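(* Assume $A=A_s$ (i.e. $A=A'$). Let $(Y^\delta,H^\delta,X^\delta)_{\delta\in\Delta}$ be a family of closed subspaces of $Y\times H\times X$ such that $X^\delta\subseteq Y^\delta$ and $\operatorname{ran}\gamma_0|_{X^\delta}\subseteq H^\delta$ for all $\delta\in\Delta$, and $$\gamma_\Delta:=\inf_{\delta\in\Delta}\ \inf_{\{u\in X^\delta\colon\partial_tu\neq0\}}\ \sup_{0\neq v\in Y^\delta}\frac{(\partial_tu)(v)}{\|\partial_tu\|_{Y'}\|v\|_Y}>0,$$ where the inner inf-sup is read as $1$ whenever $\{u\in X^\delta\colon\partial_tu\neq0\}=\emptyset$. Let $g\in Y'$, $u_0\in H$, and let $u\in X$ be the solution of $(Bu)(v_1)+\langle u(0),v_2\rangle=g(v_1)+\langle u_0,v_2\rangle$ for all $(v_1,v_2)\in Y\times H$. Then for the Galerkin solutions $(\mu^\delta,\sigma^\delta,u^\delta)\in Y^\delta\times H^\delta\times X^\delta$ of the saddle point system $$\begin{bmatrix} A_s & 0 & B \\ 0 & \mathrm{Id} & \gamma_0 \\ B' & \gamma_0' & 0 \end{bmatrix} \begin{bmatrix} \mu \\ \sigma \\ u \end{bmatrix} = \begin{bmatrix} g \\ u_0 \\ 0 \end{bmatrix},$$ i.e. the solutions of $$(A_s\mu^\delta)(v_1)+(Bu^\delta)(v_1)=g(v_1),\qquad\langle\sigma^\delta,v_2\rangle+\langle u^\delta(0),v_2\rangle=\langle u_0,v_2\rangle,\qquad(Bw)(\mu^\delta)+\langle w(0),\sigma^\delta\rangle=0$$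 for all $(v_1,v_2,w)\in Y^\delta\times H^\delta\times X^\delta$, it holds that $$\|u-u^\delta\|_X\le\gamma_\Delta^{-1}\inf_{\bar u^\delta\in X^\delta}\|u-\bar u^\delta\|_X .$$
   Context: All spaces are real. Let $V,H$ be separable Hilbert spaces (of functions on some spatial domain) with $V\hookrightarrow H$ densely and compactly; identify $H$ with its dual, giving the Gelfand triple $V\hookrightarrow H\simeq H'\hookrightarrow V'$. $\langle\cdot,\cdot\rangle$ denotes the scalar product on $H$ and also its continuous extension to the duality pairing on $V'\times V$; $\|\cdot\|$ is the norm on $H$. Let $T>0$ and $I:=(0,T)$. For a.e. $t\in I$, $a(t;\cdot,\cdot)$ is a bilinear form on $V\times V$ such that $t\mapsto a(t;\eta,\zeta)$ is measurable for all $\eta,\zeta\in V$, and, with constants independent of $t$, $|a(t;\eta,\zeta)|\lesssim\|\eta\|_V\|\zeta\|_V$ and $a(t;\eta,\eta)\gtrsim\|\eta\|_V^2$ for all $\eta,\zeta\in V$ and a.e. $t\in I$. Set $Y:=L_2(I;V)$ and $X:=L_2(I;V)\cap H^1(I;V')$. One has $X\hookrightarrow C(\bar I;H)$, and for $t\in\bar I$, $\gamma_t\colon X\to H$, $\gamma_tu:=u(t)=u(t,\cdot)$, is the bounded trace map. Define $A\colon Y\to Y'$, $(Au)(v):=\int_I a(t;u(t),v(t))\,dt$; $B\colon X\to Y'$, $(Bw)(v):=\int_I\langle\frac{dw}{dt}(t),v(t)\rangle+a(t;w(t),v(t))\,dt$; $A_s:=\frac12(A+A')$; and $\partial_t:=B-A\colon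 X\to Y'$, so $(\partial_tw)(v)=\int_I\langle\frac{dw}{dt}(t),v(t)\rangle\,dt$. Primes on operators denote dual operators. It is known that $\begin{bmatrix} B \\ \gamma_0 \end{bmatrix}\colon X\to Y'\times H$ is bounded and boundedly invertible. $Y$ and $X$ are equipped with the energy norms $\|v\|_Y^2:=(A_sv)(v)$ and $\|u\|_X^2:=\|u\|_Y^2+\|\partial_tu\|_{Y'}^2+\|u(T)\|^2$ (equivalent to the standard norms), where $\|\cdot\|_{Y'}$ is dual to $\|\cdot\|_Y$. *)

theory Defs
  imports "HOL-Analysis.Analysis"
begin

text \<open>
  The separable Hilbert spaces \<open>V\<close> and \<open>H\<close> are types; the embedding of \<open>V\<close> into \<open>H\<close> is an explicit
  bounded linear map \<open>j\<close>, and \<open>V'\<close> is the type of bounded linear functionals on \<open>V\<close>.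
  Identifying \<open>H\<close> with its dual, \<open>w :: 'v\<close> is the functional \<open>\<lambda>z. j w \<bullet> j z\<close> in \<open>V'\<close>.

  Elements of Bochner spaces on \<open>(0,T)\<close> are represented by functions on the real line, of which
  only the restriction to \<open>(0,T)\<close>, up to almost everywhere equality, is relevant.  Hence the norms
  below are seminorms on representatives; a set that is closed for them (in the sense of
  \<open>closed_subspace_of\<close>) is automatically saturated under almost everywhere equality.
\<close>

definition gelfand_embedding ::
  "('v::{real_inner,banach,second_countable_topology} \<Rightarrow>\<^sub>L
    'h::{real_inner,banach,second_countable_topology}) \<Rightarrow> bool" where
  "gelfand_embedding j \<longleftrightarrow>
     inj (blinfun_apply j) \<and>
     closure (range (blinfun_apply j)) = UNIV \<and>
     (\<forall>S. bounded S \<longrightarrow> compact (closure (blinfun_apply j ` S)))"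

abbreviation time_measure :: "real \<Rightarrow> real measure" where
  "time_measure T \<equiv> lebesgue_on {0<..<T}"

definition parabolic_form ::
  "real \<Rightarrow> (real \<Rightarrow> 'v::{real_inner,banach,second_countable_topology} \<Rightarrow> 'v \<Rightarrow> real) \<Rightarrow> bool" where
  "parabolic_form T a \<longleftrightarrow>
     (AE t in time_measure T. bilinear (a t)) \<and>
     (\<forall>x z. (\<lambda>t. a t x z) \<in> borel_measurable (time_measure T)) \<and>
     (\<exists>C. AE t in time_measure T. \<forall>x z. \<bar>a t x z\<bar> \<le> C * norm x * norm z) \<and>
     (\<exists>c>0. AE t in time_measure T. \<forall>x. a t x x \<ge> c * (norm x)\<^sup>2)"

text \<open>
  For a separable target space, Borel measurability is strong measurability; this applies to both
  \<open>V\<close> and \<open>V'\<close> (the dual of a separable Hilbert space is separable).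
\<close>

definition L2 :: "real \<Rightarrow> (real \<Rightarrow> 'b::real_normed_vector) set" where
  "L2 T = {f. f \<in> borel_measurable (time_measure T) \<and>
              integrable (time_measure T) (\<lambda>t. (norm (f t))\<^sup>2)}"

definition test_functions :: "real \<Rightarrow> (real \<Rightarrow> real) set" where
  "test_functions T = {p. (\<forall>k x. (deriv ^^ k) p field_differentiable at x) \<and>
                          closure {x. p x \<noteq> 0} \<subseteq> {0<..<T}}"

text \<open>
  The distributional derivative of a \<open>V\<close>-valued function, as a \<open>V'\<close>-valued function.  The library's
  Bochner integral needs a second-countable target type, which is not available for the type of
  functionals, so the defining identity in \<open>V'\<close> is evaluated at every \<open>z\<close> in \<open>V\<close>.
\<close>

definition weak_derivative ::
  "('v::{real_inner,banach,second_countable_topology} \<Rightarrow>\<^sub>L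
    'h::{real_inner,banach,second_countable_topology}) \<Rightarrow> real \<Rightarrow>
   (real \<Rightarrow> 'v) \<Rightarrow> (real \<Rightarrow> 'v \<Rightarrow>\<^sub>L real) \<Rightarrow> bool" where
  "weak_derivative j T w f \<longleftrightarrow>
     (\<forall>p\<in>test_functions T. \<forall>z.
        (\<integral>t. deriv p t * (j (w t) \<bullet> j z) \<partial>time_measure T) =
        - (\<integral>t. p t * f t z \<partial>time_measure T))"

definition Y_space :: "real \<Rightarrow> (real \<Rightarrow> 'v::{real_inner,banach,second_countable_topology}) set" where
  "Y_space T = L2 T"

definition X_space ::
  "('v::{real_inner,banach,second_countable_topology} \<Rightarrow>\<^sub>L
    'h::{real_inner,banach,second_countable_topology}) \<Rightarrow> real \<Rightarrow> (real \<Rightarrow> 'v) set" where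
  "X_space j T = {w \<in> L2 T. \<exists>f\<in>L2 T. weak_derivative j T w f}"

text \<open>The choice of \<open>f\<close> is unique up to almost everywhere equality.\<close>

definition time_deriv ::
  "('v::{real_inner,banach,second_countable_topology} \<Rightarrow>\<^sub>L
    'h::{real_inner,banach,second_countable_topology}) \<Rightarrow> real \<Rightarrow>
   (real \<Rightarrow> 'v) \<Rightarrow> real \<Rightarrow> 'v \<Rightarrow>\<^sub>L real" where
  "time_deriv j T w = (SOME f. f \<in> L2 T \<and> weak_derivative j T w f)"

text \<open>
  Point evaluation on \<open>[0,T]\<close> of the \<open>H\<close>-valued continuous representative, which exists for
  elements of \<open>X\<close>.
\<close>

definition time_trace ::
  "('v::{real_inner,banach,second_countable_topology} \<Rightarrow>\<^sub>L
    'h::{real_inner,banach,second_countable_topology}) \<Rightarrow> real \<Rightarrow> real \<Rightarrow> (real \<Rightarrow> 'v) \<Rightarrow> 'h" where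
  "time_trace j T t w =
     (THE h. \<exists>c. continuous_on {0..T} c \<and> (AE s in time_measure T. c s = j (w s)) \<and> c t = h)"

definition A_op ::
  "(real \<Rightarrow> 'v \<Rightarrow> 'v \<Rightarrow> real) \<Rightarrow> real \<Rightarrow>
   (real \<Rightarrow> 'v::{real_inner,banach,second_countable_topology}) \<Rightarrow> (real \<Rightarrow> 'v) \<Rightarrow> real" where
  "A_op a T w v = (\<integral>t. a t (w t) (v t) \<partial>time_measure T)"

text \<open>\<open>A' w v = A v w\<close>, by reflexivity of \<open>Y\<close>.\<close>

definition As_op ::
  "(real \<Rightarrow> 'v \<Rightarrow> 'v \<Rightarrow> real) \<Rightarrow> real \<Rightarrow>
   (real \<Rightarrow> 'v::{real_inner,banach,second_countable_topology}) \<Rightarrow> (real \<Rightarrow> 'v) \<Rightarrow> real" where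
  "As_op a T w v = (A_op a T w v + A_op a T v w) / 2"

definition B_op ::
  "('v::{real_inner,banach,second_countable_topology} \<Rightarrow>\<^sub>L
    'h::{real_inner,banach,second_countable_topology}) \<Rightarrow>
   (real \<Rightarrow> 'v \<Rightarrow> 'v \<Rightarrow> real) \<Rightarrow> real \<Rightarrow> (real \<Rightarrow> 'v) \<Rightarrow> (real \<Rightarrow> 'v) \<Rightarrow> real" where
  "B_op j a T w v =
     (\<integral>t. time_deriv j T w t (v t) + a t (w t) (v t) \<partial>time_measure T)"

definition dt_op ::
  "('v::{real_inner,banach,second_countable_topology} \<Rightarrow>\<^sub>L
    'h::{real_inner,banach,second_countable_topology}) \<Rightarrow>
   (real \<Rightarrow> 'v \<Rightarrow> 'v \<Rightarrow> real) \<Rightarrow> real \<Rightarrow> (real \<Rightarrow> 'v) \<Rightarrow> (real \<Rightarrow> 'v) \<Rightarrow> real" where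
  "dt_op j a T w v = B_op j a T w v - A_op a T w v"

definition norm_Y ::
  "(real \<Rightarrow> 'v \<Rightarrow> 'v \<Rightarrow> real) \<Rightarrow> real \<Rightarrow>
   (real \<Rightarrow> 'v::{real_inner,banach,second_countable_topology}) \<Rightarrow> real" where
  "norm_Y a T v = sqrt (As_op a T v v)"

text \<open>Functionals on \<open>Y\<close>; only the values on \<open>Y_space T\<close> are relevant.\<close>

definition Y_dual ::
  "(real \<Rightarrow> 'v \<Rightarrow> 'v \<Rightarrow> real) \<Rightarrow> real \<Rightarrow>
   ((real \<Rightarrow> 'v::{real_inner,banach,second_countable_topology}) \<Rightarrow> real) set" where
  "Y_dual a T =
     {g. (\<forall>v\<in>Y_space T. \<forall>w\<in>Y_space T. g (\<lambda>t. v t + w t) = g v + g w) \<and>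
         (\<forall>r. \<forall>v\<in>Y_space T. g (\<lambda>t. r *\<^sub>R v t) = r * g v) \<and>
         (\<exists>C. \<forall>v\<in>Y_space T. \<bar>g v\<bar> \<le> C * norm_Y a T v)}"

definition norm_Y_dual ::
  "(real \<Rightarrow> 'v \<Rightarrow> 'v \<Rightarrow> real) \<Rightarrow> real \<Rightarrow>
   ((real \<Rightarrow> 'v::{real_inner,banach,second_countable_topology}) \<Rightarrow> real) \<Rightarrow> real" where
  "norm_Y_dual a T g = (SUP v\<in>{v\<in>Y_space T. norm_Y a T v \<le> 1}. \<bar>g v\<bar>)"

definition norm_X ::
  "('v::{real_inner,banach,second_countable_topology} \<Rightarrow>\<^sub>L
    'h::{real_inner,banach,second_countable_topology}) \<Rightarrow>
   (real \<Rightarrow> 'v \<Rightarrow> 'v \<Rightarrow> real) \<Rightarrow> real \<Rightarrow> (real \<Rightarrow> 'v) \<Rightarrow> real" where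
  "norm_X j a T w =
     sqrt ((norm_Y a T w)\<^sup>2 + (norm_Y_dual a T (dt_op j a T w))\<^sup>2 + (norm (time_trace j T T w))\<^sup>2)"

definition closed_subspace_of ::
  "(real \<Rightarrow> 'v::real_normed_vector) set \<Rightarrow> ((real \<Rightarrow> 'v) \<Rightarrow> real) \<Rightarrow> (real \<Rightarrow> 'v) set \<Rightarrow> bool" where
  "closed_subspace_of S N Z \<longleftrightarrow>
     Z \<subseteq> S \<and> (\<lambda>t. 0) \<in> Z \<and>
     (\<forall>v\<in>Z. \<forall>w\<in>Z. (\<lambda>t. v t + w t) \<in> Z) \<and>
     (\<forall>r. \<forall>v\<in>Z. (\<lambda>t. r *\<^sub>R v t) \<in> Z) \<and>
     (\<forall>s. \<forall>w\<in>S. (\<forall>n::nat. s n \<in> Z) \<and> (\<lambda>n. N (\<lambda>t. s n t - w t)) \<longlonglongrightarrow> 0 \<longrightarrow> w \<in> Z)"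

text \<open>
  If \<open>Xd \<subseteq> Yd\<close>, then for \<open>w \<in> U\<close> the supremum is taken over a nonempty set, as \<open>w\<close> itself
  is not almost everywhere zero; the quotients have absolute value at most 1.
\<close>

definition inf_sup ::
  "('v::{real_inner,banach,second_countable_topology} \<Rightarrow>\<^sub>L
    'h::{real_inner,banach,second_countable_topology}) \<Rightarrow>
   (real \<Rightarrow> 'v \<Rightarrow> 'v \<Rightarrow> real) \<Rightarrow> real \<Rightarrow> (real \<Rightarrow> 'v) set \<Rightarrow> (real \<Rightarrow> 'v) set \<Rightarrow> real" where
  "inf_sup j a T Yd Xd =
     (let U = {w\<in>Xd. \<exists>v\<in>Y_space T. dt_op j a T w v \<noteq> 0} in
      if U = {} then 1
      else INF w\<in>U. SUP v\<in>{v\<in>Yd. \<not> (AE t in time_measure T. v t = 0)}.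
             dt_op j a T w v / (norm_Y_dual a T (dt_op j a T w) * norm_Y a T v))"

definition gamma_Delta ::
  "('v::{real_inner,banach,second_countable_topology} \<Rightarrow>\<^sub>L
    'h::{real_inner,banach,second_countable_topology}) \<Rightarrow>
   (real \<Rightarrow> 'v \<Rightarrow> 'v \<Rightarrow> real) \<Rightarrow> real \<Rightarrow>
   'd set \<Rightarrow> ('d \<Rightarrow> (real \<Rightarrow> 'v) set) \<Rightarrow> ('d \<Rightarrow> (real \<Rightarrow> 'v) set) \<Rightarrow> real" where
  "gamma_Delta j a T D Yd Xd = (INF d\<in>D. inf_sup j a T (Yd d) (Xd d))"

end

theory Submission
  imports Defs
begin

text \<open>
  For a symmetric form the energy norm satisfies
  \<open>\<parallel>x\<parallel>\<^sub>X\<^sup>2 = \<parallel>B x\<parallel>\<^sub>Y'\<^sup>2 + \<parallel>x(0)\<parallel>\<^sup>2\<close>: expand \<open>\<parallel>\<partial>\<^sub>t x + A x\<parallel>\<^sub>Y'\<^sup>2\<close> and use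
  \<open>2 (\<partial>\<^sub>t x)(x) = \<parallel>x(T)\<parallel>\<^sup>2 - \<parallel>x(0)\<parallel>\<^sup>2\<close>.  Let \<open>b(x)\<close> be the right-hand side with the dual norm
  of \<open>B x\<close> computed from test functions in \<open>Yd\<close> only, and let \<open>\<gamma> \<le> 1\<close> be the inf-sup constant.
  Then \<open>b(x) \<le> \<parallel>x\<parallel>\<^sub>X\<^sup>2\<close> for all \<open>x\<close>.  On
  \<open>Xd\<close>, where \<open>A w\<close> is represented by \<open>w\<close>, which lies in \<open>Yd\<close>, the same expansion together with the
  inf-sup condition gives \<open>b(w) \<ge> \<gamma>\<^sup>2 \<parallel>w\<parallel>\<^sub>X\<^sup>2\<close>.
  The discrete system says that the error \<open>e = u - ud\<close> is \<open>b\<close>-orthogonal to \<open>Xd\<close>.  Hence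
  \<open>\<gamma>\<^sup>2 \<parallel>w\<parallel>\<^sub>X\<^sup>2 \<le> b(w) \<le> b(e + w) \<le> \<parallel>e + w\<parallel>\<^sub>X\<^sup>2\<close> for all \<open>w\<close> in \<open>Xd\<close>
  (lemma \<open>galerkin_error_transversal\<close>), and in an inner product space this implies
  \<open>\<gamma> \<parallel>e\<parallel>\<^sub>X \<le> \<parallel>e + w\<parallel>\<^sub>X\<close> for these \<open>w\<close> (lemma \<open>quasi_optimal_if_transversal\<close>), which is the fact that
  a projector and its complement have the same norm.  Of the inner product structure of \<open>X\<close> only one
  inequality is needed, Stewart's theorem for the point \<open>(1-s) x + s y\<close> of a segment
  (lemma \<open>norm_X_stewart\<close>).  For the dual norm it follows from
  \<open>\<parallel>g\<parallel>\<^sup>2 = sup (2 g(v) - \<parallel>v\<parallel>\<^sup>2)\<close> by a linear substitution, so that neither Riesz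
  representation in \<open>Y\<close> nor completeness of \<open>X\<close> enters.

  What remains is the analysis of \<open>X\<close>: uniqueness of the weak derivative, existence of the
  continuous \<open>H\<close>-valued representative, and the energy identity for \<open>2 (\<partial>\<^sub>t x)(x)\<close> (lemma
  \<open>continuous_representative\<close>).  As \<open>V\<close> embeds compactly into \<open>H\<close>, there is an orthonormal basis of
  \<open>V\<close> that is orthogonal in \<open>H\<close> too.  The coefficients of \<open>x\<close> in this basis are scalar functions
  with a weak derivative, hence absolutely continuous, and obey the product rule.  So the energy
  identity holds for the truncated expansions, whose differences it bounds uniformly in time,
  and passes to the limit.  The basis also yields the Riesz representation in \<open>V\<close> and the
  measurability of the integrands.
\<close>

section \<open>Smooth bump functions\<close>

text \<open>
  The functions \<open>x\<^sup>-\<^sup>m exp(-1/x)\<close>, extended by \<open>0\<close> to \<open>x \<le> 0\<close>.  They are differentiable on the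
  whole line, and their derivatives are again combinations of such functions.
\<close>

definition flat_exp :: "nat \<Rightarrow> real \<Rightarrow> real" where
  "flat_exp m x = (if x > 0 then (1 / x) ^ m * exp (- (1 / x)) else 0)"

lemma flat_exp_tendsto_0: "(flat_exp m \<longlongrightarrow> 0) (at 0)"
proof -
  have "((\<lambda>x::real. inverse x ^ m / exp (inverse x)) \<longlongrightarrow> 0) (at_right 0)"
    by (rule filterlim_compose[OF tendsto_power_div_exp_0 filterlim_inverse_at_top_right])
  then have R: "(flat_exp m \<longlongrightarrow> 0) (at_right 0)"
    by (rule Lim_transform_eventually)
      (auto simp: eventually_at_filter flat_exp_def exp_minus field_simps)
  have L: "(flat_exp m \<longlongrightarrow> 0) (at_left 0)"
    by (rule Lim_transform_eventually[OF tendsto_const])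
      (auto simp: eventually_at_filter flat_exp_def)
  from L R show ?thesis
    by (simp add: filterlim_at_split)
qed

lemma flat_exp_has_derivative:
  "(flat_exp m has_real_derivative flat_exp (m + 2) x - m * flat_exp (m + 1) x) (at x)"
proof -
  consider "x > 0" | "x < 0" | "x = 0" by linarith
  then show ?thesis
  proof cases
    case 1
    have d: "((\<lambda>x. (1 / x) ^ m * exp (- (1 / x))) has_real_derivative
        flat_exp (m + 2) x - m * flat_exp (m + 1) x) (at x)"
    proof (cases m)
      case 0
      then show ?thesis
        using 1 by (auto intro!: derivative_eq_intros simp: flat_exp_def field_simps power2_eq_square)
    next
      case (Suc k)
      have d: "((\<lambda>x. (1 / x) ^ m * exp (- (1 / x))) has_real_derivative
          real m * (1 / x) ^ (m - Suc 0) * (- 1 / x\<^sup>2) * exp (- (1 / x)) +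
          (1 / x) ^ m * (exp (- (1 / x)) * (1 / x\<^sup>2))) (at x)"
        using 1 by (auto intro!: derivative_eq_intros simp: power2_eq_square)
      then show ?thesis
        using 1 Suc by (simp add: flat_exp_def power2_eq_square algebra_simps add_divide_distrib)
    qed
    have ev: "\<forall>\<^sub>F y in nhds x. flat_exp m y = (1 / y) ^ m * exp (- (1 / y))"
      using eventually_nhds_in_open[of "{0<..}" x] 1
      by (auto elim!: eventually_mono simp: flat_exp_def)
    show ?thesis
      by (rule DERIV_cong_ev[OF refl ev refl, THEN iffD2, OF d])
  next
    case 2
    have d: "((\<lambda>x. 0) has_real_derivative flat_exp (m + 2) x - m * flat_exp (m + 1) x) (at x)"
      using 2 by (simp add: flat_exp_def)
    have ev: "\<forall>\<^sub>F y in nhds x. flat_exp m y = 0"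
      using eventually_nhds_in_open[of "{..<0}" x] 2
      by (auto elim!: eventually_mono simp: flat_exp_def)
    show ?thesis
      by (rule DERIV_cong_ev[OF refl ev refl, THEN iffD2, OF d])
  next
    case 3
    have "((\<lambda>h. flat_exp m h / h) \<longlongrightarrow> 0) (at 0)"
      by (rule Lim_transform_eventually[OF flat_exp_tendsto_0[of "Suc m"]])
        (auto simp: eventually_at_filter flat_exp_def)
    with 3 show ?thesis
      by (simp add: DERIV_def flat_exp_def)
  qed
qed

text \<open>
  The algebra generated by the functions \<open>flat_exp m\<close> composed with affine maps.  It is closed
  under differentiation, so its members are smooth in the sense of \<open>test_functions\<close>.
\<close>

inductive_set smooth_algebra :: "(real \<Rightarrow> real) set" where
  flat: "(\<lambda>x. flat_exp m (r * x + s)) \<in> smooth_algebra"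
| const: "(\<lambda>x. c) \<in> smooth_algebra"
| add: "p \<in> smooth_algebra \<Longrightarrow> q \<in> smooth_algebra \<Longrightarrow> (\<lambda>x. p x + q x) \<in> smooth_algebra"
| mult: "p \<in> smooth_algebra \<Longrightarrow> q \<in> smooth_algebra \<Longrightarrow> (\<lambda>x. p x * q x) \<in> smooth_algebra"

lemma smooth_algebra_derivative:
  assumes "p \<in> smooth_algebra"
  shows "\<exists>q\<in>smooth_algebra. \<forall>x. (p has_real_derivative q x) (at x)"
  using assms
proof induction
  case (flat m r s)
  let ?q = "\<lambda>x. r * (flat_exp (m + 2) (r * x + s) + (- real m) * flat_exp (m + 1) (r * x + s))"
  have "?q \<in> smooth_algebra"
    by (intro smooth_algebra.intros)
  moreover have "((\<lambda>x. flat_exp m (r * x + s)) has_real_derivative ?q x) (at x)" for x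
    by (rule DERIV_chain2[where f = "flat_exp m" and g = "\<lambda>x. r * x + s", THEN DERIV_cong,
          OF flat_exp_has_derivative])
      (auto intro!: derivative_eq_intros simp: algebra_simps)
  ultimately show ?case by (intro bexI[of _ ?q]) auto
next
  case (const c)
  have "(\<lambda>x. 0) \<in> smooth_algebra"
    by (rule smooth_algebra.const)
  then show ?case by (intro bexI) auto
next
  case (add p q)
  then obtain p' q' where pq: "p' \<in> smooth_algebra" "q' \<in> smooth_algebra"
    and "\<And>x. (p has_real_derivative p' x) (at x)" "\<And>x. (q has_real_derivative q' x) (at x)"
    by blast
  then have "((\<lambda>x. p x + q x) has_real_derivative p' x + q' x) (at x)" for x
    by (auto intro!: derivative_eq_intros)
  with smooth_algebra.add[OF pq] show ?case by (intro bexI[of _ "\<lambda>x. p' x + q' x"]) auto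
next
  case (mult p q)
  then obtain p' q' where pq: "p' \<in> smooth_algebra" "q' \<in> smooth_algebra"
    and "\<And>x. (p has_real_derivative p' x) (at x)" "\<And>x. (q has_real_derivative q' x) (at x)"
    by blast
  then have "((\<lambda>x. p x * q x) has_real_derivative p' x * q x + p x * q' x) (at x)" for x
    by (auto intro!: derivative_eq_intros)
  moreover have "(\<lambda>x. p' x * q x + p x * q' x) \<in> smooth_algebra"
    using mult pq by (intro smooth_algebra.intros)
  ultimately show ?case by (intro bexI[of _ "\<lambda>x. p' x * q x + p x * q' x"]) auto
qed

lemma smooth_algebra_deriv_iterate:
  "p \<in> smooth_algebra \<Longrightarrow> (deriv ^^ k) p \<in> smooth_algebra"
proof (induction k)
  case (Suc k)
  then obtain q where "q \<in> smooth_algebra" "\<And>x. ((deriv ^^ k) p has_real_derivative q x) (at x)"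
    using smooth_algebra_derivative by blast
  moreover from this have "deriv ((deriv ^^ k) p) = q"
    by (auto intro: DERIV_imp_deriv)
  ultimately show ?case by simp
qed simp

lemma smooth_algebra_smooth:
  "p \<in> smooth_algebra \<Longrightarrow> (deriv ^^ k) p field_differentiable at x"
  using smooth_algebra_derivative[OF smooth_algebra_deriv_iterate[of p k]]
  by (auto simp: field_differentiable_def)

lemma smooth_algebra_continuous: "p \<in> smooth_algebra \<Longrightarrow> continuous_on S p"
  using smooth_algebra_smooth[of p 0]
  by (auto intro!: continuous_at_imp_continuous_on field_differentiable_imp_continuous_at)

text \<open>
  A smooth function with values in \<open>[0,1]\<close> that is positive exactly on \<open>(a,b)\<close>; as \<open>n\<close> grows,
  these functions tend pointwise to the indicator function of \<open>(a,b)\<close>.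
\<close>

definition bump :: "real \<Rightarrow> real \<Rightarrow> nat \<Rightarrow> real \<Rightarrow> real" where
  "bump a b n x = flat_exp 0 (real (Suc n) * (x - a)) * flat_exp 0 (real (Suc n) * (b - x))"

lemma bump_smooth: "bump a b n \<in> smooth_algebra"
proof -
  have "bump a b n = (\<lambda>x. flat_exp 0 (real (Suc n) * x + (- real (Suc n) * a)) *
      flat_exp 0 (- real (Suc n) * x + real (Suc n) * b))"
    by (simp add: fun_eq_iff bump_def algebra_simps)
  then show ?thesis
    by (simp only:) (intro smooth_algebra.intros)
qed

lemma bump_nonneg: "0 \<le> bump a b n x"
  and bump_le_1: "bump a b n x \<le> 1"
  and bump_pos: "0 < bump a b n x \<longleftrightarrow> a < x \<and> x < b"
  by (auto simp: bump_def flat_exp_def zero_less_mult_iff mult_le_one)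

lemma bump_outside: "\<not> (a < x \<and> x < b) \<Longrightarrow> bump a b n x = 0"
  using bump_pos[of a b n x] bump_nonneg[of a b n x] by linarith

lemma bump_tendsto_indicator: "(\<lambda>n. bump a b n x) \<longlonglongrightarrow> indicator {a<..<b} x"
proof (cases "a < x \<and> x < b")
  case True
  have *: "(\<lambda>n. flat_exp 0 (real (Suc n) * y)) \<longlonglongrightarrow> 1" if "y > 0" for y
  proof -
    have "(\<lambda>n. exp (- (inverse (real (Suc n)) * inverse y))) \<longlonglongrightarrow> exp (- (0 * inverse y))"
      by (intro tendsto_intros LIMSEQ_inverse_real_of_nat)
    then show ?thesis
      using that by (simp add: flat_exp_def zero_less_mult_iff divide_inverse mult.commute)
  qed
  show ?thesis
    using tendsto_mult[OF *[of "x - a"] *[of "b - x"]] True by (simp add: bump_def)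
next
  case False
  then show ?thesis by (auto simp: bump_outside indicator_def)
qed

lemma test_functionI:
  assumes "\<And>k x. (deriv ^^ k) p field_differentiable at x"
    and "0 < a" "b < T" and "\<And>x. p x \<noteq> 0 \<Longrightarrow> a \<le> x \<and> x \<le> b"
  shows "p \<in> test_functions T"
proof -
  have "closure {x. p x \<noteq> 0} \<subseteq> {a..b}"
    using assms(4) by (intro closure_minimal) auto
  then show ?thesis
    using assms by (auto simp: test_functions_def)
qed

lemma bump_test_function: "0 < a \<Longrightarrow> b < T \<Longrightarrow> bump a b n \<in> test_functions T"
proof (rule test_functionI[of _ a b])
  show "a \<le> x \<and> x \<le> b" if "bump a b n x \<noteq> 0" for x
    using bump_outside[of a x b n] that by argo
qed (auto intro: smooth_algebra_smooth[OF bump_smooth])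

section \<open>Scalar functions with a weak derivative\<close>

lemma finite_time_measure: "finite_measure (time_measure T)"
  by (intro finite_measure_lebesgue_on) auto

lemma sigma_finite_time_measure: "sigma_finite_measure (time_measure T)"
  using finite_time_measure by (rule finite_measure.axioms)

lemma integrable_time_const: "integrable (time_measure T) (\<lambda>t. c :: 'b::{banach, second_countable_topology})"
  using finite_measure.integrable_const[OF finite_time_measure] .

lemma borel_time_measurable: "f \<in> borel_measurable borel \<Longrightarrow> f \<in> borel_measurable (time_measure T)"
  by (intro measurable_restrict_space1 measurable_completion) simp

lemma continuous_time_measurable:
  "continuous_on UNIV f \<Longrightarrow> f \<in> borel_measurable (time_measure T)"
  by (intro borel_time_measurable borel_measurable_continuous_onI)

lemma time_AE_null_point: "AE s in time_measure T. s \<noteq> t"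
proof -
  have "AE s in lebesgue. s \<noteq> t"
    by (intro AE_completion) (rule AE_lborel_singleton)
  then show ?thesis by (simp add: AE_restrict_space_iff) (auto elim: eventually_mono)
qed

lemma integrable_bounded_mult:
  fixes f g :: "'a \<Rightarrow> real"
  assumes "integrable M f" "g \<in> borel_measurable M" "AE x in M. \<bar>g x\<bar> \<le> C"
  shows "integrable M (\<lambda>x. g x * f x)"
proof (rule Bochner_Integration.integrable_bound[of M "\<lambda>x. C * f x"])
  show "AE x in M. norm (g x * f x) \<le> norm (C * f x)"
    using assms(3) by eventually_elim (auto simp: abs_mult intro!: mult_right_mono)
qed (use assms in auto)

lemma integral_interval_zero:
  fixes k :: "real \<Rightarrow> real"
  assumes k: "integrable (time_measure T) k"
    and bump: "\<And>a b n. 0 < a \<Longrightarrow> b < T \<Longrightarrow> (\<integral>t. bump a b n t * k t \<partial>time_measure T) = 0"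
  shows "(\<integral>t. indicator {a<..<b} t * k t \<partial>time_measure T) = 0"
proof -
  have km[measurable]: "k \<in> borel_measurable (time_measure T)"
    using k by auto
  have im[measurable]: "indicator {a<..<b} \<in> borel_measurable (time_measure T)" for a b :: real
    by (intro borel_time_measurable) auto
  have 1: "(\<integral>t. indicator {a<..<b} t * k t \<partial>time_measure T) = 0" if "0 < a" "b < T" for a b
  proof -
    have "(\<lambda>n. \<integral>t. bump a b n t * k t \<partial>time_measure T) \<longlonglongrightarrow>
        (\<integral>t. indicator {a<..<b} t * k t \<partial>time_measure T)"
    proof (rule integral_dominated_convergence[where w = "\<lambda>t. \<bar>k t\<bar>"])
      show "(\<lambda>t. bump a b n t * k t) \<in> borel_measurable (time_measure T)" for n
        by (intro borel_measurable_times km borel_time_measurable borel_measurable_continuous_onI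
            smooth_algebra_continuous[OF bump_smooth])
      show "AE t in time_measure T. norm (bump a b n t * k t) \<le> \<bar>k t\<bar>" for n
        using bump_nonneg[of a b n] bump_le_1[of a b n]
        by (intro AE_I2) (auto simp: abs_mult intro!: mult_left_le_one_le)
    qed (use k in \<open>auto intro!: AE_I2 tendsto_intros bump_tendsto_indicator\<close>)
    then show ?thesis
      using bump[OF that] by (simp add: LIMSEQ_const_iff)
  qed
  \<comment> \<open>Only intervals compactly contained in \<open>(0,T)\<close> carry test functions; exhaust the others.\<close>
  let ?a = "\<lambda>n. max a 0 + 1 / Suc n" and ?b = "\<lambda>n. min b T - 1 / Suc n"
  have lim: "(\<lambda>n. 1 / real (Suc n)) \<longlonglongrightarrow> 0"
    using LIMSEQ_inverse_real_of_nat by (simp add: field_simps)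
  have "(\<lambda>n. \<integral>t. indicator {?a n<..<?b n} t * k t \<partial>time_measure T) \<longlonglongrightarrow>
      (\<integral>t. indicator {a<..<b} t * k t \<partial>time_measure T)"
  proof (rule integral_dominated_convergence[where w = "\<lambda>t. \<bar>k t\<bar>"])
    have "(\<lambda>n. indicator {?a n<..<?b n} t * k t) \<longlonglongrightarrow> indicator {a<..<b} t * k t"
      if t: "t \<in> {0<..<T}" for t
    proof -
      have "\<forall>\<^sub>F n in sequentially. indicator {?a n<..<?b n} t = (indicator {a<..<b} t :: real)"
      proof (cases "a < t \<and> t < b")
        case True
        have "?a \<longlonglongrightarrow> max a 0 + 0" "?b \<longlonglongrightarrow> min b T - 0"
          by (intro tendsto_intros lim)+
        then have "\<forall>\<^sub>F n in sequentially. ?a n < t" "\<forall>\<^sub>F n in sequentially. t < ?b n"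
          using True t by (auto intro!: order_tendstoD)
        then show ?thesis
          by eventually_elim (use True in auto)
      next
        case False
        then have "\<not> (?a n < t \<and> t < ?b n)" for n
        proof -
          have "1 / real (Suc n) > 0" by simp
          then show ?thesis using False by linarith
        qed
        then show ?thesis using False by (auto simp: indicator_def)
      qed
      then show ?thesis
        by (intro tendsto_mult tendsto_const) (rule tendsto_eventually)
    qed
    then show "AE t in time_measure T. (\<lambda>n. indicator {?a n<..<?b n} t * k t)
        \<longlonglongrightarrow> indicator {a<..<b} t * k t"
      by (intro AE_I2) simp
    show "(\<lambda>t. indicator {?a n<..<?b n} t * k t) \<in> borel_measurable (time_measure T)" for n
      by measurable
    show "AE t in time_measure T. norm (indicator {?a n<..<?b n} t * k t) \<le> \<bar>k t\<bar>" for n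
      by (intro AE_I2) (auto simp: indicator_def)
    show "(\<lambda>t. indicator {a<..<b} t * k t) \<in> borel_measurable (time_measure T)"
      by measurable
  qed (use k in auto)
  moreover have "(\<integral>t. indicator {?a n<..<?b n} t * k t \<partial>time_measure T) = 0" for n
  proof (rule 1)
    have "1 / real (Suc n) > 0" by simp
    then show "0 < ?a n" "?b n < T" by linarith+
  qed
  ultimately show ?thesis
    by (simp add: LIMSEQ_const_iff)
qed

text \<open>
  The fundamental lemma of the calculus of variations.  The integral of \<open>k\<close> vanishes on intervals,
  hence on Borel sets by Dynkin's lemma, hence on Lebesgue sets.
\<close>

lemma AE_zero_if_bump_integrals_zero:
  fixes k :: "real \<Rightarrow> real"
  assumes k: "integrable (time_measure T) k"
    and bump: "\<And>a b n. 0 < a \<Longrightarrow> b < T \<Longrightarrow> (\<integral>t. bump a b n t * k t \<partial>time_measure T) = 0"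
  shows "AE t in time_measure T. k t = 0"
proof -
  let ?M = "time_measure T"
  have sets: "A \<inter> {0<..<T} \<in> sets ?M" if "A \<in> sets borel" for A
    using that by (subst sets_restrict_space_iff) auto
  have km[measurable]: "k \<in> borel_measurable ?M"
    using k by auto
  have im: "indicator A \<in> borel_measurable ?M" if "A \<in> sets borel" for A :: "real set"
    using that by (intro borel_time_measurable) auto
  have int: "integrable ?M (\<lambda>t. indicator A t * k t)" if "A \<in> sets borel" for A
    by (intro integrable_bounded_mult[where C = 1] k im[OF that]) (auto simp: indicator_def)
  have borel: "(\<integral>t. indicator A t * k t \<partial>?M) = 0" if "A \<in> sets borel" for A
  proof -
    have sub: "range (\<lambda>(a::real, b). {a<..<b}) \<subseteq> Pow UNIV"
      by simp
    have A: "A \<in> sigma_sets UNIV (range (\<lambda>(a::real, b). {a<..<b}))"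
      using that unfolding borel_eq_box by (simp add: split_beta' box_real)
    have "Int_stable (range (\<lambda>(a::real, b). {a<..<b}))"
      by (auto simp: Int_stable_def image_iff)
    from this sub A show ?thesis
    proof (induction rule: sigma_sets_induct_disjoint)
      case (basic A)
      then show ?case using integral_interval_zero[OF k bump] by auto
    next
      case empty
      show ?case by simp
    next
      case (compl A)
      then have A: "A \<in> sets borel"
        unfolding borel_eq_box by (simp add: split_beta' box_real)
      have "(\<integral>t. indicator (UNIV - A) t * k t \<partial>?M) =
          (\<integral>t. indicator {0<..<T} t * k t - indicator A t * k t \<partial>?M)"
        by (intro Bochner_Integration.integral_cong) (auto simp: indicator_def)
      also have "\<dots> = 0"
        using integral_interval_zero[OF k bump, of 0 T] compl int[OF A] int[of "{0<..<T}"]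
        by (subst Bochner_Integration.integral_diff) auto
      finally show ?case .
    next
      case (union A)
      then have A: "A i \<in> sets borel" for i
        unfolding borel_eq_box by (auto simp: split_beta' box_real)
      have S: "A i \<inter> {0<..<T} \<in> sets ?M" for i
        by (rule sets[OF A])
      have "(\<integral>t. indicator (\<Union>i. A i) t * k t \<partial>?M) = 
          (LINT t : (\<Union>i. A i \<inter> {0<..<T}) | ?M. k t)"
        unfolding set_lebesgue_integral_def
        by (intro Bochner_Integration.integral_cong) (auto simp: indicator_def)
      also have "\<dots> = (\<Sum>i. LINT t : A i \<inter> {0<..<T} | ?M. k t)"
      proof (rule lebesgue_integral_countable_add)
        show "set_integrable ?M (\<Union>i. A i \<inter> {0<..<T}) k"
          unfolding set_integrable_def
          by (intro integrable_mult_indicator k sets.countable_UN image_subsetI S)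
        show "(A i \<inter> {0<..<T}) \<inter> (A l \<inter> {0<..<T}) = {}" if "i \<noteq> l" for i l
          using disjoint_family_onD[OF union(1) _ _ that] by blast
      qed (rule S)
      also have "(\<lambda>i. LINT t : A i \<inter> {0<..<T} | ?M. k t) = (\<lambda>i. \<integral>t. indicator (A i) t * k t \<partial>?M)"
        unfolding set_lebesgue_integral_def
        by (intro ext Bochner_Integration.integral_cong) (auto simp: indicator_def)
      finally show ?case by (simp only: union.IH suminf_zero)
    qed
  qed
  show ?thesis
  proof (rule sigma_finite_measure.density_zero[OF sigma_finite_time_measure k])
    fix A assume "A \<in> sets ?M"
    then have A: "A \<in> sets lebesgue" "A \<subseteq> {0<..<T}"
      by (auto simp: sets_restrict_space)
    let ?B = "main_part lborel A"
    have "AE t in lborel. t \<in> ?B \<longleftrightarrow> t \<in> A"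
      using A by (intro AE_in_main_part) auto
    then have "AE t in lebesgue. t \<in> ?B \<longleftrightarrow> t \<in> A"
      by (rule AE_completion)
    then have ae: "AE t in ?M. t \<in> ?B \<longleftrightarrow> t \<in> A"
      by (simp add: AE_restrict_space_iff) (auto elim: eventually_mono)
    have B: "?B \<in> sets borel"
      using main_part_sets[of A lborel] A by simp
    have "(LINT t : A | ?M. k t) = (\<integral>t. indicator ?B t * k t \<partial>?M)"
      unfolding set_lebesgue_integral_def
    proof (rule integral_cong_AE)
      show "(\<lambda>t. indicator A t *\<^sub>R k t) \<in> borel_measurable ?M"
        using \<open>A \<in> sets ?M\<close> by measurable
      show "(\<lambda>t. indicator ?B t * k t) \<in> borel_measurable ?M"
        by (intro borel_measurable_times im[OF B] km)
      show "AE t in ?M. indicator A t *\<^sub>R k t = indicator ?B t * k t"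
        using ae by eventually_elim (simp add: indicator_def)
    qed
    then show "(LINT t : A | ?M. k t) = 0"
      using borel[OF B] by simp
  qed
qed

text \<open>
  The primitive \<open>t \<mapsto> \<integral>\<^sub>0\<^sup>t f\<close> on \<open>[0,T]\<close>.  Being defined by an indicator function, it is a function
  on the whole line that is constant outside \<open>[0,T]\<close>.
\<close>

definition primitive :: "real \<Rightarrow> (real \<Rightarrow> real) \<Rightarrow> real \<Rightarrow> real" where
  "primitive T f t = (\<integral>s. indicator {..<t} s * f s \<partial>time_measure T)"

lemma primitive_eq_antiderivative:
  assumes r: "continuous_on UNIV r" and p: "\<And>x. (p has_real_derivative r x) (at x)"
    and t: "0 \<le> t" "t \<le> T"
  shows "primitive T r t = p t - p 0"
proof -
  have [measurable]: "r \<in> borel_measurable borel"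
    using r by (rule borel_measurable_continuous_onI)
  have "primitive T r t =
      (\<integral>s. indicator {0<..<T} s *\<^sub>R (indicator {..<t} s * r s) \<partial>lebesgue)"
    unfolding primitive_def by (subst integral_restrict_space) auto
  also have "\<dots> = (\<integral>s. indicator {0<..<T} s *\<^sub>R (indicator {..<t} s * r s) \<partial>lborel)"
    by (rule integral_completion) measurable
  also have "\<dots> = (\<integral>s. r s * indicator {0..t} s \<partial>lborel)"
  proof (rule integral_cong_AE)
    show "AE s in lborel. indicator {0<..<T} s *\<^sub>R (indicator {..<t} s * r s) = r s * indicator {0..t} s"
      using AE_lborel_singleton[of 0] AE_lborel_singleton[of t]
      by eventually_elim (use t in \<open>auto simp: indicator_def\<close>)
  qed measurable
  also have "\<dots> = p t - p 0"
    using t r by (intro integral_FTC_Icc_real p) (auto simp: continuous_on_eq_continuous_at)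
  finally show ?thesis .
qed

lemma indicator_lessThan_measurable [measurable]:
  "indicator {..<t::real} \<in> borel_measurable (time_measure T)"
  by (rule borel_time_measurable) simp

lemma integrable_indicator_lessThan:
  fixes f :: "real \<Rightarrow> real"
  shows "integrable (time_measure T) f \<Longrightarrow> integrable (time_measure T) (\<lambda>s. indicator {..<t} s * f s)"
  by (rule integrable_bounded_mult[where C = 1]) (auto split: split_indicator)

lemma primitive_add:
  assumes "integrable (time_measure T) f" "integrable (time_measure T) g"
  shows "primitive T (\<lambda>s. f s + g s) t = primitive T f t + primitive T g t"
  using integrable_indicator_lessThan[OF assms(1)] integrable_indicator_lessThan[OF assms(2)]
  by (simp add: primitive_def distrib_left)

lemma primitive_mult: "primitive T (\<lambda>s. c * f s) t = c * primitive T f t"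
  by (simp add: primitive_def mult.left_commute)

lemma primitive_0: "primitive T f 0 = 0"
proof -
  have "primitive T f 0 = (\<integral>s. 0 \<partial>time_measure T)"
    unfolding primitive_def by (intro Bochner_Integration.integral_cong) auto
  then show ?thesis by simp
qed

lemma primitive_end: "primitive T f T = (\<integral>s. f s \<partial>time_measure T)"
  unfolding primitive_def by (intro Bochner_Integration.integral_cong) auto

lemma continuous_primitive:
  assumes f: "integrable (time_measure T) f"
  shows "continuous_on UNIV (primitive T f)"
proof (intro continuous_at_imp_continuous_on ballI)
  fix t :: real
  have [measurable]: "f \<in> borel_measurable (time_measure T)"
    using f by auto
  have "(\<lambda>n. primitive T f (x n)) \<longlonglongrightarrow> primitive T f t" if x: "x \<longlonglongrightarrow> t" for x :: "nat \<Rightarrow> real"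
    unfolding primitive_def
  proof (rule integral_dominated_convergence[where w = "\<lambda>s. \<bar>f s\<bar>"])
    show "AE s in time_measure T. (\<lambda>n. indicator {..<x n} s * f s) \<longlonglongrightarrow> indicator {..<t} s * f s"
      using time_AE_null_point[of t T]
    proof eventually_elim
      case (elim s)
      have "\<forall>\<^sub>F n in sequentially. indicator {..<x n} s = (indicator {..<t} s :: real)"
      proof (cases "s < t")
        case True
        from order_tendstoD(1)[OF x this] show ?thesis
          by (rule eventually_mono) (use True in auto)
      next
        case False
        with elim have "t < s" by simp
        from order_tendstoD(2)[OF x this] show ?thesis
          by (rule eventually_mono) (use \<open>t < s\<close> in auto)
      qed
      then show ?case
        by (intro tendsto_mult tendsto_const) (rule tendsto_eventually)
    qed
    show "AE s in time_measure T. norm (indicator {..<x n} s * f s) \<le> \<bar>f s\<bar>" for n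
      by (intro AE_I2) (auto simp: indicator_def)
    show "(\<lambda>s. indicator {..<t} s * f s) \<in> borel_measurable (time_measure T)"
      "(\<lambda>s. indicator {..<x n} s * f s) \<in> borel_measurable (time_measure T)" for n
      by measurable
  qed (use f in simp)
  then show "isCont (primitive T f) t"
    by (auto simp: continuous_at_sequentially o_def)
qed

lemma abs_primitive_le:
  assumes "integrable (time_measure T) f"
  shows "\<bar>primitive T f t\<bar> \<le> (\<integral>s. \<bar>f s\<bar> \<partial>time_measure T)"
proof -
  have "\<bar>primitive T f t\<bar> \<le> (\<integral>s. \<bar>indicator {..<t} s * f s\<bar> \<partial>time_measure T)"
    unfolding primitive_def by (rule integral_abs_bound)
  also have "\<dots> \<le> (\<integral>s. \<bar>f s\<bar> \<partial>time_measure T)"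
    using assms integrable_indicator_lessThan[OF assms]
    by (intro integral_mono) (auto split: split_indicator)
  finally show ?thesis .
qed

lemma integrable_primitive_mult:
  assumes "integrable (time_measure T) f" "integrable (time_measure T) g"
  shows "integrable (time_measure T) (\<lambda>s. primitive T f s * g s)"
  using assms abs_primitive_le
  by (intro integrable_bounded_mult continuous_time_measurable continuous_primitive AE_I2) auto

text \<open>
  Product rule for absolutely continuous functions.  Both sides are the integral of
  \<open>\<alpha> s * \<beta> r\<close> over the square \<open>s, r < t\<close>, on the right divided along the diagonal.
\<close>

lemma primitive_product:
  assumes \<alpha>: "integrable (time_measure T) \<alpha>" and \<beta>: "integrable (time_measure T) \<beta>"
  shows "primitive T \<alpha> t * primitive T \<beta> t =
    primitive T (\<lambda>s. \<alpha> s * primitive T \<beta> s + primitive T \<alpha> s * \<beta> s) t"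
proof -
  let ?M = "time_measure T"
  interpret M: sigma_finite_measure ?M
    by (rule sigma_finite_time_measure)
  interpret P: pair_sigma_finite ?M ?M ..
  have am[measurable]: "\<alpha> \<in> borel_measurable ?M" and bm[measurable]: "\<beta> \<in> borel_measurable ?M"
    using \<alpha> \<beta> by auto
  define a where "a = (\<lambda>s. indicator {..<t} s * \<alpha> s)"
  define b where "b = (\<lambda>s. indicator {..<t} s * \<beta> s)"
  have a: "integrable ?M a" and b: "integrable ?M b"
    unfolding a_def b_def by (intro integrable_indicator_lessThan \<alpha> \<beta>)+
  have [measurable]: "a \<in> borel_measurable ?M" "b \<in> borel_measurable ?M"
    using a b by auto
  have id[measurable]: "(\<lambda>x. x) \<in> ?M \<rightarrow>\<^sub>M borel"
    by (rule borel_time_measurable) simp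
  have ab: "integrable (?M \<Otimes>\<^sub>M ?M) (\<lambda>(s, r). a s * b r)"
  proof (rule P.Fubini_integrable)
    show "integrable ?M (\<lambda>s. \<integral>r. norm (case (s, r) of (s, r) \<Rightarrow> a s * b r) \<partial>?M)"
      using a by (simp add: abs_mult)
    show "AE s in ?M. integrable ?M (\<lambda>r. case (s, r) of (s, r) \<Rightarrow> a s * b r)"
      using b by simp
  qed measurable
  have lt: "integrable (?M \<Otimes>\<^sub>M ?M) (\<lambda>(s, r). of_bool (r < s) * (a s * b r))"
    by (rule Bochner_Integration.integrable_bound[OF ab]) (auto intro!: AE_I2 simp: split_beta')
  have ge: "integrable (?M \<Otimes>\<^sub>M ?M) (\<lambda>(s, r). of_bool (s \<le> r) * (a s * b r))"
    by (rule Bochner_Integration.integrable_bound[OF ab]) (auto intro!: AE_I2 simp: split_beta')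
  have le: "(\<integral>s. of_bool (s \<le> r) * f s \<partial>?M) = primitive T f r" 
    if [measurable]: "f \<in> borel_measurable ?M" for f r
    unfolding primitive_def using time_AE_null_point[of r T]
    by (intro integral_cong_AE) (auto elim!: eventually_mono simp: indicator_def)
  have "primitive T \<alpha> t * primitive T \<beta> t = (\<integral>s. (\<integral>r. a s * b r \<partial>?M) \<partial>?M)"
    by (simp add: primitive_def a_def b_def)
  also have "\<dots> = (\<integral>(s, r). a s * b r \<partial>(?M \<Otimes>\<^sub>M ?M))"
    using P.integral_fst'[OF ab] by simp
  also have "\<dots> = (\<integral>x. (case x of (s, r) \<Rightarrow> of_bool (r < s) * (a s * b r)) +
      (case x of (s, r) \<Rightarrow> of_bool (s \<le> r) * (a s * b r)) \<partial>(?M \<Otimes>\<^sub>M ?M))"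
    by (intro Bochner_Integration.integral_cong) auto
  also have "\<dots> = (\<integral>(s, r). of_bool (r < s) * (a s * b r) \<partial>(?M \<Otimes>\<^sub>M ?M)) +
      (\<integral>(s, r). of_bool (s \<le> r) * (a s * b r) \<partial>(?M \<Otimes>\<^sub>M ?M))"
    by (intro Bochner_Integration.integral_add lt ge)
  also have "(\<integral>(s, r). of_bool (r < s) * (a s * b r) \<partial>(?M \<Otimes>\<^sub>M ?M)) =
      (\<integral>s. (\<integral>r. of_bool (r < s) * (a s * b r) \<partial>?M) \<partial>?M)"
    using P.integral_fst'[OF lt] by simp
  also have "\<dots> = (\<integral>s. indicator {..<t} s * (\<alpha> s * primitive T \<beta> s) \<partial>?M)"
  proof (rule Bochner_Integration.integral_cong[OF refl])
    fix s
    have "(\<integral>r. of_bool (r < s) * (a s * b r) \<partial>?M) = a s * (\<integral>r. of_bool (r < s) * b r \<partial>?M)"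
      by (simp add: mult.left_commute)
    also have "\<dots> = a s * primitive T \<beta> s"
    proof (cases "s < t")
      case True
      then have "(\<integral>r. of_bool (r < s) * b r \<partial>?M) = primitive T \<beta> s"
        unfolding primitive_def b_def
        by (intro Bochner_Integration.integral_cong) (auto simp: indicator_def)
      then show ?thesis by simp
    qed (simp add: a_def)
    finally show "(\<integral>r. of_bool (r < s) * (a s * b r) \<partial>?M) = indicator {..<t} s * (\<alpha> s * primitive T \<beta> s)"
      by (simp add: a_def)
  qed
  also have "(\<integral>(s, r). of_bool (s \<le> r) * (a s * b r) \<partial>(?M \<Otimes>\<^sub>M ?M)) =
      (\<integral>r. (\<integral>s. of_bool (s \<le> r) * (a s * b r) \<partial>?M) \<partial>?M)"
    using P.integral_snd[OF ge] by simp
  also have "\<dots> = (\<integral>r. indicator {..<t} r * (primitive T \<alpha> r * \<beta> r) \<partial>?M)"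
  proof (rule Bochner_Integration.integral_cong[OF refl])
    fix r
    have "(\<integral>s. of_bool (s \<le> r) * (a s * b r) \<partial>?M) = b r * (\<integral>s. of_bool (s \<le> r) * a s \<partial>?M)"
      by (subst integral_mult_right_zero[symmetric]) (simp add: mult_ac)
    also have "\<dots> = b r * primitive T \<alpha> r"
    proof (cases "r < t")
      case True
      then have "(\<integral>s. of_bool (s \<le> r) * a s \<partial>?M) = (\<integral>s. of_bool (s \<le> r) * \<alpha> s \<partial>?M)"
        unfolding a_def by (intro Bochner_Integration.integral_cong) (auto simp: indicator_def)
      then show ?thesis by (simp add: le)
    qed (simp add: b_def)
    finally show "(\<integral>s. of_bool (s \<le> r) * (a s * b r) \<partial>?M) = indicator {..<t} r * (primitive T \<alpha> r * \<beta> r)"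
      by (simp add: b_def)
  qed
  also have "(\<integral>s. indicator {..<t} s * (\<alpha> s * primitive T \<beta> s) \<partial>?M) +
      (\<integral>r. indicator {..<t} r * (primitive T \<alpha> r * \<beta> r) \<partial>?M) =
      primitive T (\<lambda>s. \<alpha> s * primitive T \<beta> s + primitive T \<alpha> s * \<beta> s) t"
  proof -
    have "integrable ?M (\<lambda>s. \<alpha> s * primitive T \<beta> s)"
      using integrable_primitive_mult[OF \<beta> \<alpha>] by (simp add: mult.commute)
    from primitive_add[OF this integrable_primitive_mult[OF \<alpha> \<beta>], of t] show ?thesis
      by (simp only: primitive_def)
  qed
  finally show ?thesis .
qed

lemma test_function_differentiable:
  "p \<in> test_functions T \<Longrightarrow> (deriv ^^ k) p field_differentiable at x"
  by (simp add: test_functions_def)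

lemma test_function_has_derivative:
  assumes "p \<in> test_functions T"
  shows "(p has_real_derivative deriv p x) (at x)"
  using test_function_differentiable[OF assms, of 0 x]
  by (simp add: field_differentiable_derivI)

lemma continuous_test_function:
  "p \<in> test_functions T \<Longrightarrow> continuous_on UNIV p"
  "p \<in> test_functions T \<Longrightarrow> continuous_on UNIV (deriv p)"
  using test_function_differentiable[of p T 0] test_function_differentiable[of p T 1]
  by (auto intro!: continuous_at_imp_continuous_on field_differentiable_imp_continuous_at)

lemma test_function_outside:
  assumes "p \<in> test_functions T" "\<not> (0 < x \<and> x < T)"
  shows "p x = 0"
  using assms closure_subset[of "{x. p x \<noteq> 0}"] by (force simp: test_functions_def)

lemma integrable_continuous_mult:
  fixes f :: "real \<Rightarrow> real"
  assumes "continuous_on UNIV p" "integrable (time_measure T) f"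
  shows "integrable (time_measure T) (\<lambda>t. p t * f t)"
proof -
  have "compact (p ` {0..T})"
    using assms(1) by (intro compact_continuous_image) (auto intro: continuous_on_subset)
  then obtain C where "\<forall>x\<in>p ` {0..T}. norm x \<le> C"
    using compact_imp_bounded bounded_iff by metis
  then show ?thesis
    using assms by (intro integrable_bounded_mult[where C = C] continuous_time_measurable AE_I2) auto
qed

lemma primitive_deriv_test_function:
  assumes "p \<in> test_functions T" "0 \<le> t" "t \<le> T"
  shows "primitive T (deriv p) t = p t"
  using primitive_eq_antiderivative[of "deriv p" p t T] test_function_has_derivative[OF assms(1)]
    continuous_test_function[OF assms(1)] test_function_outside[OF assms(1), of 0] assms by simp

lemma integrable_time_continuous:
  assumes "continuous_on UNIV p"
  shows "integrable (time_measure T) (p :: real \<Rightarrow> real)"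
  using integrable_continuous_mult[OF assms integrable_time_const[of T 1]] by simp

text \<open>Du Bois-Reymond: a function whose distributional derivative vanishes is constant.\<close>

lemma AE_constant_if_weak_derivative_zero:
  assumes T: "T > 0" and h: "integrable (time_measure T) h"
    and zero: "\<And>p. p \<in> test_functions T \<Longrightarrow> (\<integral>t. deriv p t * h t \<partial>time_measure T) = 0"
  shows "\<exists>C. AE t in time_measure T. h t = C"
proof -
  let ?M = "time_measure T"
  define \<rho> where "\<rho> = bump (T / 4) (3 * T / 4) 0"
  have \<rho>: "\<rho> \<in> smooth_algebra"
    unfolding \<rho>_def by (rule bump_smooth)
  have int: "integrable ?M q" "integrable ?M (\<lambda>t. q t * h t)" if "q \<in> smooth_algebra" for q
    by (intro integrable_time_continuous integrable_continuous_mult h smooth_algebra_continuous that)+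
  have "\<not> (AE t in ?M. \<rho> t = 0)"
  proof
    assume "AE t in ?M. \<rho> t = 0"
    then have "AE t\<in>{0<..<T} in lebesgue. t \<in> {t. \<rho> t = 0}"
      by (simp add: AE_restrict_space_iff)
    moreover have "closed {t. \<rho> t = 0}"
      by (rule closed_Collect_eq[OF smooth_algebra_continuous[OF \<rho>] continuous_on_const])
    ultimately have "T / 2 \<in> {t. \<rho> t = 0}"
      using T by (intro mem_closed_if_AE_lebesgue_open[of "{0<..<T}" "{t. \<rho> t = 0}" "T / 2"]) simp_all
    moreover have "\<rho> (T / 2) > 0"
      using T by (simp add: \<rho>_def bump_pos)
    ultimately show False by simp
  qed
  then have I: "(\<integral>t. \<rho> t \<partial>?M) \<noteq> 0"
    using integral_nonneg_eq_0_iff_AE[OF int(1)[OF \<rho>]] by (auto simp: \<rho>_def bump_nonneg)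
  define C where "C = (\<integral>t. \<rho> t * h t \<partial>?M) / (\<integral>t. \<rho> t \<partial>?M)"
  have "AE t in ?M. h t - C = 0"
  proof (rule AE_zero_if_bump_integrals_zero)
    show "integrable ?M (\<lambda>t. h t - C)"
      using h by (intro Bochner_Integration.integrable_diff integrable_time_const)
    fix a b :: real and n assume ab: "0 < a" "b < T"
    define q where "q = bump a b n"
    have q: "q \<in> smooth_algebra"
      unfolding q_def by (rule bump_smooth)
    define c where "c = (\<integral>t. q t \<partial>?M) / (\<integral>t. \<rho> t \<partial>?M)"
    \<comment> \<open>As \<open>r\<close> has mean zero, its primitive is again a test function.\<close>
    define r where "r = (\<lambda>t. q t + (- c) * \<rho> t)"
    have r: "r \<in> smooth_algebra"
      unfolding r_def by (intro smooth_algebra.intros q \<rho>)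
    have "\<exists>F. \<forall>t. -\<infinity> < ereal t \<longrightarrow> ereal t < \<infinity> \<longrightarrow> (F has_vector_derivative r t) (at t)"
      using smooth_algebra_continuous[OF r, of UNIV]
      by (intro einterval_antiderivative) (auto simp: continuous_on_eq_continuous_at)
    then obtain F where F: "(F has_real_derivative r t) (at t)" for t
      by (auto simp: has_real_derivative_iff_has_vector_derivative)
    define p where "p = (\<lambda>t. F t - F 0)"
    have p: "(p has_real_derivative r t) (at t)" for t
      unfolding p_def by (auto intro!: derivative_eq_intros F)
    then have dp: "deriv p = r"
      by (auto intro: DERIV_imp_deriv)
    have "(\<integral>t. r t \<partial>?M) = 0"
      unfolding r_def using int(1)[OF q] int(1)[OF \<rho>] I by (simp add: c_def)
    then have pT: "p T = 0"
      using primitive_eq_antiderivative[OF smooth_algebra_continuous[OF r] p, of T T] T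
      by (simp add: primitive_end p_def)
    define \<alpha> where "\<alpha> = min a (T / 4)"
    define \<beta> where "\<beta> = max b (3 * T / 4)"
    have \<alpha>\<beta>: "0 < \<alpha>" "\<alpha> < T" "0 < \<beta>" "\<beta> < T"
      using ab T by (auto simp: \<alpha>_def \<beta>_def)
    have r0: "r t = 0" if "t \<le> \<alpha> \<or> \<beta> \<le> t" for t
      using that bump_outside[of a t b n] bump_outside[of "T/4" t "3*T/4" 0]
      by (auto simp: r_def q_def \<rho>_def \<alpha>_def \<beta>_def)
    have "p \<in> test_functions T"
    proof (rule test_functionI[of _ \<alpha> \<beta>])
      show "(deriv ^^ k) p field_differentiable at x" for k x
      proof (cases k)
        case 0
        then show ?thesis using p[of x] by (auto simp: field_differentiable_def)
      next
        case (Suc l)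
        then have "(deriv ^^ k) p = (deriv ^^ l) r"
          by (simp only: funpow_Suc_right o_apply dp)
        then show ?thesis using smooth_algebra_smooth[OF r] by simp
      qed
      fix t assume nz: "p t \<noteq> 0"
      show "\<alpha> \<le> t \<and> t \<le> \<beta>"
      proof (rule ccontr)
        assume "\<not> (\<alpha> \<le> t \<and> t \<le> \<beta>)"
        then have t: "t < \<alpha> \<or> \<beta> < t" by linarith
        have p0: "(p has_real_derivative 0) (at x within S)" if "x \<le> \<alpha> \<or> \<beta> \<le> x" for x S
          using p[of x] r0[OF that] by (simp add: has_field_derivative_at_within)
        have "\<exists>c. \<forall>x\<in>{..\<alpha>}. p x = c" "\<exists>c. \<forall>x\<in>{\<beta>..}. p x = c"
          by (rule has_field_derivative_zero_constant; use p0 in auto)+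
        then have "t < \<alpha> \<Longrightarrow> p t = p 0" "\<beta> < t \<Longrightarrow> p t = p T"
          using \<alpha>\<beta> by fastforce+
        with t pT have "p t = 0" by (auto simp: p_def)
        with nz show False ..
      qed
    qed (use \<alpha>\<beta> in auto)
    from zero[OF this] have "0 = (\<integral>t. q t * h t - c * (\<rho> t * h t) \<partial>?M)"
      by (simp add: dp r_def algebra_simps)
    also have "\<dots> = (\<integral>t. q t * h t \<partial>?M) - c * (\<integral>t. \<rho> t * h t \<partial>?M)"
      using int[OF q] int[OF \<rho>] by simp
    also have "c * (\<integral>t. \<rho> t * h t \<partial>?M) = (\<integral>t. q t * C \<partial>?M)"
      by (simp add: c_def C_def)
    finally show "(\<integral>t. bump a b n t * (h t - C) \<partial>?M) = 0"
      using int[OF q] by (simp add: q_def right_diff_distrib)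
  qed
  then show ?thesis by (intro exI[of _ C]) simp
qed

text \<open>
  An integrable function with integrable distributional derivative is absolutely continuous.
\<close>

lemma weak_derivative_imp_primitive:
  assumes T: "T > 0" and \<phi>: "integrable (time_measure T) \<phi>" and \<psi>: "integrable (time_measure T) \<psi>"
    and weak: "\<And>p. p \<in> test_functions T \<Longrightarrow>
      (\<integral>t. deriv p t * \<phi> t \<partial>time_measure T) = - (\<integral>t. p t * \<psi> t \<partial>time_measure T)"
  shows "\<exists>C. AE t in time_measure T. \<phi> t = C + primitive T \<psi> t"
proof -
  let ?M = "time_measure T"
  have P: "integrable ?M (primitive T \<psi>)"
    by (intro integrable_time_continuous continuous_primitive \<psi>)
  have "\<exists>C. AE t in ?M. \<phi> t - primitive T \<psi> t = C"
  proof (rule AE_constant_if_weak_derivative_zero[OF T])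
    fix p assume p: "p \<in> test_functions T"
    note cont = continuous_test_function[OF p]
    have dp: "integrable ?M (deriv p)"
      by (intro integrable_time_continuous cont)
    have pp: "primitive T (deriv p) t = p t" if "0 < t" "t < T" for t
      using primitive_deriv_test_function[OF p] that by simp
    have "0 = primitive T (deriv p) T * primitive T \<psi> T"
      using primitive_deriv_test_function[OF p, of T] test_function_outside[OF p, of T] T by simp
    also have "\<dots> = (\<integral>t. deriv p t * primitive T \<psi> t + primitive T (deriv p) t * \<psi> t \<partial>?M)"
      by (subst primitive_product[OF dp \<psi>]) (rule primitive_end)
    also have "\<dots> = (\<integral>t. deriv p t * primitive T \<psi> t + p t * \<psi> t \<partial>?M)"
      by (intro Bochner_Integration.integral_cong) (auto simp: pp)
    also have "\<dots> = (\<integral>t. deriv p t * primitive T \<psi> t \<partial>?M) + (\<integral>t. p t * \<psi> t \<partial>?M)"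
      by (intro Bochner_Integration.integral_add integrable_continuous_mult cont P \<psi>)
    finally show "(\<integral>t. deriv p t * (\<phi> t - primitive T \<psi> t) \<partial>?M) = 0"
      using weak[OF p] integrable_continuous_mult[OF cont(2) \<phi>] integrable_continuous_mult[OF cont(2) P]
      by (simp add: right_diff_distrib)
  qed (use \<phi> P in auto)
  then show ?thesis
    by (auto simp: algebra_simps)
qed

section \<open>A basis orthogonal in both spaces of the Gelfand triple\<close>

lemma CauchyI_norm_square_le:
  fixes x :: "nat \<Rightarrow> 'a::real_normed_vector"
  assumes b: "b \<longlonglongrightarrow> (0::real)" and le: "\<And>m n. (norm (x n - x m))\<^sup>2 \<le> b n + b m"
  shows "Cauchy x"
proof (rule metric_CauchyI)
  fix \<epsilon> :: real assume \<epsilon>: "\<epsilon> > 0"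
  then have "\<forall>\<^sub>F n in sequentially. b n < \<epsilon>\<^sup>2 / 2"
    by (intro order_tendstoD(2)[OF b]) simp
  then obtain N where N: "\<And>n. n \<ge> N \<Longrightarrow> b n < \<epsilon>\<^sup>2 / 2"
    by (auto simp: eventually_sequentially)
  have "norm (x n - x m) < \<epsilon>" if "m \<ge> N" "n \<ge> N" for m n
  proof (rule power2_less_imp_less)
    show "(norm (x n - x m))\<^sup>2 < \<epsilon>\<^sup>2"
      using le[of n m] N[OF that(1)] N[OF that(2)] by simp
  qed (use \<epsilon> in simp)
  then show "\<exists>N. \<forall>m\<ge>N. \<forall>n\<ge>N. dist (x m) (x n) < \<epsilon>"
    by (auto simp: dist_norm)
qed

lemma inner_orthogonal_sums:
  fixes e :: "nat \<Rightarrow> 'a::real_inner"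
  assumes "\<And>i k. i \<noteq> k \<Longrightarrow> e i \<bullet> e k = 0" and "A \<inter> B = {}"
  shows "(\<Sum>i\<in>A. c i *\<^sub>R e i) \<bullet> (\<Sum>k\<in>B. d k *\<^sub>R e k) = 0"
proof -
  have "e i \<bullet> e k = 0" if "i \<in> A" "k \<in> B" for i k
    using that assms(2) by (intro assms(1)) auto
  then show ?thesis
    by (simp add: inner_sum_left inner_sum_right)
qed

lemma convergent_orthogonal_series:
  fixes e :: "nat \<Rightarrow> 'a::{real_inner, banach}"
  assumes orth: "\<And>i k. i \<noteq> k \<Longrightarrow> e i \<bullet> e k = 0"
    and bounded: "\<And>n. norm (\<Sum>k<n. c k *\<^sub>R e k) \<le> C"
  shows "convergent (\<lambda>n. \<Sum>k<n. c k *\<^sub>R e k)"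
proof -
  define s where "s = (\<lambda>n. \<Sum>k<n. c k *\<^sub>R e k)"
  have pyth: "(norm (s n - s m))\<^sup>2 = (norm (s n))\<^sup>2 - (norm (s m))\<^sup>2" if "m \<le> n" for m n
  proof -
    have d: "s n - s m = (\<Sum>k\<in>{m..<n}. c k *\<^sub>R e k)"
      using that sum_diff_nat_ivl[of 0 m n "\<lambda>k. c k *\<^sub>R e k"] by (simp add: s_def atLeast0LessThan)
    have "s m \<bullet> (s n - s m) = 0"
      unfolding d unfolding s_def by (rule inner_orthogonal_sums[OF orth]) auto
    then show ?thesis
      by (simp add: power2_norm_eq_inner inner_diff_left inner_diff_right inner_commute)
  qed
  have "incseq (\<lambda>n. (norm (s n))\<^sup>2)"
  proof (rule incseq_SucI)
    show "(norm (s n))\<^sup>2 \<le> (norm (s (Suc n)))\<^sup>2" for n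
      using pyth[of n "Suc n"] zero_le_power2[of "norm (s (Suc n) - s n)"] by linarith
  qed
  moreover have "(norm (s n))\<^sup>2 \<le> C\<^sup>2" for n
    using bounded[of n] by (intro power_mono) (auto simp: s_def)
  ultimately obtain L where L: "(\<lambda>n. (norm (s n))\<^sup>2) \<longlonglongrightarrow> L" and le: "\<And>n. (norm (s n))\<^sup>2 \<le> L"
    by (metis incseq_convergent)
  have "Cauchy s"
  proof (rule CauchyI_norm_square_le)
    show "(\<lambda>n. L - (norm (s n))\<^sup>2) \<longlonglongrightarrow> 0"
      using tendsto_diff[OF tendsto_const L, of L] by simp
    show "(norm (s n - s m))\<^sup>2 \<le> L - (norm (s n))\<^sup>2 + (L - (norm (s m))\<^sup>2)" for m n
      using pyth[of m n] pyth[of n m] le[of m] le[of n] norm_minus_commute[of "s n" "s m"]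
      by (cases "m \<le> n") auto
  qed
  then show ?thesis
    by (simp add: s_def Cauchy_convergent)
qed

text \<open>
  The embedding \<open>j\<close> of \<open>V\<close> into \<open>H\<close> is injective and compact, with dense range.
\<close>

locale gelfand_triple =
  fixes j :: "'v::{real_inner,banach,second_countable_topology} \<Rightarrow>\<^sub>L
              'h::{real_inner,banach,second_countable_topology}"
  assumes embedding: "gelfand_embedding j"
begin

lemma j_eq_iff: "j x = j y \<longleftrightarrow> x = y"
  using embedding by (auto simp: gelfand_embedding_def inj_def)

lemma j_zero_iff: "j x = 0 \<longleftrightarrow> x = 0"
  using j_eq_iff[of x 0] by (simp add: blinfun.zero_right)

lemma compact_subsequence:
  assumes "\<And>n. norm (x n) \<le> C"
  obtains r y where "strict_mono (r :: nat \<Rightarrow> nat)" "(\<lambda>n. j (x (r n))) \<longlonglongrightarrow> y"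
proof -
  have "bounded (range x)"
    using assms by (auto simp: bounded_iff)
  then have "seq_compact (closure (blinfun_apply j ` range x))"
    using embedding by (auto simp: gelfand_embedding_def compact_eq_seq_compact_metric)
  moreover have "j (x n) \<in> closure (blinfun_apply j ` range x)" for n
    using closure_subset by fastforce
  ultimately obtain y r where "strict_mono r" "((\<lambda>n. j (x n)) \<circ> r) \<longlonglongrightarrow> y"
    unfolding seq_compact_def by metis
  with that show thesis by (auto simp: o_def)
qed

text \<open>
  On a closed subspace the Rayleigh quotient of the embedding attains its maximum.  A maximising
  sequence is even a Cauchy sequence in \<open>V\<close>, by the parallelogram law, once its image
  converges in \<open>H\<close>.
\<close>

lemma rayleigh_maximum:
  assumes S: "subspace S" "closed S"
  shows "\<exists>e\<in>S. (e = 0 \<or> norm e = 1) \<and> (\<forall>x\<in>S. norm (j x) \<le> norm (j e) * norm x)"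
proof -
  define B where "B = (\<lambda>x. norm (j x)) ` (S \<inter> cball 0 1)"
  define m where "m = Sup B"
  have bdd: "bdd_above B"
  proof (rule bdd_aboveI)
    fix b assume "b \<in> B"
    then obtain x where "b = norm (j x)" "norm x \<le> 1" by (auto simp: B_def)
    moreover have "norm (j x) \<le> norm j * norm x" by (rule norm_blinfun)
    ultimately show "b \<le> norm j"
      using mult_left_mono[of "norm x" 1 "norm j"] by simp
  qed
  have z: "0 \<in> S" using S(1) by (rule subspace_0)
  then have ne: "B \<noteq> {}" by (auto simp: B_def)
  have m0: "0 \<le> m"
    unfolding m_def using z by (intro cSup_upper2[OF _ _ bdd, of 0]) (auto simp: B_def blinfun.zero_right intro!: image_eqI[of _ _ 0])
  have le: "norm (j x) \<le> m * norm x" if x: "x \<in> S" for x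
  proof (cases "x = 0")
    case False
    have "norm (j (x /\<^sub>R norm x)) \<le> m"
      unfolding m_def using S x False
      by (intro cSup_upper[OF _ bdd]) (auto simp: B_def subspace_scale)
    then show ?thesis
      using False by (simp add: blinfun.scaleR_right field_simps)
  qed (simp add: blinfun.zero_right)
  show ?thesis
  proof (cases "m = 0")
    case True
    then have "\<forall>x\<in>S. norm (j x) \<le> norm (j 0) * norm x"
      using le by (auto simp: blinfun.zero_right)
    with z show ?thesis by blast
  next
    case False
    with m0 have mpos: "m > 0" by simp
    have "\<exists>x. x \<in> S \<and> norm x \<le> 1 \<and> m - 1 / real (Suc n) < norm (j x)" for n
      using less_cSupD[OF ne, of "m - 1 / real (Suc n)"] by (auto simp: B_def m_def)
    then obtain x where x: "\<And>n. x n \<in> S" "\<And>n. norm (x n) \<le> 1"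
      and big: "\<And>n. m - 1 / real (Suc n) < norm (j (x n))"
      by metis
    obtain r y where r: "strict_mono (r :: nat \<Rightarrow> nat)" and y: "(\<lambda>n. j (x (r n))) \<longlonglongrightarrow> y"
      using compact_subsequence[of x 1] x by blast
    have "(\<lambda>n. norm (j (x n))) \<longlonglongrightarrow> m"
    proof (rule tendsto_sandwich[OF _ _ _ tendsto_const])
      have "(\<lambda>n. m - inverse (real (Suc n))) \<longlonglongrightarrow> m - 0"
        by (intro tendsto_diff tendsto_const LIMSEQ_inverse_real_of_nat)
      then show "(\<lambda>n. m - 1 / real (Suc n)) \<longlonglongrightarrow> m"
        by (simp add: field_simps)
      show "\<forall>\<^sub>F n in sequentially. norm (j (x n)) \<le> m"
        using le[OF x(1)] x(2) m0 by (auto intro!: always_eventually order_trans[OF le[OF x(1)]] mult_left_le)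
    qed (use big in \<open>auto intro!: always_eventually less_imp_le\<close>)
    from LIMSEQ_subseq_LIMSEQ[OF this r] have lim: "(\<lambda>n. norm (j (x (r n)))) \<longlonglongrightarrow> m"
      by (simp add: o_def)
    define b where "b = (\<lambda>n. (2 * (m\<^sup>2 - (norm (j (x (r n))))\<^sup>2) + 2 * (norm (j (x (r n)) - y))\<^sup>2) / m\<^sup>2)"
    have "b \<longlonglongrightarrow> (2 * (m\<^sup>2 - m\<^sup>2) + 2 * (norm (y - y))\<^sup>2) / m\<^sup>2"
      unfolding b_def using False by (intro tendsto_intros lim y) simp
    then have b: "b \<longlonglongrightarrow> 0" by simp
    have "Cauchy (\<lambda>n. x (r n))"
    proof (rule CauchyI_norm_square_le[OF b])
      fix p q
      let ?p = "x (r p)" and ?q = "x (r q)"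
      have par: "(norm (u + v))\<^sup>2 + (norm (u - v))\<^sup>2 = 2 * (norm u)\<^sup>2 + 2 * (norm v)\<^sup>2"
        for u v :: "'c::real_inner"
        by (simp add: power2_norm_eq_inner inner_simps inner_commute)
      have "(norm (j (?q + ?p)))\<^sup>2 \<le> (m * norm (?q + ?p))\<^sup>2"
        using x(1) S by (intro power_mono le) (auto intro: subspace_add)
      moreover have "(norm (j ?q - j ?p))\<^sup>2 \<le> 2 * (norm (j ?q - y))\<^sup>2 + 2 * (norm (j ?p - y))\<^sup>2"
      proof -
        have e: "j ?q - j ?p = (j ?q - y) - (j ?p - y)" by simp
        show ?thesis
          using par[of "j ?q - y" "j ?p - y"] zero_le_power2[of "norm (j ?q - y + (j ?p - y))"]
          by (subst e) linarith
      qed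
      moreover have "m\<^sup>2 * (norm ?p)\<^sup>2 \<le> m\<^sup>2" "m\<^sup>2 * (norm ?q)\<^sup>2 \<le> m\<^sup>2"
        using x(2) by (auto intro!: mult_left_le power_le_one)
      ultimately have *: "m\<^sup>2 * (norm (?q - ?p))\<^sup>2 \<le> 
          2 * (m\<^sup>2 - (norm (j ?p))\<^sup>2) + 2 * (norm (j ?p - y))\<^sup>2 +
          (2 * (m\<^sup>2 - (norm (j ?q))\<^sup>2) + 2 * (norm (j ?q - y))\<^sup>2)"
        using par[of "j ?q" "j ?p"] arg_cong[OF par[of ?q ?p], of "(*) (m\<^sup>2)"]
        by (simp add: blinfun.add_right power_mult_distrib algebra_simps)
      show "(norm (?q - ?p))\<^sup>2 \<le> b q + b p"
        using divide_right_mono[OF *, of "m\<^sup>2"] mpos by (simp add: b_def add_divide_distrib diff_divide_distrib)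
    qed
    then obtain e where e: "(\<lambda>n. x (r n)) \<longlonglongrightarrow> e"
      using Cauchy_convergent convergent_def by metis
    have eS: "e \<in> S"
      using closed_sequentially[OF S(2) _ e] x(1) by simp
    have e1: "norm e \<le> 1"
      using tendsto_norm[OF e] x(2) by (intro LIMSEQ_le_const2) auto
    have "(\<lambda>n. norm (j (x (r n)))) \<longlonglongrightarrow> norm (j e)"
      by (intro tendsto_intros e)
    then have je: "norm (j e) = m"
      using lim by (rule LIMSEQ_unique)
    then have "norm e = 1"
      using le[OF eS] mpos e1 by (simp add: mult_le_cancel_left1)
    with eS je le show ?thesis by auto
  qed
qed

text \<open>At a maximiser the first variation of the Rayleigh quotient vanishes.\<close>

lemma rayleigh_maximum_orthogonal:
  assumes S: "subspace S" and e: "e \<in> S" "e = 0 \<or> norm e = 1"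
    and max: "\<And>x. x \<in> S \<Longrightarrow> norm (j x) \<le> norm (j e) * norm x"
    and y: "y \<in> S" "e \<bullet> y = 0"
  shows "j e \<bullet> j y = 0"
proof (cases "e = 0")
  case False
  with e have e1: "norm e = 1" by simp
  define K where "K = (norm (j e) * norm y)\<^sup>2"
  define c where "c = j e \<bullet> j y"
  have *: "2 * t * c \<le> t\<^sup>2 * K" for t
  proof -
    have "e + t *\<^sub>R y \<in> S"
      using S e(1) y(1) by (intro subspace_add subspace_scale)
    then have "(norm (j (e + t *\<^sub>R y)))\<^sup>2 \<le> (norm (j e) * norm (e + t *\<^sub>R y))\<^sup>2"
      by (intro power_mono max) auto
    moreover have "(norm (j (e + t *\<^sub>R y)))\<^sup>2 = (norm (j e))\<^sup>2 + 2 * t * c + t\<^sup>2 * (norm (j y))\<^sup>2"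
      unfolding power2_norm_eq_inner c_def
      by (simp add: blinfun.add_right blinfun.scaleR_right inner_simps inner_commute power2_eq_square)
    moreover have "(norm (e + t *\<^sub>R y))\<^sup>2 = 1 + t\<^sup>2 * (norm y)\<^sup>2"
      using y(2) e1 unfolding power2_norm_eq_inner
      by (simp add: inner_simps inner_commute power2_eq_square norm_eq_1)
    ultimately have "2 * t * c + t\<^sup>2 * (norm (j y))\<^sup>2 \<le> t\<^sup>2 * K"
      by (simp add: K_def power_mult_distrib algebra_simps)
    then show ?thesis
      by (smt (verit) zero_le_mult_iff zero_le_power2)
  qed
  have "c = 0"
  proof (rule ccontr)
    assume "c \<noteq> 0"
    have K: "K \<ge> 0" by (simp add: K_def)
    define t where "t = c / (K + 1)"
    have c: "c = t * (K + 1)" using K by (simp add: t_def)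
    have "2 * t * c \<le> t\<^sup>2 * K"
      by (rule *)
    then have "t\<^sup>2 * (K + 2) \<le> 0"
      by (simp add: c power2_eq_square algebra_simps)
    then have "t = 0" using K by (simp add: mult_le_0_iff)
    then show False using \<open>c \<noteq> 0\<close> c by simp
  qed
  then show ?thesis by (simp add: c_def)
qed (simp add: blinfun.zero_right)

text \<open>
  A unit vector of \<open>S\<close> at which the Rayleigh quotient of the embedding is maximal, or \<open>0\<close> if \<open>S\<close>
  is trivial.
\<close>

definition maximiser :: "'v set \<Rightarrow> 'v" where
  "maximiser S = (SOME e. e \<in> S \<and> (e = 0 \<or> norm e = 1) \<and> (\<forall>x\<in>S. norm (j x) \<le> norm (j e) * norm x))"

text \<open>
  The orthogonal complement in \<open>V\<close> of the first \<open>k\<close> successive maximisers.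
\<close>

primrec complement :: "nat \<Rightarrow> 'v set" where
  "complement 0 = UNIV"
| "complement (Suc k) = {x \<in> complement k. maximiser (complement k) \<bullet> x = 0}"

text \<open>
  The successive maximisers: the orthonormal basis of \<open>V\<close> that is at the same time orthogonal in
  \<open>H\<close>.  If \<open>V\<close> has finite dimension, the sequence is continued by zeros.
\<close>

definition basis :: "nat \<Rightarrow> 'v" where
  "basis k = maximiser (complement k)"

lemma complement_subspace: "subspace (complement k)" and complement_closed: "closed (complement k)"
proof (induction k)
  case (Suc k)
  have "complement (Suc k) = complement k \<inter> {x. maximiser (complement k) \<bullet> x = 0}" by auto
  with Suc show "subspace (complement (Suc k))" "closed (complement (Suc k))"
    by (auto intro!: subspace_inter closed_Int subspace_hyperplane closed_hyperplane)
qed auto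

lemma basis_complement: "basis k \<in> complement k"
  and basis_cases: "basis k = 0 \<or> norm (basis k) = 1"
  and basis_maximal: "x \<in> complement k \<Longrightarrow> norm (j x) \<le> norm (j (basis k)) * norm x"
  using someI_ex[OF rayleigh_maximum[OF complement_subspace complement_closed, of k, unfolded Bex_def]]
  unfolding basis_def maximiser_def by auto

lemma complement_iff: "x \<in> complement n \<longleftrightarrow> (\<forall>k<n. basis k \<bullet> x = 0)"
  by (induction n) (auto simp: basis_def less_Suc_eq)

lemma basis_orthogonal: "i \<noteq> k \<Longrightarrow> basis i \<bullet> basis k = 0"
  using basis_complement[of k] basis_complement[of i]
  by (metis complement_iff inner_commute linorder_neqE_nat)

lemma j_basis_orthogonal: "i \<noteq> k \<Longrightarrow> j (basis i) \<bullet> j (basis k) = 0"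
proof (induction i k rule: linorder_wlog)
  case (le i k)
  then have "basis k \<in> complement i"
    using basis_complement[of k] by (auto simp: complement_iff)
  then show ?case
    using le basis_orthogonal
    by (intro rayleigh_maximum_orthogonal[OF complement_subspace basis_complement basis_cases basis_maximal]) auto
next
  case (sym i k)
  then show ?case by (simp add: inner_commute)
qed

lemma norm_basis_le: "norm (basis k) \<le> 1"
  using basis_cases[of k] by auto

text \<open>
  By compactness; the distance of any two of these mutually orthogonal vectors is at least the
  norm of either of them.
\<close>

lemma norm_j_basis_tendsto_0: "(\<lambda>k. norm (j (basis k))) \<longlonglongrightarrow> 0"
proof -
  obtain r y where r: "strict_mono (r :: nat \<Rightarrow> nat)" and y: "(\<lambda>n. j (basis (r n))) \<longlonglongrightarrow> y"
    using compact_subsequence[of basis 1] norm_basis_le by blast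
  have "(\<lambda>n. norm (j (basis (r n)) - j (basis (r (Suc n))))) \<longlonglongrightarrow> norm (y - y)"
    by (intro tendsto_intros y LIMSEQ_Suc[OF y])
  then have lim: "(\<lambda>n. norm (j (basis (r n)) - j (basis (r (Suc n))))) \<longlonglongrightarrow> 0" by simp
  have bound: "norm (j (basis (r n))) \<le> norm (j (basis (r n)) - j (basis (r (Suc n))))" for n
  proof (rule power2_le_imp_le)
    have "j (basis (r n)) \<bullet> j (basis (r (Suc n))) = 0"
      using strict_monoD[OF r, of n "Suc n"] by (intro j_basis_orthogonal) auto
    then show "(norm (j (basis (r n))))\<^sup>2 \<le> (norm (j (basis (r n)) - j (basis (r (Suc n)))))\<^sup>2"
      by (simp add: power2_norm_eq_inner inner_diff_left inner_diff_right inner_commute)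
  qed simp
  have sub: "(\<lambda>n. norm (j (basis (r n)))) \<longlonglongrightarrow> 0"
    by (rule tendsto_sandwich[OF _ _ tendsto_const lim]) (auto intro!: always_eventually bound)
  have "decseq (\<lambda>k. norm (j (basis k)))"
  proof (rule decseq_SucI)
    fix k
    have "basis (Suc k) \<in> complement k"
      using basis_complement[of "Suc k"] by simp
    then have "norm (j (basis (Suc k))) \<le> norm (j (basis k)) * norm (basis (Suc k))"
      by (rule basis_maximal)
    also have "\<dots> \<le> norm (j (basis k))"
      using norm_basis_le by (simp add: mult_left_le)
    finally show "norm (j (basis (Suc k))) \<le> norm (j (basis k))" .
  qed
  then obtain L where L: "(\<lambda>k. norm (j (basis k))) \<longlonglongrightarrow> L"
    using decseq_convergent[of _ 0] by (metis norm_ge_zero)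
  have "L = 0"
    using LIMSEQ_subseq_LIMSEQ[OF L r] sub by (auto simp: o_def intro: LIMSEQ_unique)
  with L show ?thesis by simp
qed

text \<open>
  The orthogonal projector of \<open>V\<close> onto the span of the first \<open>n\<close> basis vectors.
\<close>

definition proj :: "nat \<Rightarrow> 'v \<Rightarrow> 'v" where
  "proj n x = (\<Sum>k<n. (x \<bullet> basis k) *\<^sub>R basis k)"

lemma inner_sum_basis:
  "(\<Sum>k<n. c k *\<^sub>R basis k) \<bullet> basis i = (if i < n then c i * (norm (basis i))\<^sup>2 else 0)"
proof -
  have "(\<Sum>k<n. c k *\<^sub>R basis k) \<bullet> basis i = (\<Sum>k<n. if k = i then c i * (norm (basis i))\<^sup>2 else 0)"
    unfolding inner_sum_left
    by (intro sum.cong) (auto simp: basis_orthogonal power2_norm_eq_inner)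
  then show ?thesis by simp
qed

lemma proj_residual_complement: "x - proj n x \<in> complement n"
proof -
  have "(x - proj n x) \<bullet> basis k = 0" if "k < n" for k
    using basis_cases[of k] that by (auto simp: inner_diff_left proj_def inner_sum_basis)
  then show ?thesis by (simp add: complement_iff inner_commute)
qed

lemma proj_pythagoras: "(norm x)\<^sup>2 = (norm (proj n x))\<^sup>2 + (norm (x - proj n x))\<^sup>2"
proof -
  have "proj n x \<bullet> (x - proj n x) = 0"
    using proj_residual_complement[of x n]
    by (auto simp: proj_def[of n x] inner_sum_left complement_iff)
  then show ?thesis
    by (simp add: power2_norm_eq_inner inner_diff_left inner_diff_right inner_commute)
qed

lemma norm_proj_le: "norm (proj n x) \<le> norm x"
  and norm_proj_residual_le: "norm (x - proj n x) \<le> norm x"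
proof -
  have "(norm (proj n x))\<^sup>2 \<le> (norm x)\<^sup>2" "(norm (x - proj n x))\<^sup>2 \<le> (norm x)\<^sup>2"
    unfolding proj_pythagoras[of x n] by simp_all
  then show "norm (proj n x) \<le> norm x" "norm (x - proj n x) \<le> norm x"
    by (simp_all add: abs_le_square_iff[symmetric])
qed

text \<open>
  Completeness of the basis: the partial sums converge in \<open>V\<close>, and their images converge to \<open>j x\<close> as
  the maximal Rayleigh quotients tend to \<open>0\<close>; then \<open>j\<close> being injective identifies the limit.
\<close>

lemma proj_tendsto: "(\<lambda>n. proj n x) \<longlonglongrightarrow> x"
proof -
  have "convergent (\<lambda>n. proj n x)"
    using norm_proj_le[of _ x] unfolding proj_def
    by (intro convergent_orthogonal_series basis_orthogonal) auto
  then obtain y where y: "(\<lambda>n. proj n x) \<longlonglongrightarrow> y"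
    by (auto simp: convergent_def)
  have "(\<lambda>n. j (x - proj n x)) \<longlonglongrightarrow> 0"
  proof (rule tendsto_norm_zero_cancel, rule tendsto_sandwich[OF _ _ tendsto_const])
    have "norm (j (x - proj n x)) \<le> norm (j (basis n)) * norm x" for n
      using basis_maximal[OF proj_residual_complement[of x n]] norm_proj_residual_le[of x n]
      by (meson mult_left_mono norm_ge_zero order_trans)
    then show "\<forall>\<^sub>F n in sequentially. norm (j (x - proj n x)) \<le> norm (j (basis n)) * norm x"
      by simp
    show "(\<lambda>n. norm (j (basis n)) * norm x) \<longlonglongrightarrow> 0"
      using tendsto_mult_right[OF norm_j_basis_tendsto_0, of "norm x"] by simp
  qed simp
  moreover have "(\<lambda>n. j (x - proj n x)) \<longlonglongrightarrow> j (x - y)"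
    by (intro tendsto_intros y)
  ultimately have "j (x - y) = 0"
    using LIMSEQ_unique by blast
  with y show ?thesis by (simp add: j_zero_iff)
qed

lemma blinfun_proj:
  fixes g :: "'v \<Rightarrow>\<^sub>L 'c::real_normed_vector"
  shows "g (proj n x) = (\<Sum>k<n. (x \<bullet> basis k) *\<^sub>R g (basis k))"
  by (simp add: proj_def blinfun.sum_right blinfun.scaleR_right)

lemma riesz_representation:
  fixes g :: "'v \<Rightarrow>\<^sub>L real"
  shows "\<exists>r. \<forall>x. g x = r \<bullet> x"
proof -
  define r where "r = (\<lambda>n. \<Sum>k<n. g (basis k) *\<^sub>R basis k)"
  have "norm (r n) \<le> norm g" for n
  proof (cases "r n = 0")
    case False
    have "r n \<bullet> basis k = g (basis k)" if "k < n" for k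
      using basis_cases[of k] that by (auto simp: r_def inner_sum_basis blinfun.zero_right)
    then have "r n \<bullet> r n = (\<Sum>k<n. g (basis k) * g (basis k))"
      by (subst (2) r_def) (simp add: inner_sum_right)
    also have "\<dots> = g (r n)"
      by (simp add: r_def blinfun.sum_right blinfun.scaleR_right)
    also have "\<dots> \<le> norm g * norm (r n)"
      using norm_blinfun[of g "r n"] by simp
    finally show ?thesis
      using False by (simp add: power2_norm_eq_inner[symmetric] power2_eq_square)
  qed simp
  then have "convergent r"
    unfolding r_def by (intro convergent_orthogonal_series basis_orthogonal)
  then obtain y where y: "r \<longlonglongrightarrow> y"
    by (auto simp: convergent_def)
  have "g x = y \<bullet> x" for x
  proof (rule LIMSEQ_unique)
    show "(\<lambda>n. g (proj n x)) \<longlonglongrightarrow> g x"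
      by (intro tendsto_intros proj_tendsto)
    have "g (proj n x) = r n \<bullet> x" for n
      by (simp add: blinfun_proj r_def inner_sum_left inner_commute[of x] mult.commute)
    then show "(\<lambda>n. g (proj n x)) \<longlonglongrightarrow> y \<bullet> x"
      by (simp add: tendsto_inner[OF y tendsto_const])
  qed
  then show ?thesis by blast
qed

text \<open>
  The representative in \<open>V\<close> of a bounded functional.
\<close>

definition riesz :: "('v \<Rightarrow>\<^sub>L real) \<Rightarrow> 'v" where
  "riesz g = (SOME r. \<forall>x. g x = r \<bullet> x)"

lemma riesz: "riesz g \<bullet> x = g x"
proof -
  have "\<forall>x. g x = riesz g \<bullet> x"
    unfolding riesz_def by (rule someI_ex[OF riesz_representation])
  then show ?thesis by simp
qed

lemma riesz_blinfun: "blinfun_inner_left (riesz g) = g"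
  by (rule blinfun_eqI) (simp only: blinfun_inner_left.rep_eq, subst inner_commute, rule riesz)

lemma riesz_unique: "(\<And>x. blinfun_apply g x = r \<bullet> x) \<Longrightarrow> riesz g = r"
  using vector_eq_rdot[of "riesz g" r] by (simp add: riesz)

lemma norm_riesz: "norm (riesz g) = norm g"
proof (rule antisym)
  have "(norm (riesz g))\<^sup>2 = g (riesz g)"
    by (simp add: power2_norm_eq_inner riesz)
  also have "\<dots> \<le> norm g * norm (riesz g)"
    using norm_blinfun[of g "riesz g"] by simp
  finally show "norm (riesz g) \<le> norm g"
    by (cases "riesz g = 0") (auto simp: power2_eq_square)
  show "norm g \<le> norm (riesz g)"
    using Cauchy_Schwarz_ineq2[of "riesz g"] by (intro norm_blinfun_bound) (auto simp: riesz)
qed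

lemma bounded_linear_riesz: "bounded_linear riesz"
proof
  show "riesz (f + g) = riesz f + riesz g" for f g
    by (rule riesz_unique) (simp add: blinfun.add_left inner_add_left riesz)
  show "riesz (r *\<^sub>R g) = r *\<^sub>R riesz g" for r g
    by (rule riesz_unique) (simp add: blinfun.scaleR_left riesz)
  show "\<exists>K. \<forall>g. norm (riesz g) \<le> norm g * K"
    by (intro exI[of _ 1]) (simp add: norm_riesz)
qed

text \<open>
  Measurability of functions into the dual space is measurability of their Riesz representatives;
  the latter live in a second countable space, where sums of measurable functions are measurable.
\<close>

lemma measurable_riesz_iff:
  "(\<lambda>t. riesz (f t)) \<in> borel_measurable M \<longleftrightarrow> f \<in> borel_measurable M"
proof
  assume "(\<lambda>t. riesz (f t)) \<in> borel_measurable M"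
  then have "(\<lambda>t. blinfun_inner_left (riesz (f t))) \<in> borel_measurable M"
    by (rule measurable_compose) (intro borel_measurable_continuous_onI continuous_intros)
  then show "f \<in> borel_measurable M"
    by (simp add: riesz_blinfun)
next
  assume "f \<in> borel_measurable M"
  then show "(\<lambda>t. riesz (f t)) \<in> borel_measurable M"
    by (rule measurable_compose)
      (intro borel_measurable_continuous_onI bounded_linear.continuous_on[OF bounded_linear_riesz] continuous_on_id)
qed

end

section \<open>Square integrable functions\<close>

lemma L2_measurable: "v \<in> L2 T \<Longrightarrow> v \<in> borel_measurable (time_measure T)"
  and L2_integrable: "v \<in> L2 T \<Longrightarrow> integrable (time_measure T) (\<lambda>t. (norm (v t))\<^sup>2)"
  by (simp_all add: L2_def)

lemma L2_norm_measurable: "v \<in> L2 T \<Longrightarrow> (\<lambda>t. norm (v t)) \<in> borel_measurable (time_measure T)"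
  using measurable_compose[OF L2_measurable, of v T norm borel]
  by (simp add: borel_measurable_continuous_onI continuous_on_norm_id)

lemma L2_dominated:
  assumes "v \<in> borel_measurable (time_measure T)" and "integrable (time_measure T) b"
    and "\<And>t. (norm (v t))\<^sup>2 \<le> b t"
  shows "v \<in> L2 T"
proof -
  have "(\<lambda>t. norm (v t)) \<in> borel_measurable (time_measure T)"
    using assms(1) by (rule measurable_compose) (simp add: borel_measurable_continuous_onI continuous_on_norm_id)
  then have "integrable (time_measure T) (\<lambda>t. (norm (v t))\<^sup>2)"
    using assms(2,3) by (intro Bochner_Integration.integrable_bound[OF assms(2)]) (auto intro!: AE_I2 order_trans[OF assms(3)])
  with assms(1) show ?thesis by (simp add: L2_def)
qed

lemma norm_combination_square_le:
  fixes x y :: "'b::real_normed_vector"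
  shows "(norm (r *\<^sub>R x + s *\<^sub>R y))\<^sup>2 \<le> 2 * r\<^sup>2 * (norm x)\<^sup>2 + 2 * s\<^sup>2 * (norm y)\<^sup>2"
proof -
  have "norm (r *\<^sub>R x + s *\<^sub>R y) \<le> \<bar>r\<bar> * norm x + \<bar>s\<bar> * norm y"
    using norm_triangle_ineq[of "r *\<^sub>R x" "s *\<^sub>R y"] by simp
  then have "(norm (r *\<^sub>R x + s *\<^sub>R y))\<^sup>2 \<le> (\<bar>r\<bar> * norm x + \<bar>s\<bar> * norm y)\<^sup>2"
    by (intro power_mono) auto
  also have "\<dots> \<le> 2 * (\<bar>r\<bar> * norm x)\<^sup>2 + 2 * (\<bar>s\<bar> * norm y)\<^sup>2"
    using sum_squares_bound[of "\<bar>r\<bar> * norm x" "\<bar>s\<bar> * norm y"] by (simp add: power2_sum)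
  finally show ?thesis by (simp add: power_mult_distrib mult.assoc)
qed

lemma L2_combination:
  fixes v w :: "real \<Rightarrow> 'b::{real_normed_vector, second_countable_topology}"
  assumes v: "v \<in> L2 T" and w: "w \<in> L2 T"
  shows "(\<lambda>t. r *\<^sub>R v t + s *\<^sub>R w t) \<in> L2 T"
proof (rule L2_dominated[OF _ _ norm_combination_square_le])
  show "(\<lambda>t. r *\<^sub>R v t + s *\<^sub>R w t) \<in> borel_measurable (time_measure T)"
    using L2_measurable[OF v] L2_measurable[OF w] by measurable
qed (intro Bochner_Integration.integrable_add integrable_mult_right L2_integrable v w)

lemma L2_const: "(\<lambda>t. x :: 'b::{real_normed_vector, second_countable_topology}) \<in> L2 T"
  by (simp add: L2_def integrable_time_const)

lemma L2_norm_mult_integrable: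
  assumes v: "v \<in> L2 T" and w: "w \<in> L2 T"
  shows "integrable (time_measure T) (\<lambda>t. norm (v t) * norm (w t))"
proof (rule Bochner_Integration.integrable_bound)
  show "integrable (time_measure T) (\<lambda>t. (norm (v t))\<^sup>2 + (norm (w t))\<^sup>2)"
    by (intro Bochner_Integration.integrable_add L2_integrable v w)
  show "(\<lambda>t. norm (v t) * norm (w t)) \<in> borel_measurable (time_measure T)"
    by (intro borel_measurable_times L2_norm_measurable v w)
  show "AE t in time_measure T. norm (norm (v t) * norm (w t)) \<le> norm ((norm (v t))\<^sup>2 + (norm (w t))\<^sup>2)"
  proof (intro AE_I2)
    fix t
    have "2 * (norm (v t) * norm (w t)) \<le> (norm (v t))\<^sup>2 + (norm (w t))\<^sup>2"
      using sum_squares_bound[of "norm (v t)" "norm (w t)"] by simp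
    moreover have "0 \<le> norm (v t) * norm (w t)" by simp
    ultimately have "norm (v t) * norm (w t) \<le> (norm (v t))\<^sup>2 + (norm (w t))\<^sup>2" by linarith
    then show "norm (norm (v t) * norm (w t)) \<le> norm ((norm (v t))\<^sup>2 + (norm (w t))\<^sup>2)"
      by (simp add: abs_mult)
  qed
qed

lemma primitive_cong_AE:
  assumes "f \<in> borel_measurable (time_measure T)" "g \<in> borel_measurable (time_measure T)"
    and "AE t in time_measure T. f t = g t"
  shows "primitive T f t = primitive T g t"
  unfolding primitive_def using assms
  by (intro integral_cong_AE borel_measurable_times indicator_lessThan_measurable) (auto elim!: eventually_mono)

lemma primitive_sum:
  assumes "\<And>k. k \<in> A \<Longrightarrow> integrable (time_measure T) (f k)"
  shows "primitive T (\<lambda>t. \<Sum>k\<in>A. f k t) t = (\<Sum>k\<in>A. primitive T (f k) t)"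
  unfolding primitive_def sum_distrib_left
  by (intro Bochner_Integration.integral_sum integrable_indicator_lessThan assms)

context gelfand_triple
begin

lemma riesz_L2: "f \<in> L2 T \<longleftrightarrow> (\<lambda>t. riesz (f t)) \<in> L2 T"
  by (simp add: L2_def measurable_riesz_iff norm_riesz)

lemma L2_dual_combination:
  fixes f g :: "real \<Rightarrow> 'v \<Rightarrow>\<^sub>L real"
  assumes "f \<in> L2 T" "g \<in> L2 T"
  shows "(\<lambda>t. r *\<^sub>R f t + s *\<^sub>R g t) \<in> L2 T"
proof -
  have "riesz (r *\<^sub>R f t + s *\<^sub>R g t) = r *\<^sub>R riesz (f t) + s *\<^sub>R riesz (g t)" for t
    by (simp add: linear_simps[OF bounded_linear_riesz])
  then show ?thesis
    using L2_combination[of "\<lambda>t. riesz (f t)" T "\<lambda>t. riesz (g t)" r s] assms by (simp add: riesz_L2)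
qed

lemma dual_pairing_measurable:
  fixes f :: "real \<Rightarrow> 'v \<Rightarrow>\<^sub>L real"
  assumes "f \<in> borel_measurable M" "v \<in> borel_measurable M"
  shows "(\<lambda>t. f t (v t)) \<in> borel_measurable M"
proof -
  have "(\<lambda>t. riesz (f t) \<bullet> v t) \<in> borel_measurable M"
    using assms by (intro borel_measurable_inner) (simp_all add: measurable_riesz_iff)
  then show ?thesis by (simp add: riesz)
qed

lemma dual_pairing_integrable:
  fixes f :: "real \<Rightarrow> 'v \<Rightarrow>\<^sub>L real"
  assumes f: "f \<in> L2 T" and v: "v \<in> L2 T"
  shows "integrable (time_measure T) (\<lambda>t. f t (v t))"
proof (rule Bochner_Integration.integrable_bound[OF L2_norm_mult_integrable[OF f v]])
  show "(\<lambda>t. f t (v t)) \<in> borel_measurable (time_measure T)"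
    by (intro dual_pairing_measurable L2_measurable f v)
  show "AE t in time_measure T. norm (f t (v t)) \<le> norm (norm (f t) * norm (v t))"
    using norm_blinfun[of "f t" "v t" for t] by (auto intro!: AE_I2)
qed

lemma embedded_inner_integrable:
  assumes w: "w \<in> L2 T"
  shows "integrable (time_measure T) (\<lambda>t. j (w t) \<bullet> j z)"
proof (rule Bochner_Integration.integrable_bound)
  show "integrable (time_measure T) (\<lambda>t. norm (w t) * norm ((norm j)\<^sup>2 * norm z))"
    by (rule L2_norm_mult_integrable[OF w L2_const])
  show "(\<lambda>t. j (w t) \<bullet> j z) \<in> borel_measurable (time_measure T)"
    using L2_measurable[OF w]
    by (rule measurable_compose) (intro borel_measurable_continuous_onI continuous_intros)
  show "AE t in time_measure T. norm (j (w t) \<bullet> j z) \<le> norm (norm (w t) * norm ((norm j)\<^sup>2 * norm z))"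
  proof (intro AE_I2)
    fix t
    have "\<bar>j (w t) \<bullet> j z\<bar> \<le> norm (j (w t)) * norm (j z)"
      by (rule Cauchy_Schwarz_ineq2)
    also have "\<dots> \<le> (norm j * norm (w t)) * (norm j * norm z)"
      by (intro mult_mono norm_blinfun) auto
    finally show "norm (j (w t) \<bullet> j z) \<le> norm (norm (w t) * norm ((norm j)\<^sup>2 * norm z))"
      by (simp add: abs_mult power2_eq_square mult_ac)
  qed
qed

lemma inner_j_basis: "j x \<bullet> j (basis k) = (x \<bullet> basis k) * (norm (j (basis k)))\<^sup>2"
proof (rule LIMSEQ_unique)
  show "(\<lambda>n. j (proj n x) \<bullet> j (basis k)) \<longlonglongrightarrow> j x \<bullet> j (basis k)"
    by (intro tendsto_intros proj_tendsto)
  have "j (proj n x) \<bullet> j (basis k) = (x \<bullet> basis k) * (norm (j (basis k)))\<^sup>2" if "k < n" for n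
  proof -
    have "j (proj n x) \<bullet> j (basis k) = (\<Sum>i<n. if i = k then (x \<bullet> basis k) * (norm (j (basis k)))\<^sup>2 else 0)"
      unfolding blinfun_proj inner_sum_left
      by (intro sum.cong) (auto simp: j_basis_orthogonal power2_norm_eq_inner)
    with that show ?thesis by simp
  qed
  then show "(\<lambda>n. j (proj n x) \<bullet> j (basis k)) \<longlonglongrightarrow> (x \<bullet> basis k) * (norm (j (basis k)))\<^sup>2"
    by (intro tendsto_eventually eventually_mono[OF eventually_gt_at_top[of k]])
qed

lemma proj_measurable:
  assumes "w \<in> borel_measurable M"
  shows "(\<lambda>t. proj n (w t)) \<in> borel_measurable M"
  unfolding proj_def using assms by measurable

section \<open>The continuous representative and the energy identity\<close>

text \<open>
  The embedding \<open>X \<hookrightarrow> C([0,T]; H)\<close> together with the energy identity.  Each coefficient of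
  \<open>w\<close> along the common orthogonal system is absolutely continuous; as that system is orthogonal
  in \<open>H\<close>, the identity holds for the truncations, and it forces them to converge uniformly.
\<close>

lemma continuous_representative:
  assumes T: "T > 0" and w: "w \<in> L2 T" and f: "f \<in> L2 T" and weak: "weak_derivative j T w f"
  shows "\<exists>c. continuous_on {0..T} c \<and> (AE t in time_measure T. c t = j (w t)) \<and>
    (norm (c T))\<^sup>2 - (norm (c 0))\<^sup>2 = 2 * (\<integral>t. f t (w t) \<partial>time_measure T)"
proof -
  let ?M = "time_measure T"
  define \<kappa> where "\<kappa> = (\<lambda>k. (norm (j (basis k)))\<^sup>2)"
  define F where "F = (\<lambda>k t. f t (basis k))"
  define G where "G = (\<lambda>k t. F k t * (w t \<bullet> basis k))"
  have F: "integrable ?M (F k)" for k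
    unfolding F_def by (rule dual_pairing_integrable[OF f L2_const])
  have coeff: "(\<lambda>t. (w t \<bullet> basis k) *\<^sub>R basis k) \<in> L2 T" for k
  proof (rule L2_dominated[OF _ L2_integrable[OF w]])
    show "(\<lambda>t. (w t \<bullet> basis k) *\<^sub>R basis k) \<in> borel_measurable ?M"
      using L2_measurable[OF w] by measurable
    fix t
    have "\<bar>w t \<bullet> basis k\<bar> * norm (basis k) \<le> (norm (w t) * norm (basis k)) * norm (basis k)"
      by (intro mult_right_mono Cauchy_Schwarz_ineq2) simp
    also have "\<dots> \<le> norm (w t)"
      using basis_cases[of k] by auto
    finally show "(norm ((w t \<bullet> basis k) *\<^sub>R basis k))\<^sup>2 \<le> (norm (w t))\<^sup>2"
      by (intro power_mono) auto
  qed
  have G: "integrable ?M (G k)" for k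
    using dual_pairing_integrable[OF f coeff[of k]]
    by (simp add: G_def F_def blinfun.scaleR_right mult.commute)
  have "\<exists>C. AE t in ?M. j (w t) \<bullet> j (basis k) = C + primitive T (F k) t" for k
    using weak by (intro weak_derivative_imp_primitive T embedded_inner_integrable w F)
      (auto simp: weak_derivative_def F_def)
  then obtain C where C: "\<And>k. AE t in ?M. j (w t) \<bullet> j (basis k) = C k + primitive T (F k) t"
    by metis
  have \<kappa>0: "basis k = 0" if "\<kappa> k = 0" for k
    using that by (simp add: \<kappa>_def j_zero_iff)
  \<comment> \<open>Division by \<open>\<kappa> k = 0\<close> yields \<open>0\<close>, which is the right coefficient as then \<open>basis k = 0\<close>.\<close>
  define c where "c = (\<lambda>k t. (C k + primitive T (F k) t) / \<kappa> k)"
  have c_cont: "continuous_on UNIV (c k)" for k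
    unfolding c_def divide_inverse by (intro continuous_intros continuous_primitive F)
  have c_w: "AE t in ?M. \<forall>k. c k t = w t \<bullet> basis k"
    unfolding AE_all_countable
  proof
    fix k
    show "AE t in ?M. c k t = w t \<bullet> basis k"
      using C[of k]
    proof eventually_elim
      case (elim t)
      then have "C k + primitive T (F k) t = (w t \<bullet> basis k) * \<kappa> k"
        by (simp add: inner_j_basis \<kappa>_def)
      then show ?case
        using \<kappa>0[of k] by (cases "\<kappa> k = 0") (simp_all add: c_def)
    qed
  qed
  have "\<exists>K. \<forall>t. (c k t)\<^sup>2 * \<kappa> k = K + 2 * primitive T (G k) t" for k
  proof (cases "\<kappa> k = 0")
    case True
    then have "G k = (\<lambda>t. 0)"
      by (simp add: G_def \<kappa>0)
    then show ?thesis using True by (intro exI[of _ 0]) (simp add: primitive_def)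
  next
    case False
    let ?P = "primitive T (F k)"
    have PF: "integrable ?M (\<lambda>s. ?P s * F k s)"
      by (rule integrable_primitive_mult[OF F F])
    have CF: "integrable ?M (\<lambda>s. C k * F k s)"
      using F by simp
    have eq: "(C k + ?P t)\<^sup>2 = (C k)\<^sup>2 + 2 * \<kappa> k * primitive T (G k) t" for t
    proof -
      have "(C k + ?P t)\<^sup>2 = (C k)\<^sup>2 + 2 * (C k * ?P t) + ?P t * ?P t"
        by (simp add: power2_eq_square algebra_simps)
      also have "?P t * ?P t = primitive T (\<lambda>s. ?P s * F k s + ?P s * F k s) t"
        by (subst primitive_product[OF F F]) (simp add: mult.commute)
      also have "\<dots> = 2 * primitive T (\<lambda>s. ?P s * F k s) t"
        by (subst primitive_add[OF PF PF]) simp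
      also have "C k * ?P t = primitive T (\<lambda>s. C k * F k s) t"
        by (simp add: primitive_mult)
      also have "(C k)\<^sup>2 + 2 * primitive T (\<lambda>s. C k * F k s) t + 2 * primitive T (\<lambda>s. ?P s * F k s) t =
          (C k)\<^sup>2 + 2 * primitive T (\<lambda>s. C k * F k s + ?P s * F k s) t"
        by (subst primitive_add[OF CF PF]) simp
      also have "primitive T (\<lambda>s. C k * F k s + ?P s * F k s) t = primitive T (\<lambda>s. \<kappa> k * G k s) t"
      proof (rule primitive_cong_AE)
        show "AE s in ?M. C k * F k s + ?P s * F k s = \<kappa> k * G k s"
          using C[of k]
        proof eventually_elim
          case (elim s)
          then have "C k + ?P s = \<kappa> k * (w s \<bullet> basis k)"
            by (simp add: inner_j_basis \<kappa>_def mult.commute)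
          then show ?case by (simp add: G_def flip: distrib_right)
        qed
      qed (use CF PF G in auto)
      finally show ?thesis by (simp add: primitive_mult)
    qed
    have "(c k t)\<^sup>2 * \<kappa> k = (C k)\<^sup>2 / \<kappa> k + 2 * primitive T (G k) t" for t
    proof -
      have "(c k t)\<^sup>2 * \<kappa> k = (C k + ?P t)\<^sup>2 / \<kappa> k"
        using False by (simp add: c_def power2_eq_square)
      also have "\<dots> = (C k)\<^sup>2 / \<kappa> k + 2 * primitive T (G k) t"
        using False by (simp add: eq add_divide_distrib)
      finally show ?thesis .
    qed
    then show ?thesis by blast
  qed
  then obtain K where K: "\<And>k t. (c k t)\<^sup>2 * \<kappa> k = K k + 2 * primitive T (G k) t"
    by metis
  define U where "U = (\<lambda>n t. \<Sum>k<n. c k t *\<^sub>R j (basis k))"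
  have U_cont: "continuous_on S (U n)" for S n
    unfolding U_def using c_cont by (intro continuous_intros) (auto intro: continuous_on_subset)
  have U_w: "AE t in ?M. \<forall>n. U n t = j (proj n (w t))"
    using c_w by eventually_elim (simp add: U_def blinfun_proj)
  have U_norm: "(norm (U n t - U m t))\<^sup>2 =
      (\<Sum>k\<in>{m..<n}. K k) + 2 * primitive T (\<lambda>s. f s (proj n (w s) - proj m (w s))) t" if "m \<le> n" for m n t
  proof -
    have dU: "U n t - U m t = (\<Sum>k\<in>{m..<n}. c k t *\<^sub>R j (basis k))"
      using that sum_diff_nat_ivl[of 0 m n "\<lambda>k. c k t *\<^sub>R j (basis k)"]
      by (simp add: U_def atLeast0LessThan)
    have dG: "f s (proj n (w s) - proj m (w s)) = (\<Sum>k\<in>{m..<n}. G k s)" for s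
      using that sum_diff_nat_ivl[of 0 m n "\<lambda>k. G k s"]
      by (simp add: blinfun.diff_right blinfun_proj atLeast0LessThan G_def F_def mult.commute)
    have "(norm (U n t - U m t))\<^sup>2 = (\<Sum>k\<in>{m..<n}. (c k t)\<^sup>2 * \<kappa> k)"
      unfolding dU
      by (subst norm_sum_Pythagorean) (auto simp: pairwise_def orthogonal_def j_basis_orthogonal \<kappa>_def power_mult_distrib)
    also have "\<dots> = (\<Sum>k\<in>{m..<n}. K k) + 2 * (\<Sum>k\<in>{m..<n}. primitive T (G k) t)"
      by (simp add: K sum.distrib sum_distrib_left)
    also have "(\<Sum>k\<in>{m..<n}. primitive T (G k) t) = primitive T (\<lambda>s. f s (proj n (w s) - proj m (w s))) t"
      unfolding dG by (rule primitive_sum[symmetric]) (rule G)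
    finally show ?thesis .
  qed
  have proj_L2: "(\<lambda>t. proj n (w t)) \<in> L2 T" for n
    by (rule L2_dominated[OF proj_measurable[OF L2_measurable[OF w]] L2_integrable[OF w]])
      (intro power_mono norm_proj_le norm_ge_zero)
  define \<rho> where "\<rho> = (\<lambda>n t. w t - proj n (w t))"
  have \<rho>: "\<rho> n \<in> L2 T" for n
    using L2_combination[OF w proj_L2[of n], of 1 "-1"] by (simp add: \<rho>_def)
  have \<rho>_le: "norm (\<rho> n t) \<le> norm (w t)" and \<rho>_lim: "(\<lambda>n. norm (\<rho> n t)) \<longlonglongrightarrow> 0" for n t
    using norm_proj_residual_le tendsto_norm[OF tendsto_diff[OF tendsto_const proj_tendsto, of "w t" "w t"]]
    by (simp_all add: \<rho>_def)
  \<comment> \<open>Integrating the energy identity of \<open>U n - U m\<close> over the initial time will bound \<open>T\<close> times its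
    squared norm, at every time, by \<open>\<beta> n + \<beta> m\<close>.\<close>
  define \<beta> where "\<beta> = (\<lambda>n. 2 * (norm j)\<^sup>2 * (\<integral>s. (norm (\<rho> n s))\<^sup>2 \<partial>?M) +
      4 * T * (\<integral>s. norm (f s) * norm (\<rho> n s) \<partial>?M))"
  have "(\<lambda>n. \<integral>s. (norm (\<rho> n s))\<^sup>2 \<partial>?M) \<longlonglongrightarrow> (\<integral>s. 0 \<partial>?M)"
  proof (rule integral_dominated_convergence[OF _ _ L2_integrable[OF w]])
    show "AE s in ?M. (\<lambda>n. (norm (\<rho> n s))\<^sup>2) \<longlonglongrightarrow> 0"
      using tendsto_power[OF \<rho>_lim, of _ 2] by (auto intro!: AE_I2)
    show "AE s in ?M. norm ((norm (\<rho> n s))\<^sup>2) \<le> (norm (w s))\<^sup>2" for n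
      using \<rho>_le by (auto intro!: AE_I2 power_mono)
  qed (use L2_integrable[OF \<rho>] in auto)
  moreover have "(\<lambda>n. \<integral>s. norm (f s) * norm (\<rho> n s) \<partial>?M) \<longlonglongrightarrow> (\<integral>s. 0 \<partial>?M)"
  proof (rule integral_dominated_convergence[OF _ _ L2_norm_mult_integrable[OF f w]])
    show "AE s in ?M. (\<lambda>n. norm (f s) * norm (\<rho> n s)) \<longlonglongrightarrow> 0"
      using tendsto_mult_left[OF \<rho>_lim] by (auto intro!: AE_I2)
    show "AE s in ?M. norm (norm (f s) * norm (\<rho> n s)) \<le> norm (f s) * norm (w s)" for n
      using \<rho>_le by (auto intro!: AE_I2 mult_left_mono simp: abs_mult)
  qed (use L2_norm_mult_integrable[OF f \<rho>] in auto)
  ultimately have "\<beta> \<longlonglongrightarrow> 2 * (norm j)\<^sup>2 * (\<integral>s. 0 \<partial>?M) + 4 * T * (\<integral>s. 0 \<partial>?M)"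
    unfolding \<beta>_def by (intro tendsto_intros)
  then have \<beta>: "\<beta> \<longlonglongrightarrow> 0" by simp
  have U_bound: "T * (norm (U n t - U m t))\<^sup>2 \<le> \<beta> n + \<beta> m" if "m \<le> n" for m n t
  proof -
    let ?g = "\<lambda>s. f s (proj n (w s) - proj m (w s))"
    let ?I = "\<integral>s. norm (f s) * norm (\<rho> n s) \<partial>?M" and ?J = "\<integral>s. norm (f s) * norm (\<rho> m s) \<partial>?M"
    have g: "integrable ?M ?g"
      using dual_pairing_integrable[OF f L2_combination[OF proj_L2 proj_L2, of 1 _ "-1"]] by simp
    have "(\<integral>s. \<bar>?g s\<bar> \<partial>?M) \<le> (\<integral>s. norm (f s) * norm (\<rho> n s) + norm (f s) * norm (\<rho> m s) \<partial>?M)"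
    proof (rule integral_mono)
      fix s
      have "\<bar>?g s\<bar> \<le> norm (f s) * norm (proj n (w s) - proj m (w s))"
        using norm_blinfun[of "f s"] by simp
      also have "\<dots> \<le> norm (f s) * (norm (\<rho> n s) + norm (\<rho> m s))"
        using norm_triangle_ineq4[of "\<rho> m s" "\<rho> n s"]
        by (intro mult_left_mono) (auto simp: \<rho>_def)
      finally show "\<bar>?g s\<bar> \<le> norm (f s) * norm (\<rho> n s) + norm (f s) * norm (\<rho> m s)"
        by (simp add: distrib_left)
    qed (use g L2_norm_mult_integrable[OF f \<rho>] in auto)
    then have g_le: "(\<integral>s. \<bar>?g s\<bar> \<partial>?M) \<le> ?I + ?J"
      using L2_norm_mult_integrable[OF f \<rho>] by simp
    have point: "(norm (U n t - U m t))\<^sup>2 \<le> (norm (U n s - U m s))\<^sup>2 + 4 * (?I + ?J)" for s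
      using abs_primitive_le[OF g, of t] abs_primitive_le[OF g, of s] g_le
      by (simp add: U_norm[OF that] abs_le_iff)
    have bnd: "AE s in ?M. (norm (U n t - U m t))\<^sup>2 \<le>
        2 * (norm j)\<^sup>2 * (norm (\<rho> n s))\<^sup>2 + 2 * (norm j)\<^sup>2 * (norm (\<rho> m s))\<^sup>2 + 4 * (?I + ?J)"
      using U_w
    proof eventually_elim
      case (elim s)
      have "norm (U n s - U m s) = norm (j (\<rho> m s - \<rho> n s))"
        using elim by (simp add: \<rho>_def blinfun.diff_right)
      also have "\<dots> \<le> norm j * norm (\<rho> m s - \<rho> n s)"
        by (rule norm_blinfun)
      finally have "(norm (U n s - U m s))\<^sup>2 \<le> (norm j)\<^sup>2 * (norm (\<rho> m s - \<rho> n s))\<^sup>2"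
        by (subst power_mult_distrib[symmetric]) (intro power_mono norm_ge_zero)
      also have "\<dots> \<le> (norm j)\<^sup>2 * (2 * (norm (\<rho> m s))\<^sup>2 + 2 * (norm (\<rho> n s))\<^sup>2)"
        using norm_combination_square_le[of 1 "\<rho> m s" "-1" "\<rho> n s"] by (intro mult_left_mono) auto
      finally show ?case using point[of s] by (simp add: algebra_simps)
    qed
    have i: "integrable ?M (\<lambda>s. 2 * (norm j)\<^sup>2 * (norm (\<rho> k s))\<^sup>2)" for k
      by (intro integrable_mult_right L2_integrable \<rho>)
    have meas: "measure ?M (space ?M) = T"
      using T by (simp add: measure_restrict_space)
    have "(\<integral>s. (norm (U n t - U m t))\<^sup>2 \<partial>?M) \<le> (\<integral>s. 2 * (norm j)\<^sup>2 * (norm (\<rho> n s))\<^sup>2 +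
        2 * (norm j)\<^sup>2 * (norm (\<rho> m s))\<^sup>2 + 4 * (?I + ?J) \<partial>?M)"
      by (intro integral_mono_AE bnd Bochner_Integration.integrable_add i integrable_time_const)
    also have "\<dots> = 2 * (norm j)\<^sup>2 * (\<integral>s. (norm (\<rho> n s))\<^sup>2 \<partial>?M) +
        2 * (norm j)\<^sup>2 * (\<integral>s. (norm (\<rho> m s))\<^sup>2 \<partial>?M) + T * (4 * (?I + ?J))"
      by (simp only: Bochner_Integration.integral_add[OF Bochner_Integration.integrable_add[OF i i] integrable_time_const]
          Bochner_Integration.integral_add[OF i i] integral_mult_right_zero lebesgue_integral_const meas real_scaleR_def)
    finally show ?thesis
      using meas by (simp add: \<beta>_def algebra_simps)
  qed
  have "uniformly_Cauchy_on {0..T} U"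
  proof (rule uniformly_Cauchy_onI)
    fix \<epsilon> :: real assume \<epsilon>: "\<epsilon> > 0"
    then have "\<forall>\<^sub>F n in sequentially. \<beta> n < T * \<epsilon>\<^sup>2 / 2"
      using T by (intro order_tendstoD(2)[OF \<beta>]) simp
    then obtain N where N: "\<And>n. n \<ge> N \<Longrightarrow> \<beta> n < T * \<epsilon>\<^sup>2 / 2"
      by (auto simp: eventually_sequentially)
    have "dist (U m t) (U n t) < \<epsilon>" if "m \<ge> N" "n \<ge> N" for m n t
    proof -
      have "T * (norm (U m t - U n t))\<^sup>2 \<le> \<beta> m + \<beta> n"
        using U_bound[of m n t] U_bound[of n m t] by (cases "m \<le> n") (auto simp: norm_minus_commute)
      also have "\<dots> < T * \<epsilon>\<^sup>2"
        using N[OF that(1)] N[OF that(2)] by simp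
      finally have "(norm (U m t - U n t))\<^sup>2 < \<epsilon>\<^sup>2"
        using T by simp
      then show ?thesis
        using \<epsilon> by (simp add: dist_norm power2_less_imp_less)
    qed
    then show "\<exists>M. \<forall>t\<in>{0..T}. \<forall>m\<ge>M. \<forall>n\<ge>M. dist (U m t) (U n t) < \<epsilon>"
      by blast
  qed
  then obtain u where u: "uniform_limit {0..T} U u sequentially"
    using Cauchy_uniformly_convergent uniformly_convergent_on_def by blast
  have "continuous_on {0..T} u"
    by (rule uniform_limit_theorem[OF _ u]) (auto intro!: always_eventually U_cont)
  moreover have "AE t in ?M. u t = j (w t)"
    using U_w AE_space
  proof eventually_elim
    case (elim t)
    have "(\<lambda>n. U n t) \<longlonglongrightarrow> u t"
      using elim by (intro tendsto_uniform_limitI[OF u]) auto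
    moreover have "(\<lambda>n. U n t) \<longlonglongrightarrow> j (w t)"
      using elim by (simp add: tendsto_intros proj_tendsto)
    ultimately show ?case by (rule LIMSEQ_unique)
  qed
  moreover have "(norm (u T))\<^sup>2 - (norm (u 0))\<^sup>2 = 2 * (\<integral>t. f t (w t) \<partial>?M)"
  proof (rule LIMSEQ_unique)
    show "(\<lambda>n. (norm (U n T))\<^sup>2 - (norm (U n 0))\<^sup>2) \<longlonglongrightarrow> (norm (u T))\<^sup>2 - (norm (u 0))\<^sup>2"
      using T by (intro tendsto_intros tendsto_uniform_limitI[OF u]) auto
    have "(norm (U n T))\<^sup>2 - (norm (U n 0))\<^sup>2 = 2 * (\<integral>t. f t (proj n (w t)) \<partial>?M)" for n
      using U_norm[of 0 n T] U_norm[of 0 n 0]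
      by (simp add: U_def proj_def[of 0] primitive_0 primitive_end)
    moreover have "(\<lambda>n. \<integral>t. f t (proj n (w t)) \<partial>?M) \<longlonglongrightarrow> (\<integral>t. f t (w t) \<partial>?M)"
    proof (rule integral_dominated_convergence[OF _ _ L2_norm_mult_integrable[OF f w]])
      show "AE t in ?M. (\<lambda>n. f t (proj n (w t))) \<longlonglongrightarrow> f t (w t)"
        by (intro AE_I2 tendsto_intros proj_tendsto)
      show "AE t in ?M. norm (f t (proj n (w t))) \<le> norm (f t) * norm (w t)" for n
        by (intro AE_I2 order_trans[OF norm_blinfun] mult_left_mono norm_proj_le norm_ge_zero)
    qed (use dual_pairing_integrable[OF f w] dual_pairing_integrable[OF f proj_L2] in auto)
    ultimately show "(\<lambda>n. (norm (U n T))\<^sup>2 - (norm (U n 0))\<^sup>2) \<longlonglongrightarrow> 2 * (\<integral>t. f t (w t) \<partial>?M)"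
      by (simp add: tendsto_mult_left)
  qed
  ultimately show ?thesis by blast
qed

end

lemma closed_time_interval_AE:
  assumes T: "T > 0" and C: "closed C" and ae: "AE t in time_measure T. t \<in> C"
  shows "{0..T} \<subseteq> C"
proof -
  have "AE t\<in>{0<..<T} in lebesgue. t \<in> C"
    using ae by (simp add: AE_restrict_space_iff)
  then have "{0<..<T} \<subseteq> C"
    using mem_closed_if_AE_lebesgue_open[OF open_greaterThanLessThan C] by blast
  then have "closure {0<..<T} \<subseteq> C"
    using C by (rule closure_minimal)
  then show ?thesis using T by simp
qed

lemma continuous_representative_unique:
  fixes c c' :: "real \<Rightarrow> 'b::real_normed_vector"
  assumes T: "T > 0" and c: "continuous_on {0..T} c" "continuous_on {0..T} c'"
    and ae: "AE t in time_measure T. c t = c' t" and t: "t \<in> {0..T}"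
  shows "c t = c' t"
proof -
  let ?C = "{t \<in> {0..T}. c t - c' t \<in> {0}}"
  have "closed ?C"
    by (intro continuous_closed_preimage[unfolded vimage_def Int_def, simplified] continuous_on_diff c) auto
  moreover have "AE t in time_measure T. t \<in> ?C"
    using ae AE_space by eventually_elim auto
  ultimately have "{0..T} \<subseteq> ?C"
    by (rule closed_time_interval_AE[OF T])
  with t show ?thesis by auto
qed

lemma time_trace_eq:
  fixes j :: "'v::{real_inner,banach,second_countable_topology} \<Rightarrow>\<^sub>L
              'h::{real_inner,banach,second_countable_topology}"
  assumes T: "T > 0" and c: "continuous_on {0..T} c" and ae: "AE t in time_measure T. c t = j (w t)"
    and t: "t \<in> {0..T}"
  shows "time_trace j T t w = c t"
  unfolding time_trace_def
proof (rule the_equality)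
  show "\<exists>c'. continuous_on {0..T} c' \<and> (AE s in time_measure T. c' s = j (w s)) \<and> c' t = c t"
    using c ae by blast
  fix h assume "\<exists>c'. continuous_on {0..T} c' \<and> (AE s in time_measure T. c' s = j (w s)) \<and> c' t = h"
  then obtain c' where c': "continuous_on {0..T} c'" "AE s in time_measure T. c' s = j (w s)" "c' t = h"
    by blast
  have "AE s in time_measure T. c' s = c s"
    using c'(2) ae by eventually_elim simp
  from continuous_representative_unique[OF T c'(1) c this t] c'(3) show "h = c t"
    by simp
qed

lemma X_space_L2: "w \<in> X_space j T \<Longrightarrow> w \<in> L2 T"
  by (simp add: X_space_def)

lemma time_deriv:
  fixes j :: "'v::{real_inner,banach,second_countable_topology} \<Rightarrow>\<^sub>L
              'h::{real_inner,banach,second_countable_topology}"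
  assumes "w \<in> X_space j T"
  shows time_deriv_L2: "time_deriv j T w \<in> L2 T"
    and time_deriv_weak_derivative: "weak_derivative j T w (time_deriv j T w)"
proof -
  have "\<exists>f. f \<in> L2 T \<and> weak_derivative j T w f"
    using assms by (auto simp: X_space_def)
  from someI_ex[OF this] show "time_deriv j T w \<in> L2 T" "weak_derivative j T w (time_deriv j T w)"
    by (simp_all add: time_deriv_def)
qed

context gelfand_triple
begin

lemma weak_derivative_unique:
  assumes f: "f \<in> L2 T" "weak_derivative j T w f" and g: "g \<in> L2 T" "weak_derivative j T w g"
  shows "AE t in time_measure T. f t = g t"
proof -
  have "AE t in time_measure T. f t (basis k) - g t (basis k) = 0" for k
  proof (rule AE_zero_if_bump_integrals_zero)
    have i: "integrable (time_measure T) (\<lambda>t. f t (basis k))" "integrable (time_measure T) (\<lambda>t. g t (basis k))"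
      by (intro dual_pairing_integrable L2_const f g)+
    then show "integrable (time_measure T) (\<lambda>t. f t (basis k) - g t (basis k))"
      by simp
    fix a b :: real and n assume ab: "0 < a" "b < T"
    have p: "bump a b n \<in> test_functions T"
      using ab by (rule bump_test_function)
    have "(\<integral>t. bump a b n t * f t (basis k) \<partial>time_measure T) = (\<integral>t. bump a b n t * g t (basis k) \<partial>time_measure T)"
      using f(2)[unfolded weak_derivative_def, rule_format, OF p, of "basis k"]
        g(2)[unfolded weak_derivative_def, rule_format, OF p, of "basis k"] by simp
    then show "(\<integral>t. bump a b n t * (f t (basis k) - g t (basis k)) \<partial>time_measure T) = 0"
      using integrable_continuous_mult[OF continuous_test_function(1)[OF p] i(1)]
        integrable_continuous_mult[OF continuous_test_function(1)[OF p] i(2)]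
      by (simp add: right_diff_distrib)
  qed
  then have "AE t in time_measure T. \<forall>k. f t (basis k) - g t (basis k) = 0"
    by (simp add: AE_all_countable)
  then show ?thesis
  proof eventually_elim
    case (elim t)
    show "f t = g t"
    proof (rule blinfun_eqI)
      fix x
      have eq: "f t (proj n x) = g t (proj n x)" for n
        using elim by (simp add: blinfun_proj)
      have "(\<lambda>n. f t (proj n x)) \<longlonglongrightarrow> f t x" "(\<lambda>n. g t (proj n x)) \<longlonglongrightarrow> g t x"
        by (intro tendsto_intros proj_tendsto)+
      then show "f t x = g t x"
        unfolding eq by (rule LIMSEQ_unique)
    qed
  qed
qed

lemma weak_derivative_combination:
  assumes v: "v \<in> L2 T" and w: "w \<in> L2 T" and f: "f \<in> L2 T" and g: "g \<in> L2 T"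
    and "weak_derivative j T v f" "weak_derivative j T w g"
  shows "weak_derivative j T (\<lambda>t. r *\<^sub>R v t + s *\<^sub>R w t) (\<lambda>t. r *\<^sub>R f t + s *\<^sub>R g t)"
  unfolding weak_derivative_def
proof (intro ballI allI)
  fix p z assume p: "p \<in> test_functions T"
  let ?M = "time_measure T"
  note cont = continuous_test_function[OF p]
  have i: "integrable ?M (\<lambda>t. deriv p t * (j (v t) \<bullet> j z))" "integrable ?M (\<lambda>t. deriv p t * (j (w t) \<bullet> j z))"
    "integrable ?M (\<lambda>t. p t * f t z)" "integrable ?M (\<lambda>t. p t * g t z)"
    by (intro integrable_continuous_mult cont embedded_inner_integrable dual_pairing_integrable L2_const v w f g)+
  have "(\<integral>t. deriv p t * (j (r *\<^sub>R v t + s *\<^sub>R w t) \<bullet> j z) \<partial>?M) =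
      (\<integral>t. r * (deriv p t * (j (v t) \<bullet> j z)) + s * (deriv p t * (j (w t) \<bullet> j z)) \<partial>?M)"
    by (simp add: blinfun.add_right blinfun.scaleR_right inner_add_left algebra_simps)
  also have "\<dots> = r * (\<integral>t. deriv p t * (j (v t) \<bullet> j z) \<partial>?M) + s * (\<integral>t. deriv p t * (j (w t) \<bullet> j z) \<partial>?M)"
    using i by simp
  also have "\<dots> = - (r * (\<integral>t. p t * f t z \<partial>?M) + s * (\<integral>t. p t * g t z \<partial>?M))"
    using assms(5,6) p by (simp add: weak_derivative_def)
  also have "r * (\<integral>t. p t * f t z \<partial>?M) + s * (\<integral>t. p t * g t z \<partial>?M) =
      (\<integral>t. r * (p t * f t z) + s * (p t * g t z) \<partial>?M)"
    using i by simp
  also have "\<dots> = (\<integral>t. p t * (r *\<^sub>R f t + s *\<^sub>R g t) z \<partial>?M)"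
    by (simp add: blinfun.add_left blinfun.scaleR_left algebra_simps)
  finally show "(\<integral>t. deriv p t * (j (r *\<^sub>R v t + s *\<^sub>R w t) \<bullet> j z) \<partial>?M) =
      - (\<integral>t. p t * (r *\<^sub>R f t + s *\<^sub>R g t) z \<partial>?M)" .
qed

lemma X_space_combination:
  assumes v: "v \<in> X_space j T" and w: "w \<in> X_space j T"
  shows "(\<lambda>t. r *\<^sub>R v t + s *\<^sub>R w t) \<in> X_space j T"
  unfolding X_space_def mem_Collect_eq
  using L2_combination[OF X_space_L2[OF v] X_space_L2[OF w]]
    L2_dual_combination[OF time_deriv_L2[OF v] time_deriv_L2[OF w]]
    weak_derivative_combination[OF X_space_L2[OF v] X_space_L2[OF w] time_deriv_L2[OF v] time_deriv_L2[OF w]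
      time_deriv_weak_derivative[OF v] time_deriv_weak_derivative[OF w]]
  by blast

lemma time_deriv_combination:
  assumes v: "v \<in> X_space j T" and w: "w \<in> X_space j T"
  shows "AE t in time_measure T. time_deriv j T (\<lambda>t. r *\<^sub>R v t + s *\<^sub>R w t) t =
    r *\<^sub>R time_deriv j T v t + s *\<^sub>R time_deriv j T w t"
  by (rule weak_derivative_unique[OF time_deriv[OF X_space_combination[OF v w]]
        L2_dual_combination[OF time_deriv_L2[OF v] time_deriv_L2[OF w]]
        weak_derivative_combination[OF X_space_L2[OF v] X_space_L2[OF w] time_deriv_L2[OF v] time_deriv_L2[OF w]
          time_deriv_weak_derivative[OF v] time_deriv_weak_derivative[OF w]]])

lemma time_deriv_AE_zero:
  assumes w: "w \<in> X_space j T" and ae: "AE t in time_measure T. w t = 0"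
  shows "AE t in time_measure T. time_deriv j T w t = 0"
proof (rule weak_derivative_unique[OF time_deriv[OF w]])
  show "(\<lambda>t. 0 :: 'v \<Rightarrow>\<^sub>L real) \<in> L2 T"
    by (simp add: L2_def)
  have "(\<integral>t. deriv p t * (j (w t) \<bullet> j z) \<partial>time_measure T) = 0" for p z
    by (rule integral_eq_zero_AE) (use ae in eventually_elim, simp add: blinfun.zero_right)
  then show "weak_derivative j T w (\<lambda>t. 0)"
    by (simp add: weak_derivative_def)
qed

lemma time_trace_continuous:
  assumes T: "T > 0" and w: "w \<in> X_space j T"
  shows "continuous_on {0..T} (\<lambda>t. time_trace j T t w)"
    and "AE t in time_measure T. time_trace j T t w = j (w t)"
    and "(norm (time_trace j T T w))\<^sup>2 - (norm (time_trace j T 0 w))\<^sup>2 =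
      2 * (\<integral>t. time_deriv j T w t (w t) \<partial>time_measure T)"
proof -
  obtain c where c: "continuous_on {0..T} c" "AE t in time_measure T. c t = j (w t)"
    and e: "(norm (c T))\<^sup>2 - (norm (c 0))\<^sup>2 = 2 * (\<integral>t. time_deriv j T w t (w t) \<partial>time_measure T)"
    using continuous_representative[OF T X_space_L2[OF w] time_deriv[OF w]] by blast
  have eq: "time_trace j T t w = c t" if "t \<in> {0..T}" for t
    by (rule time_trace_eq[OF T c that])
  show "continuous_on {0..T} (\<lambda>t. time_trace j T t w)"
    using c(1) by (rule continuous_on_eq) (simp add: eq)
  show "AE t in time_measure T. time_trace j T t w = j (w t)"
    using c(2) AE_space by eventually_elim (simp add: eq)
  show "(norm (time_trace j T T w))\<^sup>2 - (norm (time_trace j T 0 w))\<^sup>2 =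
      2 * (\<integral>t. time_deriv j T w t (w t) \<partial>time_measure T)"
    using e T by (simp add: eq)
qed

lemma time_trace_combination:
  assumes T: "T > 0" and v: "v \<in> X_space j T" and w: "w \<in> X_space j T" and t: "t \<in> {0..T}"
  shows "time_trace j T t (\<lambda>t. r *\<^sub>R v t + s *\<^sub>R w t) = r *\<^sub>R time_trace j T t v + s *\<^sub>R time_trace j T t w"
proof (rule time_trace_eq[OF T _ _ t, of "\<lambda>t. r *\<^sub>R time_trace j T t v + s *\<^sub>R time_trace j T t w"])
  show "continuous_on {0..T} (\<lambda>t. r *\<^sub>R time_trace j T t v + s *\<^sub>R time_trace j T t w)"
    by (intro continuous_intros time_trace_continuous T v w)
  show "AE t in time_measure T. r *\<^sub>R time_trace j T t v + s *\<^sub>R time_trace j T t w = j (r *\<^sub>R v t + s *\<^sub>R w t)"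
    using time_trace_continuous(2)[OF T v] time_trace_continuous(2)[OF T w]
    by eventually_elim (simp add: blinfun.add_right blinfun.scaleR_right)
qed

end

section \<open>The operators of the parabolic problem\<close>

lemma time_measurable_cong_AE:
  fixes f g :: "real \<Rightarrow> real"
  assumes f: "f \<in> borel_measurable (time_measure T)" and ae: "AE t in time_measure T. f t = g t"
  shows "g \<in> borel_measurable (time_measure T)"
proof -
  have S: "{0<..<T} \<in> sets lebesgue" by simp
  have "(\<lambda>t. if t \<in> {0<..<T} then g t else 0) \<in> borel_measurable lebesgue"
  proof (rule borel_measurable_AE)
    show "(\<lambda>t. if t \<in> {0<..<T} then f t else 0) \<in> borel_measurable lebesgue"
      using f by (simp only: borel_measurable_if[OF S])
    have "AE t in lebesgue. t \<in> {0<..<T} \<longrightarrow> f t = g t"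
      using ae by (simp add: AE_restrict_space_iff)
    then show "AE t in lebesgue. (if t \<in> {0<..<T} then f t else 0) = (if t \<in> {0<..<T} then g t else 0)"
      by eventually_elim auto
  qed
  then show ?thesis
    by (simp only: borel_measurable_if[OF S])
qed

lemma bounded_bilinear_if_bilinear_bound:
  fixes h :: "'a::real_normed_vector \<Rightarrow> 'a \<Rightarrow> real"
  assumes h: "bilinear h" and bound: "\<And>x z. \<bar>h x z\<bar> \<le> C * norm x * norm z"
  shows "bounded_bilinear h"
proof
  show "\<exists>K. \<forall>x z. norm (h x z) \<le> norm x * norm z * K"
    using bound by (intro exI[of _ C]) (simp add: mult_ac)
qed (use bilinear_ladd[OF h] bilinear_radd[OF h] bilinear_lmul[OF h] bilinear_rmul[OF h] in auto)

text \<open>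
  A Gelfand triple with a measurable, bounded and coercive family of bilinear forms on it.
\<close>

locale parabolic = gelfand_triple j
  for j :: "'v::{real_inner,banach,second_countable_topology} \<Rightarrow>\<^sub>L
            'h::{real_inner,banach,second_countable_topology}" +
  fixes T :: real and a :: "real \<Rightarrow> 'v \<Rightarrow> 'v \<Rightarrow> real"
  assumes T_pos: "T > 0" and form: "parabolic_form T a"
begin

lemma form_bound:
  obtains C where "C \<ge> 0" "AE t in time_measure T. \<forall>x z. \<bar>a t x z\<bar> \<le> C * norm x * norm z"
proof -
  obtain C where "AE t in time_measure T. \<forall>x z. \<bar>a t x z\<bar> \<le> C * norm x * norm z"
    using form by (auto simp: parabolic_form_def)
  then have "AE t in time_measure T. \<forall>x z. \<bar>a t x z\<bar> \<le> \<bar>C\<bar> * norm x * norm z"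
  proof eventually_elim
    case (elim t)
    have "C * norm x * norm z \<le> \<bar>C\<bar> * norm x * norm z" for x z :: 'v
      by (intro mult_right_mono) auto
    then show ?case using elim order_trans by blast
  qed
  then show thesis using that[of "\<bar>C\<bar>"] by simp
qed

lemma form_bounded_bilinear: "AE t in time_measure T. bounded_bilinear (a t)"
proof -
  obtain C where C: "AE t in time_measure T. \<forall>x z. \<bar>a t x z\<bar> \<le> C * norm x * norm z"
    using form_bound by blast
  have "AE t in time_measure T. bilinear (a t)"
    using form by (simp add: parabolic_form_def)
  with C show ?thesis
    by eventually_elim (blast intro: bounded_bilinear_if_bilinear_bound)
qed

text \<open>
  The form is only known to be measurable for constant arguments; expand both arguments in the basis.
\<close>

lemma form_measurable:
  assumes w: "w \<in> borel_measurable (time_measure T)" and v: "v \<in> borel_measurable (time_measure T)"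
  shows "(\<lambda>t. a t (w t) (v t)) \<in> borel_measurable (time_measure T)"
proof -
  let ?s = "\<lambda>n t. \<Sum>i<n. \<Sum>k<n. (w t \<bullet> basis i) * ((v t \<bullet> basis k) * a t (basis i) (basis k))"
  have [measurable]: "(\<lambda>t. a t x z) \<in> borel_measurable (time_measure T)" for x z
    using form by (simp add: parabolic_form_def)
  have "(\<lambda>t. lim (\<lambda>n. ?s n t)) \<in> borel_measurable (time_measure T)"
    using w v by measurable
  moreover have "AE t in time_measure T. lim (\<lambda>n. ?s n t) = a t (w t) (v t)"
    using form_bounded_bilinear
  proof eventually_elim
    case (elim t)
    then interpret bounded_bilinear "a t" .
    have "?s n t = a t (proj n (w t)) (proj n (v t))" for n
      unfolding proj_def
      by (subst sum.swap)
        (simp add: sum_left sum_right scaleR_left scaleR_right sum_distrib_left mult.left_commute)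
    moreover have "(\<lambda>n. a t (proj n (w t)) (proj n (v t))) \<longlonglongrightarrow> a t (w t) (v t)"
      by (intro tendsto proj_tendsto)
    ultimately show ?case by (simp add: limI)
  qed
  ultimately show ?thesis by (rule time_measurable_cong_AE)
qed

lemma form_integrable:
  assumes w: "w \<in> L2 T" and v: "v \<in> L2 T"
  shows "integrable (time_measure T) (\<lambda>t. a t (w t) (v t))"
proof -
  obtain C where C: "C \<ge> 0" "AE t in time_measure T. \<forall>x z. \<bar>a t x z\<bar> \<le> C * norm x * norm z"
    by (rule form_bound)
  show ?thesis
  proof (rule Bochner_Integration.integrable_bound)
    show "integrable (time_measure T) (\<lambda>t. C * (norm (w t) * norm (v t)))"
      by (intro integrable_mult_right L2_norm_mult_integrable w v)
    show "(\<lambda>t. a t (w t) (v t)) \<in> borel_measurable (time_measure T)"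
      by (intro form_measurable L2_measurable w v)
    show "AE t in time_measure T. norm (a t (w t) (v t)) \<le> norm (C * (norm (w t) * norm (v t)))"
      using C(2) by eventually_elim (use C(1) in \<open>auto simp: abs_mult mult.assoc\<close>)
  qed
qed

lemma A_op_combination_left:
  assumes "v \<in> L2 T" "w \<in> L2 T" "z \<in> L2 T"
  shows "A_op a T (\<lambda>t. r *\<^sub>R v t + s *\<^sub>R w t) z = r * A_op a T v z + s * A_op a T w z"
proof -
  let ?M = "time_measure T"
  have "(\<integral>t. a t (r *\<^sub>R v t + s *\<^sub>R w t) (z t) \<partial>?M) = (\<integral>t. r * a t (v t) (z t) + s * a t (w t) (z t) \<partial>?M)"
  proof (rule integral_cong_AE)
    show "(\<lambda>t. a t (r *\<^sub>R v t + s *\<^sub>R w t) (z t)) \<in> borel_measurable ?M"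
      by (intro form_measurable L2_measurable L2_combination assms)
    show "(\<lambda>t. r * a t (v t) (z t) + s * a t (w t) (z t)) \<in> borel_measurable ?M"
      by (intro borel_measurable_add borel_measurable_times borel_measurable_const form_measurable L2_measurable assms)
    show "AE t in ?M. a t (r *\<^sub>R v t + s *\<^sub>R w t) (z t) = r * a t (v t) (z t) + s * a t (w t) (z t)"
      using form_bounded_bilinear
      by eventually_elim (simp add: bounded_bilinear.add_left bounded_bilinear.scaleR_left)
  qed
  then show ?thesis
    using form_integrable assms by (simp add: A_op_def)
qed

lemma A_op_combination_right:
  assumes "v \<in> L2 T" "w \<in> L2 T" "z \<in> L2 T"
  shows "A_op a T z (\<lambda>t. r *\<^sub>R v t + s *\<^sub>R w t) = r * A_op a T z v + s * A_op a T z w"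
proof -
  let ?M = "time_measure T"
  have "(\<integral>t. a t (z t) (r *\<^sub>R v t + s *\<^sub>R w t) \<partial>?M) = (\<integral>t. r * a t (z t) (v t) + s * a t (z t) (w t) \<partial>?M)"
  proof (rule integral_cong_AE)
    show "(\<lambda>t. a t (z t) (r *\<^sub>R v t + s *\<^sub>R w t)) \<in> borel_measurable ?M"
      by (intro form_measurable L2_measurable L2_combination assms)
    show "(\<lambda>t. r * a t (z t) (v t) + s * a t (z t) (w t)) \<in> borel_measurable ?M"
      by (intro borel_measurable_add borel_measurable_times borel_measurable_const form_measurable L2_measurable assms)
    show "AE t in ?M. a t (z t) (r *\<^sub>R v t + s *\<^sub>R w t) = r * a t (z t) (v t) + s * a t (z t) (w t)"
      using form_bounded_bilinear
      by eventually_elim (simp add: bounded_bilinear.add_right bounded_bilinear.scaleR_right)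
  qed
  then show ?thesis
    using form_integrable assms by (simp add: A_op_def)
qed

lemma A_op_coercive: "\<exists>c>0. \<forall>v\<in>L2 T. c * (\<integral>t. (norm (v t))\<^sup>2 \<partial>time_measure T) \<le> A_op a T v v"
proof -
  obtain c where c: "c > 0" "AE t in time_measure T. \<forall>x. a t x x \<ge> c * (norm x)\<^sup>2"
    using form by (auto simp: parabolic_form_def)
  have "c * (\<integral>t. (norm (v t))\<^sup>2 \<partial>time_measure T) \<le> A_op a T v v" if v: "v \<in> L2 T" for v
    unfolding A_op_def integral_mult_right_zero[symmetric]
    using c(2) by (intro integral_mono_AE integrable_mult_right L2_integrable form_integrable v)
      (auto elim: eventually_mono)
  with c(1) show ?thesis by blast
qed

lemma As_op_combination:
  assumes "v \<in> L2 T" "w \<in> L2 T" "z \<in> L2 T"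
  shows As_op_combination_left: "As_op a T (\<lambda>t. r *\<^sub>R v t + s *\<^sub>R w t) z = r * As_op a T v z + s * As_op a T w z"
    and As_op_combination_right: "As_op a T z (\<lambda>t. r *\<^sub>R v t + s *\<^sub>R w t) = r * As_op a T z v + s * As_op a T z w"
  using assms by (simp_all add: As_op_def A_op_combination_left A_op_combination_right field_simps)

lemma As_op_sym: "As_op a T v w = As_op a T w v"
  by (simp add: As_op_def)

lemma As_op_square:
  assumes "v \<in> L2 T" "w \<in> L2 T"
  shows "As_op a T (\<lambda>t. r *\<^sub>R v t + s *\<^sub>R w t) (\<lambda>t. r *\<^sub>R v t + s *\<^sub>R w t) =
    r\<^sup>2 * As_op a T v v + 2 * r * s * As_op a T v w + s\<^sup>2 * As_op a T w w"
  using assms As_op_sym[of w v]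
  by (simp add: As_op_combination L2_combination power2_eq_square algebra_simps)

lemma As_op_nonneg:
  assumes v: "v \<in> L2 T"
  shows "0 \<le> As_op a T v v"
proof -
  obtain c where "c > 0" "c * (\<integral>t. (norm (v t))\<^sup>2 \<partial>time_measure T) \<le> A_op a T v v"
    using A_op_coercive v by blast
  moreover have "0 \<le> (\<integral>t. (norm (v t))\<^sup>2 \<partial>time_measure T)"
    by simp
  ultimately have "0 \<le> A_op a T v v"
    using mult_nonneg_nonneg[of c "\<integral>t. (norm (v t))\<^sup>2 \<partial>time_measure T"] by linarith
  then show ?thesis
    by (simp add: As_op_def)
qed

lemma norm_Y_square: "v \<in> L2 T \<Longrightarrow> (norm_Y a T v)\<^sup>2 = As_op a T v v"
  by (simp add: norm_Y_def As_op_nonneg)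

lemma norm_Y_scaleR:
  assumes "v \<in> L2 T"
  shows "norm_Y a T (\<lambda>t. r *\<^sub>R v t) = \<bar>r\<bar> * norm_Y a T v"
proof -
  have "As_op a T (\<lambda>t. r *\<^sub>R v t) (\<lambda>t. r *\<^sub>R v t) = r\<^sup>2 * As_op a T v v"
    using As_op_square[OF assms assms, of r 0] by simp
  then show ?thesis
    unfolding norm_Y_def by (simp only: real_sqrt_mult real_sqrt_abs)
qed

lemma B_op_eq:
  assumes w: "w \<in> X_space j T" and v: "v \<in> L2 T"
  shows "B_op j a T w v = (\<integral>t. time_deriv j T w t (v t) \<partial>time_measure T) + A_op a T w v"
  unfolding B_op_def A_op_def
  by (intro Bochner_Integration.integral_add dual_pairing_integrable time_deriv_L2[OF w]
      form_integrable X_space_L2[OF w] v)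

lemma dt_op_eq:
  assumes w: "w \<in> X_space j T" and v: "v \<in> L2 T"
  shows "dt_op j a T w v = (\<integral>t. time_deriv j T w t (v t) \<partial>time_measure T)"
  by (simp add: dt_op_def B_op_eq[OF assms])

lemma dt_op_combination_left:
  assumes v: "v \<in> X_space j T" and w: "w \<in> X_space j T" and z: "z \<in> L2 T"
  shows "dt_op j a T (\<lambda>t. r *\<^sub>R v t + s *\<^sub>R w t) z = r * dt_op j a T v z + s * dt_op j a T w z"
proof -
  let ?M = "time_measure T" and ?u = "\<lambda>t. r *\<^sub>R v t + s *\<^sub>R w t"
  note i = dual_pairing_integrable[OF time_deriv_L2 z]
  have "(\<integral>t. time_deriv j T ?u t (z t) \<partial>?M) =
      (\<integral>t. r * time_deriv j T v t (z t) + s * time_deriv j T w t (z t) \<partial>?M)"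
  proof (rule integral_cong_AE)
    show "AE t in ?M. time_deriv j T ?u t (z t) = r * time_deriv j T v t (z t) + s * time_deriv j T w t (z t)"
      using time_deriv_combination[OF v w, of r s]
      by eventually_elim (simp add: blinfun.add_left blinfun.scaleR_left)
  qed (use i[OF X_space_combination[OF v w]] i[OF v] i[OF w] in auto)
  also have "\<dots> = r * (\<integral>t. time_deriv j T v t (z t) \<partial>?M) + s * (\<integral>t. time_deriv j T w t (z t) \<partial>?M)"
    using i[OF v] i[OF w] by simp
  finally show ?thesis
    by (simp add: dt_op_eq X_space_combination v w z)
qed

lemma dt_op_combination_right:
  assumes w: "w \<in> X_space j T" and v: "v \<in> L2 T" and z: "z \<in> L2 T"
  shows "dt_op j a T w (\<lambda>t. r *\<^sub>R v t + s *\<^sub>R z t) = r * dt_op j a T w v + s * dt_op j a T w z"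
  using dual_pairing_integrable[OF time_deriv_L2[OF w] v] dual_pairing_integrable[OF time_deriv_L2[OF w] z]
  by (simp add: dt_op_eq L2_combination w v z blinfun.add_right blinfun.scaleR_right)

lemma dt_op_energy:
  assumes w: "w \<in> X_space j T"
  shows "2 * dt_op j a T w w = (norm (time_trace j T T w))\<^sup>2 - (norm (time_trace j T 0 w))\<^sup>2"
  by (simp add: dt_op_eq[OF w X_space_L2[OF w]] time_trace_continuous(3)[OF T_pos w])

lemma dt_op_AE_zero:
  assumes w: "w \<in> X_space j T" and v: "v \<in> L2 T" and ae: "AE t in time_measure T. w t = 0"
  shows "dt_op j a T w v = 0"
  unfolding dt_op_eq[OF w v]
  by (rule integral_eq_zero_AE) (use time_deriv_AE_zero[OF w ae] in eventually_elim, simp)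

lemma dt_op_bounded:
  assumes w: "w \<in> X_space j T"
  shows "\<exists>K. \<forall>v\<in>L2 T. norm_Y a T v \<le> 1 \<longrightarrow> \<bar>dt_op j a T w v\<bar> \<le> K"
proof -
  let ?M = "time_measure T" and ?f = "time_deriv j T w"
  obtain c where c: "c > 0" "\<And>v. v \<in> L2 T \<Longrightarrow> c * (\<integral>t. (norm (v t))\<^sup>2 \<partial>?M) \<le> A_op a T v v"
    using A_op_coercive by blast
  have "\<bar>dt_op j a T w v\<bar> \<le> (\<integral>t. (norm (?f t))\<^sup>2 \<partial>?M) + 1 / c"
    if v: "v \<in> L2 T" and 1: "norm_Y a T v \<le> 1" for v
  proof -
    have "\<bar>dt_op j a T w v\<bar> \<le> (\<integral>t. \<bar>?f t (v t)\<bar> \<partial>?M)"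
      unfolding dt_op_eq[OF w v] by (rule integral_abs_bound)
    also have "\<dots> \<le> (\<integral>t. (norm (?f t))\<^sup>2 + (norm (v t))\<^sup>2 \<partial>?M)"
    proof (rule integral_mono)
      fix t
      have "\<bar>?f t (v t)\<bar> \<le> norm (?f t) * norm (v t)"
        using norm_blinfun[of "?f t" "v t"] by simp
      then show "\<bar>?f t (v t)\<bar> \<le> (norm (?f t))\<^sup>2 + (norm (v t))\<^sup>2"
        using sum_squares_bound[of "norm (?f t)" "norm (v t)"] mult_nonneg_nonneg[of "norm (?f t)" "norm (v t)"]
        by simp
    qed (intro integrable_abs dual_pairing_integrable Bochner_Integration.integrable_add L2_integrable time_deriv_L2 w v)+
    also have "\<dots> = (\<integral>t. (norm (?f t))\<^sup>2 \<partial>?M) + (\<integral>t. (norm (v t))\<^sup>2 \<partial>?M)"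
      by (intro Bochner_Integration.integral_add L2_integrable time_deriv_L2 w v)
    also have "(\<integral>t. (norm (v t))\<^sup>2 \<partial>?M) \<le> 1 / c"
    proof -
      have "(norm_Y a T v)\<^sup>2 \<le> 1"
        using 1 As_op_nonneg[OF v] by (simp add: power_le_one norm_Y_def)
      then have "A_op a T v v \<le> 1"
        by (simp add: norm_Y_square[OF v] As_op_def)
      then show ?thesis
        using c(2)[OF v] c(1) by (simp add: field_simps)
    qed
    finally show ?thesis by simp
  qed
  then show ?thesis by blast
qed

end

section \<open>The dual norm and the energy norm of the trial space\<close>

lemma mult_le_if_all_less:
  fixes \<gamma> x y :: real
  assumes "0 < \<gamma>" and le: "\<And>\<eta>. 0 < \<eta> \<Longrightarrow> \<eta> < \<gamma> \<Longrightarrow> \<eta> * x \<le> y"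
  shows "\<gamma> * x \<le> y"
proof (cases "0 < x")
  case True
  have "\<gamma> \<le> y / x"
    by (rule dense_le_bounded[OF assms(1)]) (use le True in \<open>simp add: field_simps\<close>)
  with True show ?thesis by (simp add: field_simps)
next
  case False
  have "\<gamma> * x \<le> (\<gamma> / 2) * x"
    using False assms(1) by (intro mult_right_mono_neg) auto
  also have "\<dots> \<le> y"
    using assms(1) by (intro le) auto
  finally show ?thesis .
qed

context parabolic
begin

text \<open>
  Functionals on \<open>L2 T\<close> that are linear and bounded with respect to the energy norm.
\<close>

definition functional :: "((real \<Rightarrow> 'v) \<Rightarrow> real) \<Rightarrow> bool" where
  "functional g \<longleftrightarrow>
     (\<forall>v\<in>L2 T. \<forall>w\<in>L2 T. \<forall>r s. g (\<lambda>t. r *\<^sub>R v t + s *\<^sub>R w t) = r * g v + s * g w) \<and>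
     (\<exists>K. \<forall>v\<in>L2 T. norm_Y a T v \<le> 1 \<longrightarrow> \<bar>g v\<bar> \<le> K)"

lemma functional_dt_op: "w \<in> X_space j T \<Longrightarrow> functional (dt_op j a T w)"
  by (simp add: functional_def dt_op_bounded dt_op_combination_right)

lemma functional_combination:
  "functional g \<Longrightarrow> v \<in> L2 T \<Longrightarrow> w \<in> L2 T \<Longrightarrow> g (\<lambda>t. r *\<^sub>R v t + s *\<^sub>R w t) = r * g v + s * g w"
  by (simp add: functional_def)

lemma functional_scaleR: "functional g \<Longrightarrow> v \<in> L2 T \<Longrightarrow> g (\<lambda>t. r *\<^sub>R v t) = r * g v"
  using functional_combination[of g v v r 0] by simp

lemma L2_scaleR: "v \<in> L2 T \<Longrightarrow> (\<lambda>t. r *\<^sub>R v t) \<in> L2 T" for v :: "real \<Rightarrow> 'v"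
  using L2_combination[of v T v r 0] by simp

lemma norm_Y_nonneg: "v \<in> L2 T \<Longrightarrow> 0 \<le> norm_Y a T v"
  by (simp add: norm_Y_def As_op_nonneg)

lemma norm_Y_zero: "norm_Y a T (\<lambda>t. 0) = 0"
  using norm_Y_scaleR[OF L2_const, of 0 0] by simp

lemma unit_ball_nonempty: "{v \<in> Y_space T. norm_Y a T v \<le> 1} \<noteq> {}"
  using L2_const[of 0 T] norm_Y_zero by (force simp: Y_space_def)

lemma functional_bdd_above:
  assumes "functional g"
  shows "bdd_above ((\<lambda>v. \<bar>g v\<bar>) ` {v \<in> Y_space T. norm_Y a T v \<le> 1})"
proof -
  obtain K where "\<forall>v\<in>L2 T. norm_Y a T v \<le> 1 \<longrightarrow> \<bar>g v\<bar> \<le> K"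
    using assms by (auto simp: functional_def)
  then show ?thesis
    by (intro bdd_aboveI[of _ K]) (auto simp: Y_space_def)
qed

lemma abs_functional_le_norm_unit:
  assumes "functional g" "v \<in> L2 T" "norm_Y a T v \<le> 1"
  shows "\<bar>g v\<bar> \<le> norm_Y_dual a T g"
  unfolding norm_Y_dual_def using assms
  by (intro cSUP_upper functional_bdd_above) (auto simp: Y_space_def)

lemma norm_Y_dual_nonneg: "functional g \<Longrightarrow> 0 \<le> norm_Y_dual a T g"
  using abs_functional_le_norm_unit[of g "\<lambda>t. 0"] L2_const[of 0 T] norm_Y_zero by fastforce

lemma abs_functional_le:
  assumes g: "functional g" and v: "v \<in> L2 T"
  shows "\<bar>g v\<bar> \<le> norm_Y_dual a T g * norm_Y a T v"
proof (cases "norm_Y a T v = 0")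
  case True
  \<comment> \<open>Then all multiples of \<open>v\<close> lie in the unit ball, on which \<open>g\<close> is bounded.\<close>
  have "r * \<bar>g v\<bar> \<le> norm_Y_dual a T g" if "r \<ge> 0" for r
    using abs_functional_le_norm_unit[OF g L2_scaleR[OF v], of r] True that
    by (simp add: norm_Y_scaleR[OF v] functional_scaleR[OF g v] abs_mult)
  from this[of "(norm_Y_dual a T g + 1) / \<bar>g v\<bar>"] have "g v = 0"
    using norm_Y_dual_nonneg[OF g] by (cases "g v = 0") auto
  then show ?thesis using True by simp
next
  case False
  then have pos: "norm_Y a T v > 0"
    using norm_Y_nonneg[OF v] by simp
  have "\<bar>g (\<lambda>t. (1 / norm_Y a T v) *\<^sub>R v t)\<bar> \<le> norm_Y_dual a T g"
    using pos by (intro abs_functional_le_norm_unit g L2_scaleR v) (simp add: norm_Y_scaleR[OF v])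
  then show ?thesis
    using pos by (simp only: functional_scaleR[OF g v]) (simp add: abs_mult field_simps)
qed

text \<open>
  The squared dual norm is the supremum of \<open>2 g v - \<parallel>v\<parallel>\<^sup>2\<close>.
\<close>

lemma norm_Y_dual_square_ge:
  assumes g: "functional g" and v: "v \<in> L2 T"
  shows "2 * g v - As_op a T v v \<le> (norm_Y_dual a T g)\<^sup>2"
proof -
  have "2 * g v \<le> 2 * norm_Y_dual a T g * norm_Y a T v"
    using abs_functional_le[OF g v] by simp
  also have "\<dots> \<le> (norm_Y_dual a T g)\<^sup>2 + (norm_Y a T v)\<^sup>2"
    by (rule sum_squares_bound)
  finally show ?thesis by (simp add: norm_Y_square[OF v])
qed

lemma norm_Y_dual_square_approx:
  assumes g: "functional g" and \<epsilon>: "\<epsilon> > 0"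
  shows "\<exists>v\<in>L2 T. (norm_Y_dual a T g)\<^sup>2 - \<epsilon> < 2 * g v - As_op a T v v"
proof (cases "norm_Y_dual a T g = 0")
  case True
  have "g (\<lambda>t. 0) = 0"
    using functional_scaleR[OF g L2_const, of 0 0] by simp
  moreover have "As_op a T (\<lambda>t. 0) (\<lambda>t. 0) = 0"
    using norm_Y_square[OF L2_const, of 0] norm_Y_zero by simp
  ultimately show ?thesis
    using True \<epsilon> L2_const[of 0 T] by (intro bexI[of _ "\<lambda>t. 0"]) auto
next
  case False
  define N where "N = norm_Y_dual a T g"
  have N: "N > 0"
    using False norm_Y_dual_nonneg[OF g] by (simp add: N_def)
  have "0 < \<epsilon> / (2 * N)"
    using N \<epsilon> by simp
  then have "N - \<epsilon> / (2 * N) < norm_Y_dual a T g"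
    by (simp add: N_def)
  then have "\<exists>v\<in>{v \<in> Y_space T. norm_Y a T v \<le> 1}. N - \<epsilon> / (2 * N) < \<bar>g v\<bar>"
    unfolding norm_Y_dual_def
    by (rule less_cSUP_iff[OF unit_ball_nonempty functional_bdd_above[OF g], THEN iffD1])
  then obtain v where v: "v \<in> L2 T" "norm_Y a T v \<le> 1" and gv: "N - \<epsilon> / (2 * N) < \<bar>g v\<bar>"
    by (auto simp: Y_space_def)
  define r where "r = N * sgn (g v)"
  have "As_op a T v v \<le> 1"
    using v norm_Y_nonneg[OF v(1)] by (simp add: norm_Y_square[OF v(1), symmetric] power_le_one)
  moreover have "r\<^sup>2 \<le> N\<^sup>2"
    by (simp add: r_def power_mult_distrib sgn_if)
  ultimately have A: "r\<^sup>2 * As_op a T v v \<le> N\<^sup>2"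
    using mult_mono[of "r\<^sup>2" "N\<^sup>2" "As_op a T v v" 1] As_op_nonneg[OF v(1)] by simp
  have "N\<^sup>2 - \<epsilon> = 2 * N * (N - \<epsilon> / (2 * N)) - N\<^sup>2"
    using N by (simp add: power2_eq_square field_simps)
  also have "\<dots> < 2 * N * \<bar>g v\<bar> - N\<^sup>2"
    using gv N by simp
  also have "2 * N * \<bar>g v\<bar> = 2 * (r * g v)"
    by (simp add: r_def abs_sgn mult.commute mult.left_commute)
  finally have "N\<^sup>2 - \<epsilon> < 2 * (r * g v) - r\<^sup>2 * As_op a T v v"
    using A by linarith
  moreover have "As_op a T (\<lambda>t. r *\<^sub>R v t) (\<lambda>t. r *\<^sub>R v t) = r\<^sup>2 * As_op a T v v"
    using As_op_square[OF v(1) v(1), of r 0] by simp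
  ultimately show ?thesis
    using L2_scaleR[OF v(1), of r]
    by (intro bexI[of _ "\<lambda>t. r *\<^sub>R v t"]) (simp_all add: functional_scaleR[OF g v(1)] N_def)
qed

text \<open>
  Stewart's identity, one half of it, for the dual norm.  It holds because a linear substitution
  turns the two suprema on the left into those on the right.
\<close>

lemma norm_Y_dual_stewart:
  assumes g: "functional g" and h: "functional h" and k: "functional k" and d: "functional d"
    and k_eq: "\<And>v. v \<in> L2 T \<Longrightarrow> k v = (1 - s) * g v + s * h v"
    and d_eq: "\<And>v. v \<in> L2 T \<Longrightarrow> d v = h v - g v"
    and s: "0 \<le> s" "s \<le> 1"
  shows "(1 - s) * (norm_Y_dual a T g)\<^sup>2 + s * (norm_Y_dual a T h)\<^sup>2 \<le>
    (norm_Y_dual a T k)\<^sup>2 + s * (1 - s) * (norm_Y_dual a T d)\<^sup>2"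
proof (rule field_le_epsilon)
  fix \<epsilon> :: real assume \<epsilon>: "\<epsilon> > 0"
  obtain v where v: "v \<in> L2 T" "(norm_Y_dual a T g)\<^sup>2 - \<epsilon> < 2 * g v - As_op a T v v"
    using norm_Y_dual_square_approx[OF g \<epsilon>] by blast
  obtain w where w: "w \<in> L2 T" "(norm_Y_dual a T h)\<^sup>2 - \<epsilon> < 2 * h w - As_op a T w w"
    using norm_Y_dual_square_approx[OF h \<epsilon>] by blast
  define p where "p = (\<lambda>t. 1 *\<^sub>R w t + (-1) *\<^sub>R v t)"
  define q where "q = (\<lambda>t. (1 - s) *\<^sub>R v t + s *\<^sub>R w t)"
  have p: "p \<in> L2 T" and q: "q \<in> L2 T"
    unfolding p_def q_def by (intro L2_combination v w)+
  have fp: "f p = f w - f v" and fq: "f q = (1 - s) * f v + s * f w" if "functional f" for f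
    using functional_combination[OF that w(1) v(1), of 1 "-1"] functional_combination[OF that v(1) w(1)]
    by (simp_all add: p_def q_def)
  have pp: "As_op a T p p = As_op a T w w - 2 * As_op a T v w + As_op a T v v"
    unfolding p_def by (subst As_op_square[OF w(1) v(1)]) (simp add: As_op_sym)
  have qq: "As_op a T q q = (1 - s)\<^sup>2 * As_op a T v v + 2 * (1 - s) * s * As_op a T v w + s\<^sup>2 * As_op a T w w"
    unfolding q_def by (rule As_op_square[OF v(1) w(1)])
  have "(1 - s) * (2 * g v - As_op a T v v) + s * (2 * h w - As_op a T w w) =
      (2 * k q - As_op a T q q) + s * (1 - s) * (2 * d p - As_op a T p p)"
    unfolding pp qq k_eq[OF q] d_eq[OF p] fp[OF g] fp[OF h] fq[OF g] fq[OF h]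
    by (simp add: power2_eq_square algebra_simps)
  also have "\<dots> \<le> (norm_Y_dual a T k)\<^sup>2 + s * (1 - s) * (norm_Y_dual a T d)\<^sup>2"
    using s by (intro add_mono mult_left_mono norm_Y_dual_square_ge k d p q) auto
  finally have 1: "(1 - s) * (2 * g v - As_op a T v v) + s * (2 * h w - As_op a T w w) \<le>
      (norm_Y_dual a T k)\<^sup>2 + s * (1 - s) * (norm_Y_dual a T d)\<^sup>2" .
  have "(1 - s) * ((norm_Y_dual a T g)\<^sup>2 - \<epsilon>) + s * ((norm_Y_dual a T h)\<^sup>2 - \<epsilon>) \<le>
      (1 - s) * (2 * g v - As_op a T v v) + s * (2 * h w - As_op a T w w)"
    using s v(2) w(2) by (intro add_mono mult_left_mono) auto
  with 1 show "(1 - s) * (norm_Y_dual a T g)\<^sup>2 + s * (norm_Y_dual a T h)\<^sup>2 \<le>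
      (norm_Y_dual a T k)\<^sup>2 + s * (1 - s) * (norm_Y_dual a T d)\<^sup>2 + \<epsilon>"
    by (simp add: algebra_simps)
qed

lemma norm_X_square:
  assumes "w \<in> X_space j T"
  shows "(norm_X j a T w)\<^sup>2 =
    As_op a T w w + (norm_Y_dual a T (dt_op j a T w))\<^sup>2 + (norm (time_trace j T T w))\<^sup>2"
  using As_op_nonneg[OF X_space_L2[OF assms]] by (simp add: norm_X_def norm_Y_square[OF X_space_L2[OF assms]])

lemma norm_X_nonneg: "0 \<le> norm_X j a T w"
  by (simp add: norm_X_def)

lemma norm_X_stewart:
  assumes x: "x \<in> X_space j T" and y: "y \<in> X_space j T" and s: "0 \<le> s" "s \<le> 1"
  shows "(1 - s) * (norm_X j a T x)\<^sup>2 + s * (norm_X j a T y)\<^sup>2 \<le>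
    (norm_X j a T (\<lambda>t. (1 - s) *\<^sub>R x t + s *\<^sub>R y t))\<^sup>2 + s * (1 - s) * (norm_X j a T (\<lambda>t. y t - x t))\<^sup>2"
proof -
  define k where "k = (\<lambda>t. (1 - s) *\<^sub>R x t + s *\<^sub>R y t)"
  define d where "d = (\<lambda>t. 1 *\<^sub>R y t + (-1) *\<^sub>R x t)"
  note xL = X_space_L2[OF x] and yL = X_space_L2[OF y]
  have k: "k \<in> X_space j T" and d: "d \<in> X_space j T"
    unfolding k_def d_def by (intro X_space_combination x y)+
  have "(1 - s) * (norm_Y_dual a T (dt_op j a T x))\<^sup>2 + s * (norm_Y_dual a T (dt_op j a T y))\<^sup>2 \<le>
      (norm_Y_dual a T (dt_op j a T k))\<^sup>2 + s * (1 - s) * (norm_Y_dual a T (dt_op j a T d))\<^sup>2"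
  proof (intro norm_Y_dual_stewart functional_dt_op x y k d s)
    fix v :: "real \<Rightarrow> 'v" assume v: "v \<in> L2 T"
    show "dt_op j a T k v = (1 - s) * dt_op j a T x v + s * dt_op j a T y v"
      unfolding k_def by (rule dt_op_combination_left[OF x y v])
    show "dt_op j a T d v = dt_op j a T y v - dt_op j a T x v"
      unfolding d_def by (subst dt_op_combination_left[OF y x v]) simp
  qed
  moreover have "(1 - s) * As_op a T x x + s * As_op a T y y = As_op a T k k + s * (1 - s) * As_op a T d d"
    unfolding k_def d_def As_op_square[OF xL yL] As_op_square[OF yL xL] As_op_sym[of y x]
    by (simp add: power2_eq_square algebra_simps)
  moreover have "(1 - s) * (norm (time_trace j T T x))\<^sup>2 + s * (norm (time_trace j T T y))\<^sup>2 =
      (norm (time_trace j T T k))\<^sup>2 + s * (1 - s) * (norm (time_trace j T T d))\<^sup>2"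
  proof -
    have T: "T \<in> {0..T}" using T_pos by simp
    show ?thesis
      unfolding k_def d_def time_trace_combination[OF T_pos x y T] time_trace_combination[OF T_pos y x T]
        power2_norm_eq_inner
      by (simp add: inner_simps inner_commute algebra_simps)
  qed
  moreover have "(\<lambda>t. y t - x t) = d"
    by (simp add: d_def)
  ultimately show ?thesis
    unfolding k_def[symmetric] by (simp add: norm_X_square x y k d algebra_simps)
qed

text \<open>
  Testing the parabolic operator gives lower bounds of the energy norm, because
  \<open>\<parallel>x\<parallel>\<^sub>X\<^sup>2 = \<parallel>B x\<parallel>\<^sub>Y'\<^sup>2 + \<parallel>x(0)\<parallel>\<^sup>2\<close> for symmetric forms.
\<close>

lemma norm_X_square_ge:
  assumes sym: "\<forall>w\<in>Y_space T. \<forall>v\<in>Y_space T. A_op a T w v = As_op a T w v"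
    and x: "x \<in> X_space j T" and v: "v \<in> L2 T"
  shows "2 * B_op j a T x v - As_op a T v v + (norm (time_trace j T 0 x))\<^sup>2 \<le> (norm_X j a T x)\<^sup>2"
proof -
  note xL = X_space_L2[OF x]
  define p where "p = (\<lambda>t. 1 *\<^sub>R v t + (-1) *\<^sub>R x t)"
  have p: "p \<in> L2 T"
    unfolding p_def by (intro L2_combination v xL)
  have "dt_op j a T x p = dt_op j a T x v - dt_op j a T x x"
    unfolding p_def by (subst dt_op_combination_right[OF x v xL]) simp
  moreover have "As_op a T p p = As_op a T v v - 2 * As_op a T x v + As_op a T x x"
    unfolding p_def by (subst As_op_square[OF v xL]) (simp add: As_op_sym)
  moreover have "B_op j a T x v = dt_op j a T x v + As_op a T x v"
    using sym xL v by (simp add: dt_op_def Y_space_def)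
  ultimately show ?thesis
    using norm_Y_dual_square_ge[OF functional_dt_op[OF x] p] dt_op_energy[OF x]
    by (simp add: norm_X_square[OF x])
qed

section \<open>The inf-sup condition\<close>

text \<open>
  The quotient in the inf-sup condition.
\<close>

definition inf_sup_quotient :: "(real \<Rightarrow> 'v) \<Rightarrow> (real \<Rightarrow> 'v) \<Rightarrow> real" where
  "inf_sup_quotient w v = dt_op j a T w v / (norm_Y_dual a T (dt_op j a T w) * norm_Y a T v)"

lemma abs_inf_sup_quotient_le:
  assumes w: "w \<in> X_space j T" and v: "v \<in> L2 T"
  shows "\<bar>inf_sup_quotient w v\<bar> \<le> 1"
proof -
  let ?N = "norm_Y_dual a T (dt_op j a T w) * norm_Y a T v"
  have N: "0 \<le> ?N"
    by (intro mult_nonneg_nonneg norm_Y_dual_nonneg norm_Y_nonneg functional_dt_op w v)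
  then have "\<bar>inf_sup_quotient w v\<bar> = \<bar>dt_op j a T w v\<bar> / ?N"
    unfolding inf_sup_quotient_def by (simp only: abs_divide abs_of_nonneg)
  also have "\<dots> \<le> 1"
    using abs_functional_le[OF functional_dt_op[OF w] v] N by (intro divide_le_eq_1[THEN iffD2]) linarith
  finally show ?thesis .
qed

lemma trial_not_AE_zero:
  assumes w: "w \<in> X_space j T" and v: "v \<in> Y_space T" and nz: "dt_op j a T w v \<noteq> 0"
  shows "\<not> (AE t in time_measure T. w t = 0)"
  using dt_op_AE_zero[OF w] v nz by (auto simp: Y_space_def)

lemma sup_quotient_bounds:
  assumes Xd: "Xd \<subseteq> X_space j T" and Yd: "Yd \<subseteq> L2 T" and sub: "Xd \<subseteq> Yd"
    and w: "w \<in> Xd" "\<exists>v\<in>Y_space T. dt_op j a T w v \<noteq> 0"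
  defines "A \<equiv> {v \<in> Yd. \<not> (AE t in time_measure T. v t = 0)}"
  shows "A \<noteq> {}" and "-1 \<le> (SUP v\<in>A. inf_sup_quotient w v)" and "(SUP v\<in>A. inf_sup_quotient w v) \<le> 1"
proof -
  have wX: "w \<in> X_space j T" using Xd w by blast
  then have wA: "w \<in> A"
    using trial_not_AE_zero w sub by (auto simp: A_def)
  then show ne: "A \<noteq> {}" by blast
  have "A \<subseteq> L2 T" using Yd by (auto simp: A_def)
  then have b: "-1 \<le> inf_sup_quotient w v \<and> inf_sup_quotient w v \<le> 1" if "v \<in> A" for v
    using abs_inf_sup_quotient_le[OF wX, of v] that by auto
  then show "(SUP v\<in>A. inf_sup_quotient w v) \<le> 1"
    by (intro cSUP_least ne) auto
  show "-1 \<le> (SUP v\<in>A. inf_sup_quotient w v)"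
    using b b[OF wA] by (intro cSUP_upper2[OF _ wA] bdd_aboveI[of _ 1]) auto
qed

lemma inf_sup_bounds:
  assumes Xd: "Xd \<subseteq> X_space j T" and Yd: "Yd \<subseteq> L2 T" and sub: "Xd \<subseteq> Yd"
  shows "-1 \<le> inf_sup j a T Yd Xd" and "inf_sup j a T Yd Xd \<le> 1"
    and "w \<in> Xd \<Longrightarrow> \<exists>v\<in>Y_space T. dt_op j a T w v \<noteq> 0 \<Longrightarrow>
      inf_sup j a T Yd Xd \<le> (SUP v\<in>{v \<in> Yd. \<not> (AE t in time_measure T. v t = 0)}. inf_sup_quotient w v)"
proof -
  define U where "U = {w \<in> Xd. \<exists>v\<in>Y_space T. dt_op j a T w v \<noteq> 0}"
  define S where "S = (\<lambda>w. SUP v\<in>{v \<in> Yd. \<not> (AE t in time_measure T. v t = 0)}. inf_sup_quotient w v)"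
  have eq: "inf_sup j a T Yd Xd = (if U = {} then 1 else INF w\<in>U. S w)"
    by (simp only: inf_sup_def Let_def U_def S_def inf_sup_quotient_def)
  have S: "-1 \<le> S w" "S w \<le> 1" if "w \<in> U" for w
    using sup_quotient_bounds[OF Xd Yd sub, of w] that by (auto simp: U_def S_def)
  have low: "(INF w\<in>U. S w) \<le> S w" if "w \<in> U" for w
    using S that by (intro cINF_lower bdd_belowI[of _ "-1"]) auto
  show "-1 \<le> inf_sup j a T Yd Xd"
    using S by (auto simp: eq intro!: cINF_greatest)
  show "inf_sup j a T Yd Xd \<le> 1"
    using low S by (auto simp: eq intro: order_trans)
  show "inf_sup j a T Yd Xd \<le> (SUP v\<in>{v \<in> Yd. \<not> (AE t in time_measure T. v t = 0)}. inf_sup_quotient w v)"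
    if "w \<in> Xd" "\<exists>v\<in>Y_space T. dt_op j a T w v \<noteq> 0"
  proof -
    have "w \<in> U" using that by (simp add: U_def)
    with low[OF this] show ?thesis by (auto simp: eq S_def)
  qed
qed

lemma inf_sup_test_function:
  assumes Xd: "Xd \<subseteq> X_space j T" and Yd: "closed_subspace_of (Y_space T) (norm_Y a T) Yd" and sub: "Xd \<subseteq> Yd"
    and \<eta>: "0 < \<eta>" "\<eta> < inf_sup j a T Yd Xd" and w: "w \<in> Xd"
  shows "\<exists>v\<in>Yd. \<eta>\<^sup>2 * (norm_Y_dual a T (dt_op j a T w))\<^sup>2 \<le> 2 * dt_op j a T w v - As_op a T v v"
proof -
  define N where "N = norm_Y_dual a T (dt_op j a T w)"
  have wX: "w \<in> X_space j T" using Xd w by blast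
  have YdL: "Yd \<subseteq> L2 T" and scale: "\<And>r v. v \<in> Yd \<Longrightarrow> (\<lambda>t. r *\<^sub>R v t) \<in> Yd" and zero: "(\<lambda>t. 0) \<in> Yd"
    using Yd by (auto simp: closed_subspace_of_def Y_space_def)
  show ?thesis
  proof (cases "\<exists>v\<in>Y_space T. dt_op j a T w v \<noteq> 0")
    case False
    then have z: "dt_op j a T w v = 0" if "v \<in> Y_space T" for v
      using that by blast
    have "N = (SUP v\<in>{v \<in> Y_space T. norm_Y a T v \<le> 1}. 0)"
      unfolding N_def norm_Y_dual_def by (rule SUP_cong) (auto simp: z)
    then have "N = 0"
      using unit_ball_nonempty by simp
    moreover have "As_op a T (\<lambda>t. 0) (\<lambda>t. 0) = 0"
      using norm_Y_square[OF L2_const, of 0] norm_Y_zero by simp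
    moreover have "dt_op j a T w (\<lambda>t. 0) = 0"
      by (rule z) (simp add: Y_space_def L2_const)
    ultimately show ?thesis
      using zero by (intro bexI[of _ "\<lambda>t. 0"]) (simp_all add: N_def)
  next
    case True
    let ?A = "{v \<in> Yd. \<not> (AE t in time_measure T. v t = 0)}"
    have "\<eta> < (SUP v\<in>?A. inf_sup_quotient w v)"
      using \<eta>(2) inf_sup_bounds(3)[OF Xd YdL sub w True] by simp
    then obtain v where v: "v \<in> Yd" and q: "\<eta> < inf_sup_quotient w v"
      using less_cSupD[of "inf_sup_quotient w ` ?A" \<eta>] sup_quotient_bounds(1)[OF Xd YdL sub w True] by auto
    have vL: "v \<in> L2 T" using v YdL by blast
    define n where "n = norm_Y a T v"
    have "n \<noteq> 0" "N \<noteq> 0"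
      using q \<eta>(1) by (auto simp: inf_sup_quotient_def n_def N_def)
    then have n: "n > 0" and N: "N > 0"
      using norm_Y_nonneg[OF vL] norm_Y_dual_nonneg[OF functional_dt_op[OF wX]] by (auto simp: n_def N_def)
    have dt: "\<eta> * (N * n) \<le> dt_op j a T w v"
      using q n N by (simp add: inf_sup_quotient_def n_def[symmetric] N_def[symmetric] less_divide_eq)
    \<comment> \<open>This multiple of \<open>v\<close> has energy norm \<open>\<eta> * N\<close>.\<close>
    define r where "r = \<eta> * N / n"
    have "As_op a T (\<lambda>t. r *\<^sub>R v t) (\<lambda>t. r *\<^sub>R v t) = r\<^sup>2 * As_op a T v v"
      using As_op_square[OF vL vL, of r 0] by simp
    also have "\<dots> = (\<eta> * N)\<^sup>2"
      using n by (simp add: norm_Y_square[OF vL, symmetric] n_def[symmetric] r_def power_divide)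
    finally have A: "As_op a T (\<lambda>t. r *\<^sub>R v t) (\<lambda>t. r *\<^sub>R v t) = (\<eta> * N)\<^sup>2" .
    have "(\<eta> * N)\<^sup>2 = r * (\<eta> * (N * n))"
      using n by (simp add: r_def power2_eq_square)
    also have "\<dots> \<le> r * dt_op j a T w v"
      using n N \<eta>(1) by (intro mult_left_mono dt) (simp add: r_def)
    finally have "(\<eta> * N)\<^sup>2 \<le> dt_op j a T w (\<lambda>t. r *\<^sub>R v t)"
      by (simp add: functional_scaleR[OF functional_dt_op[OF wX] vL])
    with A show ?thesis
      using scale[OF v, of r] by (intro bexI[of _ "\<lambda>t. r *\<^sub>R v t"]) (auto simp: N_def power_mult_distrib)
  qed
qed

section \<open>Quasi-optimality\<close>

text \<open>
  The error \<open>e\<close> of the Galerkin solution cannot be cancelled by an element of the trial space.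
  Writing \<open>b(x)\<close> for what \<open>\<parallel>B x\<parallel>\<^sup>2 + \<parallel>x(0)\<parallel>\<^sup>2\<close> becomes when the dual norm is
  taken over \<open>Yd\<close> only, the Galerkin equations say that \<open>e\<close> is \<open>b\<close>-orthogonal to \<open>Xd\<close>, and
  \<open>\<eta>\<^sup>2 * \<parallel>w\<parallel>\<^sub>X\<^sup>2 \<le> b(w) \<le> b(e + w) \<le> \<parallel>e + w\<parallel>\<^sub>X\<^sup>2\<close>.
\<close>

lemma galerkin_error_transversal:
  assumes sym: "\<forall>w\<in>Y_space T. \<forall>v\<in>Y_space T. A_op a T w v = As_op a T w v"
    and Xd: "Xd \<subseteq> X_space j T" and Yd: "closed_subspace_of (Y_space T) (norm_Y a T) Yd" and sub: "Xd \<subseteq> Yd"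
    and \<eta>: "0 < \<eta>" "\<eta> \<le> 1" "\<eta> < inf_sup j a T Yd Xd"
    and e: "e \<in> X_space j T" and w: "w \<in> Xd" and \<mu>: "\<mu> \<in> Yd"
    and eq1: "\<forall>v\<in>Yd. B_op j a T e v = As_op a T \<mu> v"
    and eq2: "time_trace j T 0 e \<bullet> time_trace j T 0 w = \<sigma> \<bullet> time_trace j T 0 w"
    and eq3: "B_op j a T w \<mu> + time_trace j T 0 w \<bullet> \<sigma> = 0"
  shows "\<eta>\<^sup>2 * (norm_X j a T w)\<^sup>2 \<le> (norm_X j a T (\<lambda>t. e t + w t))\<^sup>2"
proof -
  have wX: "w \<in> X_space j T" and wY: "w \<in> Yd" using Xd sub w by auto
  have YdL: "Yd \<subseteq> L2 T" and add: "\<And>v z. v \<in> Yd \<Longrightarrow> z \<in> Yd \<Longrightarrow> (\<lambda>t. v t + z t) \<in> Yd"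
    using Yd by (auto simp: closed_subspace_of_def Y_space_def)
  obtain v where v: "v \<in> Yd"
    and v_le: "\<eta>\<^sup>2 * (norm_Y_dual a T (dt_op j a T w))\<^sup>2 \<le> 2 * dt_op j a T w v - As_op a T v v"
    using inf_sup_test_function[OF Xd Yd sub \<eta>(1,3) w] by blast
  \<comment> \<open>On \<open>Yd\<close>, \<open>B e\<close> is represented by \<open>\<mu>\<close> and \<open>A w\<close> by \<open>w\<close>, so test \<open>B (e + w)\<close> with \<open>\<mu> + w + v\<close>.\<close>
  define y where "y = (\<lambda>t. w t + v t)"
  define z where "z = (\<lambda>t. \<mu> t + y t)"
  define x where "x = (\<lambda>t. e t + w t)"
  have y: "y \<in> Yd" and z: "z \<in> Yd"
    unfolding z_def y_def by (intro add \<mu> wY v)+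
  note L = subsetD[OF YdL]
  have x: "x \<in> X_space j T"
    unfolding x_def using X_space_combination[OF e wX, of 1 1] by simp
  have B: "B_op j a T u p = dt_op j a T u p + As_op a T u p" if "u \<in> X_space j T" "p \<in> L2 T" for u p
    using sym X_space_L2[OF that(1)] that(2) by (simp add: dt_op_def Y_space_def)
  have "B_op j a T x z = B_op j a T e z + B_op j a T w z"
    using dt_op_combination_left[OF e wX L[OF z], of 1 1]
      As_op_combination_left[OF X_space_L2[OF e] X_space_L2[OF wX] L[OF z], of 1 1]
    by (simp add: B x e wX L[OF z]) (simp add: x_def)
  moreover have "B_op j a T e z = As_op a T \<mu> \<mu> + As_op a T \<mu> y"
    using eq1 z As_op_combination_right[OF L[OF \<mu>] L[OF y] L[OF \<mu>], of 1 1] by (simp add: z_def)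
  moreover have "B_op j a T w z = B_op j a T w \<mu> + B_op j a T w y"
    using dt_op_combination_right[OF wX L[OF \<mu>] L[OF y], of 1 1]
      As_op_combination_right[OF L[OF \<mu>] L[OF y] X_space_L2[OF wX], of 1 1]
    by (simp add: B wX L[OF z] L[OF \<mu>] L[OF y]) (simp add: z_def)
  moreover have "As_op a T z z = As_op a T \<mu> \<mu> + 2 * As_op a T \<mu> y + As_op a T y y"
    using As_op_square[OF L[OF \<mu>] L[OF y], of 1 1] by (simp add: z_def)
  moreover have "B_op j a T w y = dt_op j a T w w + dt_op j a T w v + As_op a T w w + As_op a T w v"
    using dt_op_combination_right[OF wX L[OF wY] L[OF v], of 1 1]
      As_op_combination_right[OF L[OF wY] L[OF v] X_space_L2[OF wX], of 1 1]
    by (simp add: B[OF wX L[OF y]]) (simp add: y_def)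
  moreover have "As_op a T y y = As_op a T w w + 2 * As_op a T w v + As_op a T v v"
    using As_op_square[OF L[OF wY] L[OF v], of 1 1] by (simp add: y_def)
  moreover have "(norm (time_trace j T 0 x))\<^sup>2 = (norm (time_trace j T 0 e))\<^sup>2 +
      2 * (\<sigma> \<bullet> time_trace j T 0 w) + (norm (time_trace j T 0 w))\<^sup>2"
    using time_trace_combination[OF T_pos e wX, of 0 1 1] T_pos eq2
    by (simp add: x_def power2_norm_eq_inner inner_simps inner_commute)
  ultimately have "As_op a T \<mu> \<mu> + (norm (time_trace j T 0 e))\<^sup>2 + As_op a T w w +
      (2 * dt_op j a T w v - As_op a T v v) + (2 * dt_op j a T w w + (norm (time_trace j T 0 w))\<^sup>2)
      \<le> (norm_X j a T x)\<^sup>2"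
    using norm_X_square_ge[OF sym x L[OF z]] eq3 by (simp add: inner_commute)
  moreover have "2 * dt_op j a T w w + (norm (time_trace j T 0 w))\<^sup>2 = (norm (time_trace j T T w))\<^sup>2"
    using dt_op_energy[OF wX] by simp
  moreover have "\<eta>\<^sup>2 * (norm_X j a T w)\<^sup>2 \<le> As_op a T w w +
      \<eta>\<^sup>2 * (norm_Y_dual a T (dt_op j a T w))\<^sup>2 + (norm (time_trace j T T w))\<^sup>2"
  proof -
    have "\<eta>\<^sup>2 \<le> 1" using \<eta> by (simp add: power_le_one)
    then have "\<eta>\<^sup>2 * As_op a T w w \<le> 1 * As_op a T w w"
      "\<eta>\<^sup>2 * (norm (time_trace j T T w))\<^sup>2 \<le> 1 * (norm (time_trace j T T w))\<^sup>2"
      using As_op_nonneg[OF X_space_L2[OF wX]] by (intro mult_right_mono; simp)+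
    then show ?thesis
      by (simp add: norm_X_square[OF wX] distrib_left)
  qed
  ultimately have "\<eta>\<^sup>2 * (norm_X j a T w)\<^sup>2 \<le> (norm_X j a T x)\<^sup>2"
    using v_le As_op_nonneg[OF L[OF \<mu>]] zero_le_power2[of "norm (time_trace j T 0 e)"] by linarith
  then show ?thesis by (simp only: x_def)
qed

text \<open>
  From an error that is uniformly transversal to the trial space to quasi-optimality with the same
  constant.  This is the argument that a projector and its complement have equal norms.
\<close>

lemma quasi_optimal_if_transversal:
  assumes e: "e \<in> X_space j T" and w: "w \<in> X_space j T"
    and \<eta>: "0 < \<eta>" "\<eta> < 1"
    and trans: "\<And>r. \<eta>\<^sup>2 * (norm_X j a T (\<lambda>t. r *\<^sub>R w t))\<^sup>2 \<le> (norm_X j a T (\<lambda>t. e t + r *\<^sub>R w t))\<^sup>2"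
  shows "\<eta> * norm_X j a T e \<le> norm_X j a T (\<lambda>t. e t + w t)"
proof -
  \<comment> \<open>With this weight the multiples of \<open>\<parallel>r w\<parallel>\<^sup>2\<close> on both sides cancel.\<close>
  define s where "s = 1 - \<eta>\<^sup>2"
  have "\<eta>\<^sup>2 < 1" using \<eta> by (simp add: power_less_one_iff)
  then have s: "0 < s" "s \<le> 1" by (simp_all add: s_def)
  define r where "r = 1 / s"
  define y where "y = (\<lambda>t. 1 *\<^sub>R e t + r *\<^sub>R w t)"
  have y: "y \<in> X_space j T"
    unfolding y_def by (rule X_space_combination[OF e w])
  have d: "(\<lambda>t. y t - e t) = (\<lambda>t. r *\<^sub>R w t)"
    by (simp add: y_def)
  have c: "(\<lambda>t. (1 - s) *\<^sub>R e t + s *\<^sub>R y t) = (\<lambda>t. e t + w t)"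
    using s by (simp add: y_def r_def scaleR_add_right flip: scaleR_add_left) (simp add: fun_eq_iff algebra_simps)
  have "(1 - s) * (norm_X j a T e)\<^sup>2 + s * (norm_X j a T y)\<^sup>2 \<le>
      (norm_X j a T (\<lambda>t. e t + w t))\<^sup>2 + s * (1 - s) * (norm_X j a T (\<lambda>t. r *\<^sub>R w t))\<^sup>2"
    using norm_X_stewart[OF e y, of s] s unfolding d c by simp
  moreover have "s * ((1 - s) * (norm_X j a T (\<lambda>t. r *\<^sub>R w t))\<^sup>2) \<le> s * (norm_X j a T y)\<^sup>2"
    using trans[of r] s by (intro mult_left_mono) (simp_all add: s_def y_def)
  ultimately have "(1 - s) * (norm_X j a T e)\<^sup>2 \<le> (norm_X j a T (\<lambda>t. e t + w t))\<^sup>2"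
    by (simp add: mult.assoc)
  then have "(\<eta> * norm_X j a T e)\<^sup>2 \<le> (norm_X j a T (\<lambda>t. e t + w t))\<^sup>2"
    by (simp add: s_def power_mult_distrib)
  then show ?thesis
    by (rule power2_le_imp_le) (rule norm_X_nonneg)
qed

end



theorem theorem3p7:
  fixes j :: "'v::{real_inner,banach,second_countable_topology} \<Rightarrow>\<^sub>L
              'h::{real_inner,banach,second_countable_topology}"
    and a :: "real \<Rightarrow> 'v \<Rightarrow> 'v \<Rightarrow> real"
    and T :: real
    and D :: "'d set"
    and Yd :: "'d \<Rightarrow> (real \<Rightarrow> 'v) set"
    and Hd :: "'d \<Rightarrow> 'h set"
    and Xd :: "'d \<Rightarrow> (real \<Rightarrow> 'v) set"
    and g :: "(real \<Rightarrow> 'v) \<Rightarrow> real"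
    and u0 :: 'h
    and u :: "real \<Rightarrow> 'v"
  assumes "T > 0"
    and "gelfand_embedding j"
    and "parabolic_form T a"
    and A_symmetric: "\<forall>w\<in>Y_space T. \<forall>v\<in>Y_space T. A_op a T w v = As_op a T w v"
    and "\<forall>d\<in>D. closed_subspace_of (Y_space T) (norm_Y a T) (Yd d)"
    and "\<forall>d\<in>D. subspace (Hd d) \<and> closed (Hd d)"
    and "\<forall>d\<in>D. closed_subspace_of (X_space j T) (norm_X j a T) (Xd d)"
    and "\<forall>d\<in>D. Xd d \<subseteq> Yd d"
    and "\<forall>d\<in>D. time_trace j T 0 ` Xd d \<subseteq> Hd d"
    and "gamma_Delta j a T D Yd Xd > 0"
    and "g \<in> Y_dual a T"
    and "u \<in> X_space j T"
    and "\<forall>v1\<in>Y_space T. \<forall>v2.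
           B_op j a T u v1 + time_trace j T 0 u \<bullet> v2 = g v1 + u0 \<bullet> v2"
  shows "\<forall>d\<in>D. \<forall>\<mu>\<in>Yd d. \<forall>\<sigma>\<in>Hd d. \<forall>ud\<in>Xd d.
           (\<forall>v1\<in>Yd d. As_op a T \<mu> v1 + B_op j a T ud v1 = g v1) \<and>
           (\<forall>v2\<in>Hd d. \<sigma> \<bullet> v2 + time_trace j T 0 ud \<bullet> v2 = u0 \<bullet> v2) \<and>
           (\<forall>w\<in>Xd d. B_op j a T w \<mu> + time_trace j T 0 w \<bullet> \<sigma> = 0) \<longrightarrow>
           norm_X j a T (\<lambda>t. u t - ud t) \<le>
             inverse (gamma_Delta j a T D Yd Xd) *
             (INF ubar\<in>Xd d. norm_X j a T (\<lambda>t. u t - ubar t))"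
proof -
  interpret parabolic j T a
    using assms(1-3) by unfold_locales
  let ?\<gamma> = "gamma_Delta j a T D Yd Xd"
  show ?thesis
  proof (intro ballI impI, elim conjE)
    fix d \<mu> \<sigma> ud
    assume d: "d \<in> D" and \<mu>: "\<mu> \<in> Yd d" and \<sigma>: "\<sigma> \<in> Hd d" and ud: "ud \<in> Xd d"
      and eq1: "\<forall>v1\<in>Yd d. As_op a T \<mu> v1 + B_op j a T ud v1 = g v1"
      and eq2: "\<forall>v2\<in>Hd d. \<sigma> \<bullet> v2 + time_trace j T 0 ud \<bullet> v2 = u0 \<bullet> v2"
      and eq3: "\<forall>w\<in>Xd d. B_op j a T w \<mu> + time_trace j T 0 w \<bullet> \<sigma> = 0"
    have X: "Xd c \<subseteq> X_space j T" and Y: "Yd c \<subseteq> L2 T" and sub: "Xd c \<subseteq> Yd c" if "c \<in> D" for c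
      using assms(5,7,8) that by (auto simp: closed_subspace_of_def Y_space_def)
    have Xadd: "\<And>v w. v \<in> Xd d \<Longrightarrow> w \<in> Xd d \<Longrightarrow> (\<lambda>t. v t + w t) \<in> Xd d"
      and Xscale: "\<And>r v. v \<in> Xd d \<Longrightarrow> (\<lambda>t. r *\<^sub>R v t) \<in> Xd d"
      using assms(7) d by (auto simp: closed_subspace_of_def)
    note uX = assms(12)
    have udX: "ud \<in> X_space j T" using X[OF d] ud by blast
    have \<gamma>_le: "?\<gamma> \<le> inf_sup j a T (Yd d) (Xd d)"
      unfolding gamma_Delta_def
      by (rule cINF_lower[OF _ d]) (auto intro!: bdd_belowI[of _ "-1"] inf_sup_bounds(1) X Y sub)
    then have \<gamma>1: "?\<gamma> \<le> 1"
      using inf_sup_bounds(2)[OF X[OF d] Y[OF d] sub[OF d]] by linarith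
    have zeroY: "(\<lambda>t. 0 :: 'v) \<in> L2 T"
      by (rule L2_const)
    have g0: "g (\<lambda>t. 0) = 0"
      using assms(11) zeroY by (fastforce simp: Y_dual_def Y_space_def)
    have u_trace: "time_trace j T 0 u \<bullet> v2 = u0 \<bullet> v2" for v2
    proof -
      have "B_op j a T u (\<lambda>t. 0) = 0"
        using assms(13) zeroY g0 by (auto simp: Y_space_def dest!: bspec[of _ _ "\<lambda>t. 0"] spec[of _ 0])
      then show ?thesis
        using assms(13) zeroY g0 by (auto simp: Y_space_def dest!: bspec[of _ _ "\<lambda>t. 0"] spec[of _ v2])
    qed
    have u_B: "B_op j a T u v = g v" if "v \<in> L2 T" for v
      using assms(13)[rule_format, of v 0] that by (simp add: Y_space_def)
    define e where "e = (\<lambda>t. 1 *\<^sub>R u t + (-1) *\<^sub>R ud t)"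
    have e: "e \<in> X_space j T"
      unfolding e_def by (rule X_space_combination[OF uX udX])
    have e_B: "\<forall>v\<in>Yd d. B_op j a T e v = As_op a T \<mu> v"
    proof
      fix v assume v: "v \<in> Yd d"
      then have vL: "v \<in> L2 T" using Y[OF d] by blast
      have "B_op j a T e v = B_op j a T u v - B_op j a T ud v"
        using dt_op_combination_left[OF uX udX vL, of 1 "-1"]
          A_op_combination_left[OF X_space_L2[OF uX] X_space_L2[OF udX] vL, of 1 "-1"]
        unfolding e_def[symmetric] dt_op_def by simp
      with eq1 v u_B[OF vL] show "B_op j a T e v = As_op a T \<mu> v" by force
    qed
    have e_trace: "time_trace j T 0 e \<bullet> time_trace j T 0 w = \<sigma> \<bullet> time_trace j T 0 w" if w: "w \<in> Xd d" for w
    proof -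
      have "time_trace j T 0 w \<in> Hd d" using assms(9) d w by blast
      then show ?thesis
        using eq2 u_trace[of "time_trace j T 0 w"] time_trace_combination[OF T_pos uX udX, of 0 1 "-1"] T_pos
        by (force simp: e_def inner_diff_left)
    qed
    have "?\<gamma> * norm_X j a T e \<le> norm_X j a T (\<lambda>t. u t - ubar t)" if ubar: "ubar \<in> Xd d" for ubar
    proof -
      define w where "w = (\<lambda>t. ud t + (-1) *\<^sub>R ubar t)"
      have w: "w \<in> Xd d"
        unfolding w_def by (intro Xadd Xscale ud ubar)
      have ew: "(\<lambda>t. e t + w t) = (\<lambda>t. u t - ubar t)"
        by (simp add: e_def w_def)
      \<comment> \<open>The supremum in the inf-sup condition need not be attained, so pass to the limit \<open>\<eta> \<rightarrow> \<gamma>\<close>.\<close>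
      have "\<eta> * norm_X j a T e \<le> norm_X j a T (\<lambda>t. u t - ubar t)" if \<eta>: "0 < \<eta>" "\<eta> < ?\<gamma>" for \<eta>
        unfolding ew[symmetric]
      proof (rule quasi_optimal_if_transversal[OF e])
        fix r
        have rw: "(\<lambda>t. r *\<^sub>R w t) \<in> Xd d" by (rule Xscale[OF w])
        show "\<eta>\<^sup>2 * (norm_X j a T (\<lambda>t. r *\<^sub>R w t))\<^sup>2 \<le> (norm_X j a T (\<lambda>t. e t + r *\<^sub>R w t))\<^sup>2"
          using \<eta> \<gamma>1 \<gamma>_le assms(5) d eq3 rw
          by (intro galerkin_error_transversal[OF A_symmetric X[OF d] _ sub[OF d] _ _ _ e rw \<mu> e_B e_trace[OF rw]]) auto
      qed (use \<eta> \<gamma>1 X[OF d] w in auto)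
      then show ?thesis
        by (rule mult_le_if_all_less[OF assms(10)])
    qed
    then have "?\<gamma> * norm_X j a T e \<le> (INF ubar\<in>Xd d. norm_X j a T (\<lambda>t. u t - ubar t))"
      using ud by (intro cINF_greatest) auto
    then have "norm_X j a T e \<le> inverse ?\<gamma> * (INF ubar\<in>Xd d. norm_X j a T (\<lambda>t. u t - ubar t))"
      using assms(10) by (simp add: field_simps)
    moreover have "e = (\<lambda>t. u t - ud t)"
      by (simp add: e_def)
    ultimately show "norm_X j a T (\<lambda>t. u t - ud t) \<le>
        inverse ?\<gamma> * (INF ubar\<in>Xd d. norm_X j a T (\<lambda>t. u t - ubar t))"
      by simp
  qed
qed

end
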